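(* Let $G=(a,b)$ be an invariant attractor ($G=G_-$ or $G=G_+$). The invariant measure of the process $\Xi(t)=(X(t),\xi(t))$ with support $G$ exists and is determined by the probability density functions $\pi_0(x),\pi_1(x)$ (i.e. in the stationary regime $\mathbb{P}\{X(t)\in dx,\xi(t)=i\}\equiv\pi_i(x)\,dx$, $i\in\{0,1\}$), where $$\pi_0(x)=C_0\,\frac{\Psi(x)^{-1}}{c_0-U'(x)},\qquad \pi_1(x)=C_1\,\frac{\Psi(x)^{-1}}{U'(x)-c_1},\qquad x\in G.$$ Here $\Psi(x)^{-1}=\exp(-\lambda_0\Phi_0(x)-\lambda_1\Phi_1(x))$, and $C_0,C_1$ are the normalising constants $$C_0=\frac{\lambda_1}{\lambda_0+\lambda_1}\left(\int_a^b\frac{\Psi(x)^{-1}\,dx}{c_0-U'(x)}\right)^{-1},\qquad C_1=\frac{\lambda_0}{\lambda_0+\lambda_1}\left(\int_a^b\frac{\Psi(x)^{-1}\,dx}{U'(x)-c_1}\right)^{-1}.$$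
   Context: Let $U\in C^2(-\infty,\infty)$ be a double-well potential: it has a local maximum at $x_0$ and two local minima at $x_-,x_+$ with $x_-<x_0<x_+$, and $U''\neq0$ at these points. Let $c_0>c_1$ be real, and let $\xi=\xi(t)\in\{0,1\}$ be a two-state Markov process which switches from $0$ to $1$ with intensity $\lambda_0>0$ and from $1$ to $0$ with intensity $\lambda_1>0$. The process $X=X^x(t)$ solves $dX(t)=(c_{\xi(t)}-U'(X(t)))\,dt$, $t>0$, $X(0)=x$. Set $U_i(x)=U(x)-c_ix$; it is assumed that $\int\frac{dy}{U_i'(y)}$ diverges at every critical point of $U_i$. $V$ and $v$ denote, respectively, the local maximum value and the local minimum value of $U'$. If $V>c_0>c_1>v$, let $a_-<a_0<a_+$ be the critical points of $U_1$ (solutions of $U'=c_1$) and $b_-<b_0<b_+$ the critical points of $U_0$ (solutions of $U'=c_0$); then $a_-<b_-<b_0<a_0<a_+<b_+$ and the attractors are $G_-=(a_-,b_-)$ and $G_+=(a_+,b_+)$. (If $c_0>V>c_1>v$, $U_0$ has the single critical point $b_+$ and the only attractor is $G_+$; if $V>c_0>v>c_1$, $U_1$ has the single critical point $a_-$ and the only attractor is $G_-$.) The interval $G=(a,b)$, $G=G_-$ or $G=G_+$, is invariant: a process started in $G$ stays in $G$ for all $t>0$ almost surely; moreover $U'(a)=c_1$, $U'(b)=c_0$ and $c_1\le U'(x)\le c_0$ on $G$. The functions $\Phi_0,\Phi_1$ are defined on $G$, up to arbitrary additive constants, by $\Phi_i'(y)=\frac1{c_i-U'(y)}$. *)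

theory Defs
  imports "HOL-Probability.Probability"
begin

section \<open>The potential and its attractors\<close>

definition C2 :: "(real \<Rightarrow> real) \<Rightarrow> bool" where
  "C2 f \<longleftrightarrow>
     (\<forall>x. f differentiable (at x)) \<and> (\<forall>x. deriv f differentiable (at x)) \<and>
     continuous_on UNIV (deriv (deriv f))"

definition is_local_max :: "(real \<Rightarrow> real) \<Rightarrow> real \<Rightarrow> bool" where
  "is_local_max f x \<longleftrightarrow> (\<forall>\<^sub>F y in nhds x. f y \<le> f x)"

definition is_local_min :: "(real \<Rightarrow> real) \<Rightarrow> real \<Rightarrow> bool" where
  "is_local_min f x \<longleftrightarrow> (\<forall>\<^sub>F y in nhds x. f x \<le> f y)"

definition double_well :: "(real \<Rightarrow> real) \<Rightarrow> real \<Rightarrow> real \<Rightarrow> real \<Rightarrow> bool" where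
  "double_well U xm x0 xp \<longleftrightarrow>
     C2 U \<and> xm < x0 \<and> x0 < xp \<and>
     {x. is_local_max U x} = {x0} \<and> {x. is_local_min U x} = {xm, xp} \<and>
     (\<forall>x\<in>{xm, x0, xp}. deriv (deriv U) x \<noteq> 0)"

text \<open>``The local maximum (minimum) value of f'' presupposes that f has exactly one
  local maximum (minimum) point.\<close>

definition the_local_max_value :: "(real \<Rightarrow> real) \<Rightarrow> real \<Rightarrow> bool" where
  "the_local_max_value f V \<longleftrightarrow> (\<exists>p. {x. is_local_max f x} = {p} \<and> V = f p)"

definition the_local_min_value :: "(real \<Rightarrow> real) \<Rightarrow> real \<Rightarrow> bool" where
  "the_local_min_value f v \<longleftrightarrow> (\<exists>q. {x. is_local_min f x} = {q} \<and> v = f q)"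

definition tilted :: "(real \<Rightarrow> real) \<Rightarrow> real \<Rightarrow> real \<Rightarrow> real" where
  "tilted U k = (\<lambda>x. U x - k * x)"

definition crit_points :: "(real \<Rightarrow> real) \<Rightarrow> real set" where
  "crit_points f = {x. deriv f x = 0}"

text \<open>Both one-sided integrals of 1/f' at a critical point diverge. For the tilted double
  wells the critical points are isolated, so that 1/f' has constant sign on each side and
  divergence of the improper integral is the failure of Lebesgue integrability.\<close>

definition divergent_at_crit_points :: "(real \<Rightarrow> real) \<Rightarrow> bool" where
  "divergent_at_crit_points f \<longleftrightarrow>
     (\<forall>z\<in>crit_points f. \<forall>e>0.
        \<not> set_integrable lborel {z<..<z + e} (\<lambda>y. 1 / deriv f y) \<and>
        \<not> set_integrable lborel {z - e<..<z} (\<lambda>y. 1 / deriv f y))"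

text \<open>The interval (a,b) is one of the attractors (am,bm), (ap,bp), in the three regimes
  V > c 0 > c 1 > v, c 0 > V > c 1 > v and V > c 0 > v > c 1.\<close>

definition is_attractor ::
    "(real \<Rightarrow> real) \<Rightarrow> (nat \<Rightarrow> real) \<Rightarrow> real \<Rightarrow> real \<Rightarrow> real \<Rightarrow> real \<Rightarrow> bool" where
  "is_attractor U c V v a b \<longleftrightarrow>
     (V > c 0 \<and> c 0 > c 1 \<and> c 1 > v \<and>
       (\<exists>am a0 ap bm b0 bp. am < a0 \<and> a0 < ap \<and> bm < b0 \<and> b0 < bp \<and>
          crit_points (tilted U (c 1)) = {am, a0, ap} \<and>
          crit_points (tilted U (c 0)) = {bm, b0, bp} \<and>
          ((a, b) = (am, bm) \<or> (a, b) = (ap, bp)))) \<or>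
     (c 0 > V \<and> V > c 1 \<and> c 1 > v \<and>
       (\<exists>am a0 ap bp. am < a0 \<and> a0 < ap \<and>
          crit_points (tilted U (c 1)) = {am, a0, ap} \<and>
          crit_points (tilted U (c 0)) = {bp} \<and>
          (a, b) = (ap, bp))) \<or>
     (V > c 0 \<and> c 0 > v \<and> v > c 1 \<and>
       (\<exists>am bm b0 bp. bm < b0 \<and> b0 < bp \<and>
          crit_points (tilted U (c 1)) = {am} \<and>
          crit_points (tilted U (c 0)) = {bm, b0, bp} \<and>
          (a, b) = (am, bm)))"

section \<open>The process\<close>

definition past_events :: "'w measure \<Rightarrow> (real \<Rightarrow> 'w \<Rightarrow> nat) \<Rightarrow> real \<Rightarrow> 'w set set" where
  "past_events M \<xi> s =
     sigma_sets (space M) {\<xi> u -` {k} \<inter> space M | u k. 0 \<le> u \<and> u \<le> s}"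

text \<open>A time-homogeneous Markov process with state space {0,1}, started from i, with right
  continuous paths with left limits (hence finitely many switches in bounded time), and
  with transition probabilities p satisfying
  p h j (1 - j) = lam j * h + o(h) as h tends to 0 from the right.\<close>

definition two_state_markov ::
    "'w measure \<Rightarrow> (nat \<Rightarrow> real) \<Rightarrow> nat \<Rightarrow> (real \<Rightarrow> 'w \<Rightarrow> nat) \<Rightarrow> bool" where
  "two_state_markov M lam i \<xi> \<longleftrightarrow>
     prob_space M \<and>
     (\<forall>t\<ge>0. \<xi> t \<in> measurable M (count_space {0, 1})) \<and>
     (AE \<omega> in M. \<xi> 0 \<omega> = i) \<and>
     (AE \<omega> in M. (\<forall>t\<ge>0. \<forall>\<^sub>F s in at_right t. \<xi> s \<omega> = \<xi> t \<omega>) \<and>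
                  (\<forall>t>0. \<exists>j. \<forall>\<^sub>F s in at_left t. \<xi> s \<omega> = j)) \<and>
     (\<exists>p :: real \<Rightarrow> nat \<Rightarrow> nat \<Rightarrow> real.
        (\<forall>s\<ge>0. \<forall>h\<ge>0. \<forall>E\<in>past_events M \<xi> s. \<forall>j\<in>{0, 1}. \<forall>k\<in>{0, 1}.
           measure M (E \<inter> {\<omega>\<in>space M. \<xi> s \<omega> = j \<and> \<xi> (s + h) \<omega> = k}) =
           p h j k * measure M (E \<inter> {\<omega>\<in>space M. \<xi> s \<omega> = j})) \<and>
        (\<forall>j\<in>{0, 1}. ((\<lambda>h. p h j (1 - j) / h) \<longlongrightarrow> lam j) (at_right 0)))"

text \<open>The equation dX = (c(\<xi>) - U'(X)) dt, X(0) = x in integral form; X is not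
  differentiable at the switching times.\<close>

definition solves_switched_ode ::
    "'w measure \<Rightarrow> (real \<Rightarrow> real) \<Rightarrow> (nat \<Rightarrow> real) \<Rightarrow> (real \<Rightarrow> 'w \<Rightarrow> nat) \<Rightarrow>
     real \<Rightarrow> (real \<Rightarrow> 'w \<Rightarrow> real) \<Rightarrow> bool" where
  "solves_switched_ode M U c \<xi> x X \<longleftrightarrow>
     (\<forall>t\<ge>0. X t \<in> borel_measurable M) \<and>
     (AE \<omega> in M. \<forall>t\<ge>0.
        ((\<lambda>s. c (\<xi> s \<omega>) - deriv U (X s \<omega>)) has_integral (X t \<omega> - x)) {0..t})"

section \<open>Invariant measures\<close>

abbreviation state_space :: "(real \<times> nat) measure" where
  "state_space \<equiv> borel \<Otimes>\<^sub>M count_space {0, 1}"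

text \<open>For each initial state i of the switching process, M i is the underlying probability
  space, \<xi> i the switching process and X i x the position process started from x.\<close>

definition transition ::
    "(nat \<Rightarrow> 'w measure) \<Rightarrow> (nat \<Rightarrow> real \<Rightarrow> 'w \<Rightarrow> nat) \<Rightarrow> (nat \<Rightarrow> real \<Rightarrow> real \<Rightarrow> 'w \<Rightarrow> real) \<Rightarrow>
     real \<Rightarrow> real \<times> nat \<Rightarrow> (real \<times> nat) measure" where
  "transition M \<xi> X t = (\<lambda>(x, i). distr (M i) state_space (\<lambda>\<omega>. (X i x t \<omega>, \<xi> i t \<omega>)))"

definition invariant_measure ::
    "(real \<Rightarrow> real \<times> nat \<Rightarrow> (real \<times> nat) measure) \<Rightarrow> (real \<times> nat) measure \<Rightarrow> bool" where
  "invariant_measure P \<mu> \<longleftrightarrow>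
     prob_space \<mu> \<and> sets \<mu> = sets state_space \<and>
     (\<forall>t\<ge>0. \<forall>A\<in>sets state_space. (\<integral>\<^sup>+ z. emeasure (P t z) A \<partial>\<mu>) = emeasure \<mu> A)"

definition has_support :: "(real \<times> nat) measure \<Rightarrow> real set \<Rightarrow> bool" where
  "has_support \<mu> G \<longleftrightarrow>
     (AE z in \<mu>. fst z \<in> G) \<and>
     (\<forall>S. open S \<and> S \<inter> G \<noteq> {} \<longrightarrow> emeasure \<mu> (S \<times> {0, 1}) > 0)"

section \<open>The stationary densities\<close>

definition Psi_inv :: "(nat \<Rightarrow> real) \<Rightarrow> (nat \<Rightarrow> real \<Rightarrow> real) \<Rightarrow> real \<Rightarrow> real" where
  "Psi_inv lam \<Phi> x = exp (- lam 0 * \<Phi> 0 x - lam 1 * \<Phi> 1 x)"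

definition C0 where
  "C0 U c lam \<Phi> a b =
     lam 1 / (lam 0 + lam 1) *
     inverse (LBINT x:{a<..<b}. Psi_inv lam \<Phi> x / (c (0::nat) - deriv U x))"

definition C1 where
  "C1 U c lam \<Phi> a b =
     lam 0 / (lam 0 + lam 1) *
     inverse (LBINT x:{a<..<b}. Psi_inv lam \<Phi> x / (deriv U x - c (1::nat)))"

definition stat_density ::
    "(real \<Rightarrow> real) \<Rightarrow> (nat \<Rightarrow> real) \<Rightarrow> (nat \<Rightarrow> real) \<Rightarrow> (nat \<Rightarrow> real \<Rightarrow> real) \<Rightarrow> real \<Rightarrow> real \<Rightarrow>
     nat \<Rightarrow> real \<Rightarrow> real" where
  "stat_density U c lam \<Phi> a b i x =
     (if i = 0 then C0 U c lam \<Phi> a b * (Psi_inv lam \<Phi> x / (c 0 - deriv U x))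
      else C1 U c lam \<Phi> a b * (Psi_inv lam \<Phi> x / (deriv U x - c 1)))"

definition measure_of_densities ::
    "real set \<Rightarrow> (nat \<Rightarrow> real \<Rightarrow> real) \<Rightarrow> (real \<times> nat) measure" where
  "measure_of_densities G \<pi> =
     density (lborel \<Otimes>\<^sub>M count_space {0, 1}) (\<lambda>(x, i). ennreal (\<pi> i x) * indicator G x)"

end

theory Submission
  imports Defs
begin

text \<open>
  Why the theorem holds. Let \<open>u = U'\<close>. On \<open>G = (a, b)\<close> the force \<open>u\<close> is strictly increasing
  from \<open>c 1\<close> to \<open>c 0\<close> (\<open>attractor_in_increasing_branch\<close>), so the process moves to the
  right in state \<open>0\<close>, to the left in state \<open>1\<close>, and cannot leave \<open>G\<close>. Put
  \<open>flux = \<Psi>\<inverse>\<close> and \<open>weight i = flux / \<bar>c i - u\<bar>\<close>. Then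
  \<open>flux' = \<lambda>\<^sub>1 weight 1 - \<lambda>\<^sub>0 weight 0\<close>, which is the stationary Fokker--Planck equation for
  densities proportional to the weights: \<open>flux\<close> is the probability flux to the right in state
  \<open>0\<close> and to the left in state \<open>1\<close>. Since \<open>\<Phi> 0\<close> tends to infinity at \<open>b\<close> and
  \<open>\<Phi> 1\<close> at \<open>a\<close>, the flux vanishes at both ends. Hence the weights are integrable, the two
  normalising constants coincide, and integration by parts has no boundary terms
  (\<open>flux_integration_by_parts\<close>).

  The law of the process enters only through \<open>expectation_limit_of_iterates\<close>: the expectation
  of \<open>g (\<xi> T) (X T)\<close> is the limit of the \<open>n\<close>-th iterate of a deterministic operator
  \<open>step (T / n)\<close>, which makes one Euler step of the position and one switch at the exact
  rates. On the side of the paths this is the convergence of the Euler scheme along a path with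
  finitely many jumps; on the side of the law it is the Markov property at the mesh times. The
  formula shows at the same time that the transition probabilities depend measurably on the
  starting point.

  Existence. For the functional \<open>stat_fun\<close> given by the weights,
  \<open>stat_fun (step h f) - stat_fun f\<close> is \<open>O(h\<^sup>2)\<close>, with a constant that depends on \<open>f\<close>
  only through a Lipschitz bound (\<open>stat_fun_step\<close>): all derivatives are moved onto the flux.
  The bound grows at most by the factor \<open>exp (T Lip)\<close> under the iterates, so \<open>n\<close> steps of
  length \<open>T / n\<close> change the functional by \<open>O(1 / n)\<close>, and the limit shows invariance.

  Uniqueness. The same iterates give \<open>P\<^sub>t f = f + t L f + o(t)\<close> uniformly on \<open>G\<close>, with
  the generator \<open>L\<close> (\<open>generator_estimate\<close>), so that an invariant law integrates \<open>L f\<close>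
  to zero (\<open>weak_stationarity\<close>). Test functions that do not depend on the state yield the
  balance of the fluxes of the two states (\<open>flux_balance\<close>). After that, test functions
  \<open>H / flux\<close> living in state \<open>0\<close> leave only \<open>H'\<close> (\<open>integrating_factor\<close>), which forces
  the law in state \<open>0\<close> to be a multiple of \<open>weight 0\<close>. Flux balance then determines the law
  in state \<open>1\<close>, and the total mass determines the multiple.
\<close>


section \<open>Increasing branches of the derivative of a double well\<close>

text \<open>A maximum and a minimum over \<open>{x..y}\<close> are attained. If both are attained at endpoints only,
  the function is constant and every interior point is an extremum.\<close>

lemma local_extremum_between:
  fixes f :: "real \<Rightarrow> real"
  assumes cont: "continuous_on {x..y} f" and "x < y" and "f x = f y"
  shows "\<exists>z\<in>{x<..<y}. is_local_max f z \<or> is_local_min f z"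
proof -
  have ev: "\<forall>\<^sub>F t in nhds z. t \<in> {x..y}" if "z \<in> {x<..<y}" for z
    using eventually_nhds_in_open[OF open_greaterThanLessThan that]
    by (rule eventually_mono) auto
  obtain p where p: "p \<in> {x..y}" "\<And>t. t \<in> {x..y} \<Longrightarrow> f t \<le> f p"
    using continuous_attains_sup[OF _ _ cont] \<open>x < y\<close> by auto
  obtain q where q: "q \<in> {x..y}" "\<And>t. t \<in> {x..y} \<Longrightarrow> f q \<le> f t"
    using continuous_attains_inf[OF _ _ cont] \<open>x < y\<close> by auto
  have "t \<in> {x<..<y} \<or> t \<in> {x, y}" if "t \<in> {x..y}" for t
    using that by (auto simp: order.order_iff_strict)
  then consider "p \<in> {x<..<y}" | "q \<in> {x<..<y}" | "p \<in> {x, y}" "q \<in> {x, y}"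
    using p(1) q(1) by blast
  then show ?thesis
  proof cases
    case 1
    with p(2) have "is_local_max f p"
      unfolding is_local_max_def using ev[OF 1] by (auto elim!: eventually_mono)
    with 1 show ?thesis by blast
  next
    case 2
    with q(2) have "is_local_min f q"
      unfolding is_local_min_def using ev[OF 2] by (auto elim!: eventually_mono)
    with 2 show ?thesis by blast
  next
    case 3
    then have eq: "f t = f x" if "t \<in> {x..y}" for t
      using p(2)[OF that] q(2)[OF that] \<open>f x = f y\<close> by auto
    have m: "(x + y) / 2 \<in> {x<..<y}" using \<open>x < y\<close> by auto
    have "f t \<le> f ((x + y) / 2)" if "t \<in> {x..y}" for t
      using eq[OF that] eq[of "(x + y) / 2"] \<open>x < y\<close> by (simp add: field_simps)
    then have "is_local_max f ((x + y) / 2)"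
      unfolding is_local_max_def using ev[OF m] by (auto elim!: eventually_mono)
    with m show ?thesis by blast
  qed
qed

lemma inj_on_without_local_extremum:
  fixes f :: "real \<Rightarrow> real"
  assumes "continuous_on UNIV f" "is_interval I"
    and "\<And>z. z \<in> interior I \<Longrightarrow> \<not> is_local_max f z \<and> \<not> is_local_min f z"
  shows "inj_on f I"
proof (rule inj_onI, rule ccontr)
  have neq: False if "x \<in> I" "y \<in> I" "f x = f y" "x < y" for x y
  proof -
    have "{x..y} \<subseteq> I" 
      using mem_is_interval_1_I[OF assms(2) that(1,2)] by auto
    then have "{x<..<y} \<subseteq> interior I"
      by (intro interior_maximal) auto
    moreover obtain z where "z \<in> {x<..<y}" "is_local_max f z \<or> is_local_min f z"
      using local_extremum_between[OF continuous_on_subset[OF assms(1)] \<open>x < y\<close> \<open>f x = f y\<close>] by auto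
    ultimately show False using assms(3) by blast
  qed
  fix x y assume "x \<in> I" "y \<in> I" "f x = f y" "x \<noteq> y"
  then show False using neq[of x y] neq[of y x] by (metis linorder_neqE)
qed

text \<open>To the left of a local maximum, the absence of extrema leaves only an increase: a value
  \<open>f x > f y\<close> with \<open>x < y \<le> p\<close> would force an interior minimum of \<open>f\<close> on \<open>{x..p}\<close>.\<close>

lemma strict_mono_on_left_of_local_max:
  fixes f :: "real \<Rightarrow> real"
  assumes cont: "continuous_on UNIV f" and p: "is_local_max f p"
    and no: "\<And>z. z < p \<Longrightarrow> \<not> is_local_max f z \<and> \<not> is_local_min f z"
  shows "strict_mono_on {..p} f"
proof -
  have inj: "inj_on f {..p}"
    by (rule inj_on_without_local_extremum[OF cont]) (auto simp: no is_interval_1)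
  have noval: False if asm: "x < z" "z < p" "f z < f x" "f z < f p" for x z
  proof -
    obtain y where y: "x \<le> y" "y \<le> p" "\<And>t. t \<in> {x..p} \<Longrightarrow> f y \<le> f t"
      using continuous_attains_inf[OF _ _ continuous_on_subset[OF cont], of "{x..p}"] asm by auto
    have "f y \<le> f z" using y(3)[of z] that by auto
    then have "y \<noteq> x" "y \<noteq> p" using asm by auto
    with y have yi: "y \<in> {x<..<p}" by auto
    have "\<forall>\<^sub>F t in nhds y. t \<in> {x<..<p}" by (rule eventually_nhds_in_open[OF _ yi]) auto
    then have "is_local_min f y"
      unfolding is_local_min_def using y(3) by (auto elim!: eventually_mono)
    with no[of y] yi show False by auto
  qed
  have top: "f x < f p" if "x < p" for x
  proof (rule ccontr)
    assume "\<not> f x < f p"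
    moreover have "f x \<noteq> f p" using inj_onD[OF inj, of x p] that by auto
    ultimately have gt: "f p < f x" by simp
    have "\<forall>\<^sub>F t in at_left p. f t \<le> f p \<and> t \<in> {x<..<p}"
      using p[unfolded is_local_max_def] that
      by (intro eventually_conj eventually_at_left_real)
         (auto simp: eventually_at_filter elim: eventually_mono)
    then obtain t where t: "f t \<le> f p" "x < t" "t < p"
      using eventually_happens[of _ "at_left p"] by (auto simp: trivial_limit_at_left_real)
    with inj_onD[OF inj, of t p] have "f t < f p" by (auto simp: order.order_iff_strict)
    with noval[of x t] t gt show False by auto
  qed
  show ?thesis
  proof (rule strict_mono_onI)
    fix x y assume xy: "x \<in> {..p}" "y \<in> {..p}" "x < y"
    show "f x < f y"
    proof (cases "y = p")
      case True with top xy show ?thesis by auto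
    next
      case False
      then have "f y < f p" using top xy by auto
      then have "\<not> f y < f x" using noval[of x y] xy False by auto
      moreover have "f x \<noteq> f y" using inj_onD[OF inj, of x y] xy by auto
      ultimately show ?thesis by simp
    qed
  qed
qed

text \<open>The mirror image under \<open>f \<mapsto> (\<lambda>x. - f (- x))\<close>.\<close>

lemma strict_mono_on_right_of_local_min:
  fixes f :: "real \<Rightarrow> real"
  assumes cont: "continuous_on UNIV f" and q: "is_local_min f q"
    and no: "\<And>z. q < z \<Longrightarrow> \<not> is_local_max f z \<and> \<not> is_local_min f z"
  shows "strict_mono_on {q..} f"
proof -
  let ?g = "\<lambda>x. - f (- x)"
  have tr: "(\<forall>\<^sub>F y in nhds (- x). P (- y)) \<longleftrightarrow> (\<forall>\<^sub>F y in nhds x. P y)" for P and x :: real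
  proof -
    have lim: "filterlim uminus (nhds (- y)) (nhds y)" for y :: real
      using tendsto_minus[OF filterlim_ident, of y] by simp
    show ?thesis
      using filterlim_iff[THEN iffD1, OF lim[of "- x"], rule_format, of P]
        filterlim_iff[THEN iffD1, OF lim[of x], rule_format, of "\<lambda>y. P (- y)"] by auto
  qed
  have max: "is_local_max ?g x \<longleftrightarrow> is_local_min f (- x)" for x
    using tr[of "\<lambda>y. f (- x) \<le> f y" "- x"] by (simp add: is_local_max_def is_local_min_def)
  have min: "is_local_min ?g x \<longleftrightarrow> is_local_max f (- x)" for x
    using tr[of "\<lambda>y. f y \<le> f (- x)" "- x"] by (simp add: is_local_max_def is_local_min_def)
  have "strict_mono_on {..- q} ?g"
    using q no by (intro strict_mono_on_left_of_local_max)
      (auto simp: max min intro!: continuous_intros continuous_on_compose2[OF cont])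
  then have "?g (- y) < ?g (- x)" if "q \<le> x" "x < y" for x y
    using that by (intro strict_mono_onD[where f = ?g]) auto
  then show ?thesis by (intro strict_mono_onI) auto
qed

text \<open>Immediately to the right of \<open>z\<close> the derivative is negative, so \<open>F\<close> drops below \<open>F z\<close>.\<close>

lemma no_local_min_if_derivative_decreasing:
  fixes F f :: "real \<Rightarrow> real"
  assumes "\<And>x. (F has_real_derivative f x) (at x)" "f z = 0"
    and "(f has_real_derivative d) (at z)" "d < 0"
  shows "\<not> is_local_min F z"
proof
  assume "is_local_min F z"
  then have ev: "\<forall>\<^sub>F y in at_right z. F z \<le> F y"
    unfolding is_local_min_def eventually_at_filter by (auto elim: eventually_mono)
  obtain e where e: "e > 0" "\<And>h. 0 < h \<Longrightarrow> h < e \<Longrightarrow> f (z + h) < 0"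
    using has_real_derivative_neg_dec_right[OF assms(3)] assms(2,4) by auto
  from ev have "\<forall>\<^sub>F y in at_right z. F z \<le> F y \<and> y \<in> {z<..<z + e}"
    using e by (intro eventually_conj eventually_at_right_real) auto
  then obtain y where y: "F z \<le> F y" "z < y" "y < z + e"
    using eventually_happens[of _ "at_right z"] by (auto simp: trivial_limit_at_right_real)
  obtain t where "z < t" "t < y" "F y - F z = (y - z) * f t"
    using MVT2[OF y(2), of F f] assms(1) by auto
  moreover have "f t < 0" using e(2)[of "t - z"] \<open>z < t\<close> \<open>t < y\<close> y by auto
  ultimately show False using y mult_pos_neg[of "y - z" "f t"] by auto
qed

lemma is_local_min_uminus: "is_local_min (\<lambda>x. - f x) z \<longleftrightarrow> is_local_max f z"
  by (simp add: is_local_min_def is_local_max_def)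

lemma local_max_above_endpoints:
  fixes f :: "real \<Rightarrow> real"
  assumes cont: "continuous_on {x..y} f" and z: "x < z" "z < y" "f x < f z" "f y < f z"
  shows "\<exists>p\<in>{x<..<y}. is_local_max f p"
proof -
  obtain p where p: "x \<le> p" "p \<le> y" "\<And>t. t \<in> {x..y} \<Longrightarrow> f t \<le> f p"
    using continuous_attains_sup[OF _ _ cont] z by auto
  have "f z \<le> f p" using p(3)[of z] z by auto
  then have "p \<noteq> x" "p \<noteq> y" using z by auto
  with p have pi: "p \<in> {x<..<y}" by auto
  have "\<forall>\<^sub>F t in nhds p. t \<in> {x<..<y}" by (rule eventually_nhds_in_open[OF _ pi]) auto
  then have "is_local_max f p"
    unfolding is_local_max_def using p(3) by (auto elim!: eventually_mono)
  with pi show ?thesis by blast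
qed

lemma C2_D:
  assumes "C2 U"
  shows "(U has_real_derivative deriv U x) (at x)"
    and "(deriv U has_real_derivative deriv (deriv U) x) (at x)"
    and "continuous_on UNIV (deriv (deriv U))"
    and "continuous_on UNIV (deriv U)"
proof -
  show *: "(deriv U has_real_derivative deriv (deriv U) x) (at x)" for x
    using assms unfolding C2_def by (metis DERIV_imp_deriv real_differentiable_def)
  show "(U has_real_derivative deriv U x) (at x)"
    using assms unfolding C2_def by (metis DERIV_imp_deriv real_differentiable_def)
  show "continuous_on UNIV (deriv U)"
    by (rule DERIV_continuous_on[OF DERIV_subset[OF *]]) auto
qed (use assms in \<open>simp add: C2_def\<close>)

text \<open>The derivative vanishes at \<open>xm\<close>, \<open>x0\<close> and \<open>xp\<close>, is positive just after \<open>xm\<close> and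
  negative just after \<open>x0\<close>. So its local maximum lies between \<open>xm\<close> and \<open>x0\<close> and its local
  minimum between \<open>x0\<close> and \<open>xp\<close>; in particular they are in this order.\<close>

lemma double_well_deriv_shape:
  assumes dw: "double_well U xm x0 xp"
    and p: "{x. is_local_max (deriv U) x} = {p}" and q: "{x. is_local_min (deriv U) x} = {q}"
  shows "p < q" "strict_mono_on {..p} (deriv U)" "strict_mono_on {q..} (deriv U)"
    "inj_on (deriv U) {p..q}"
proof -
  let ?u = "deriv U" and ?u' = "deriv (deriv U)"
  have C2: "C2 U" and ord: "xm < x0" "x0 < xp"
    and ext: "is_local_max U x0" "is_local_min U xm" "is_local_min U xp"
    and nz: "?u' xm \<noteq> 0" "?u' x0 \<noteq> 0" "?u' xp \<noteq> 0"
    using dw unfolding double_well_def by blast+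
  note D = C2_D[OF C2]
  have crit_min: "?u x = 0" if m: "is_local_min U x" for x
  proof -
    obtain d where "d > 0" "\<And>y. dist y x < d \<Longrightarrow> U x \<le> U y"
      using m unfolding is_local_min_def eventually_nhds_metric by blast
    then show ?thesis
      by (intro DERIV_local_min[OF D(1)]) (auto simp: dist_real_def abs_minus_commute)
  qed
  have crit_max: "?u x = 0" if m: "is_local_max U x" for x
  proof -
    obtain d where "d > 0" "\<And>y. dist y x < d \<Longrightarrow> U y \<le> U x"
      using m unfolding is_local_max_def eventually_nhds_metric by blast
    then show ?thesis
      by (intro DERIV_local_max[OF D(1)]) (auto simp: dist_real_def abs_minus_commute)
  qed
  have pos: "?u' xm > 0"
    using no_local_min_if_derivative_decreasing[OF D(1) crit_min[OF ext(2)] D(2)] ext(2) nz by force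
  have neg: "?u' x0 < 0"
  proof (rule ccontr)
    assume "\<not> ?u' x0 < 0"
    then have "\<not> is_local_min (\<lambda>x. - U x) x0"
      using nz crit_max[OF ext(1)] D
      by (intro no_local_min_if_derivative_decreasing[where f = "\<lambda>x. - ?u x" and d = "- ?u' x0"])
         (auto intro!: derivative_intros)
    with ext(1) show False by (simp add: is_local_min_uminus)
  qed
  have u0: "?u xm = 0" "?u x0 = 0" "?u xp = 0" using crit_min crit_max ext by auto
  obtain e where e: "e > 0" "\<And>h. 0 < h \<Longrightarrow> h < e \<Longrightarrow> 0 < ?u (xm + h)"
    using has_real_derivative_pos_inc_right[OF D(2) pos] u0 by auto
  obtain e' where e': "e' > 0" "\<And>h. 0 < h \<Longrightarrow> h < e' \<Longrightarrow> ?u (x0 + h) < 0"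
    using has_real_derivative_neg_dec_right[OF D(2) neg] u0 by auto
  have "?u (xm + min (e/2) ((x0 - xm)/2)) > 0" "?u (x0 + min (e'/2) ((xp - x0)/2)) < 0"
    using ord e(1) e'(1) by (intro e(2) e'(2); simp add: min_less_iff_disj)+
  moreover have "xm < xm + min (e/2) ((x0 - xm)/2)" "xm + min (e/2) ((x0 - xm)/2) < x0"
    "x0 < x0 + min (e'/2) ((xp - x0)/2)" "x0 + min (e'/2) ((xp - x0)/2) < xp"
    using ord e(1) e'(1) by (auto simp: min_def field_simps)
  ultimately have sgn: "?u (xm + min (e/2) ((x0 - xm)/2)) > 0" "?u (x0 + min (e'/2) ((xp - x0)/2)) < 0"
    "xm < xm + min (e/2) ((x0 - xm)/2)" "xm + min (e/2) ((x0 - xm)/2) < x0"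
    "x0 < x0 + min (e'/2) ((xp - x0)/2)" "x0 + min (e'/2) ((xp - x0)/2) < xp" by blast+
  have "\<exists>p\<in>{xm<..<x0}. is_local_max ?u p"
    using e(1) ord u0 sgn
    by (intro local_max_above_endpoints[where z = "xm + min (e/2) ((x0 - xm)/2)"]
        continuous_on_subset[OF D(4)]) auto
  with p have "p < x0" by (force simp: set_eq_iff)
  have "\<exists>p\<in>{x0<..<xp}. is_local_max (\<lambda>x. - ?u x) p"
    using e'(1) ord u0 sgn
    by (intro local_max_above_endpoints[where z = "x0 + min (e'/2) ((xp - x0)/2)"]
        continuous_on_subset[OF D(4)] continuous_intros) auto
  then have "\<exists>p\<in>{x0<..<xp}. is_local_min ?u p"
    using is_local_min_uminus[of "\<lambda>x. - ?u x"] by simp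
  with q have "x0 < q" by (force simp: set_eq_iff)
  with \<open>p < x0\<close> show "p < q" by simp
  have mx: "is_local_max ?u x \<longleftrightarrow> x = p" and mn: "is_local_min ?u x \<longleftrightarrow> x = q" for x
    using p q by blast+
  show "strict_mono_on {..p} ?u" "strict_mono_on {q..} ?u"
    using \<open>p < q\<close> strict_mono_on_left_of_local_max[OF D(4), of p]
      strict_mono_on_right_of_local_min[OF D(4), of q] by (auto simp: mx mn)
  show "inj_on ?u {p..q}"
    by (rule inj_on_without_local_extremum[OF D(4)]) (auto simp: mx mn is_interval_1)
qed

lemma crit_points_tilted:
  assumes "C2 U" shows "crit_points (tilted U k) = {x. deriv U x = k}"
proof -
  have "deriv (tilted U k) x = deriv U x - k" for x
    unfolding tilted_def
    by (rule DERIV_imp_deriv) (auto intro!: derivative_eq_intros C2_D(1)[OF assms])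
  then show ?thesis by (simp add: crit_points_def)
qed

text \<open>Each increasing branch of \<open>U'\<close> and the decreasing middle piece meet a level at most once, so three solutions of \<open>U' = k\<close> occupy one piece each;
  a single solution is on the branch where the level exceeds \<open>V\<close> or falls below \<open>v\<close>.\<close>

lemma attractor_in_increasing_branch:
  assumes dw: "double_well U xm x0 xp" and V: "the_local_max_value (deriv U) V"
    and v: "the_local_min_value (deriv U) v" and att: "is_attractor U c V v a b"
  obtains l r where "l < a" "a < b" "b < r" "strict_mono_on {l..r} (deriv U)"
    "deriv U a = c 1" "deriv U b = c 0"
proof -
  note intro = that
  let ?u = "deriv U"
  have C2: "C2 U" using dw unfolding double_well_def by blast
  note D = C2_D[OF C2]
  obtain p q where p: "{x. is_local_max ?u x} = {p}" "V = ?u p"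
    and q: "{x. is_local_min ?u x} = {q}" "v = ?u q"
    using V v unfolding the_local_max_value_def the_local_min_value_def by blast
  note S = double_well_deriv_shape[OF dw p(1) q(1)]
  note left = strict_mono_onD[OF S(2)] and right = strict_mono_onD[OF S(3)]
    and mid = inj_onD[OF S(4)]
  have cont: "continuous_on I ?u" for I using D(4) continuous_on_subset by blast
  have three: "x \<le> p" "q \<le> z"
    if "crit_points (tilted U k) = {x, y, z}" "x < y" "y < z" for x y z k
  proof -
    have k: "?u x = k" "?u y = k" "?u z = k" using that(1) unfolding crit_points_tilted[OF C2] by auto
    show "x \<le> p"
    proof (rule ccontr)
      assume "\<not> x \<le> p"
      moreover from this have "\<not> y \<le> q" using mid[of x y] k that(2) by auto
      ultimately show False using right[of y z] k that(3) by auto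
    qed
    show "q \<le> z"
    proof (rule ccontr)
      assume "\<not> q \<le> z"
      moreover from this have "\<not> p \<le> y" using mid[of y z] k that(3) by auto
      ultimately show False using left[of x y] k that(2) by auto
    qed
  qed
  have L: thesis if "a < p" "b < p" "?u a = c 1" "?u b = c 0" "c 1 < c 0"
  proof (rule intro[of "min a b - 1" p])
    show "a < b" using left[of b a] that by (cases a b rule: linorder_cases) force+
    show "strict_mono_on {min a b - 1..p} ?u"
      by (rule monotone_on_subset[OF S(2)]) auto
  qed (use that in auto)
  have R: thesis if "q < a" "q < b" "?u a = c 1" "?u b = c 0" "c 1 < c 0"
  proof (rule intro[of q "max a b + 1"])
    show "a < b" using right[of b a] that by (cases a b rule: linorder_cases) force+
    show "strict_mono_on {q..max a b + 1} ?u"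
      by (rule monotone_on_subset[OF S(3)]) auto
  qed (use that in auto)
  have one_right: "q < x" if asm: "?u x = c 0" "c 0 > V" "V > v" for x
  proof (rule ccontr)
    assume "\<not> q < x"
    then consider "x \<le> p" | "p < x" "x \<le> q" by linarith
    then show False
    proof cases
      case 1 then show False using left[of x p] that p(2) by (cases "x = p") auto
    next
      case 2
      obtain y where "x \<le> y" "y \<le> q" "?u y = V"
        using IVT2'[of ?u q V x] 2 asm q(2) cont by auto
      with mid[of y p] 2 p(2) S(1) show False by auto
    qed
  qed
  have one_left: "x < p" if asm: "?u x = c 1" "v > c 1" "V > v" for x
  proof (rule ccontr)
    assume "\<not> x < p"
    then consider "q \<le> x" | "p \<le> x" "x < q" by linarith
    then show False
    proof cases
      case 1 then show False using right[of q x] that q(2) by (cases "x = q") auto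
    next
      case 2
      obtain y where "p \<le> y" "y \<le> x" "?u y = v"
        using IVT2'[of ?u x v p] 2 asm p(2) cont by auto
      with mid[of y q] 2 q(2) S(1) show False by auto
    qed
  qed
  from att show thesis
    unfolding is_attractor_def
  proof (elim disjE conjE exE)
    fix am a0 ap bm b0 bp
    assume *: "V > c 0" "c 0 > c 1" "c 1 > v" "am < a0" "a0 < ap" "bm < b0" "b0 < bp"
      "crit_points (tilted U (c 1)) = {am, a0, ap}" "crit_points (tilted U (c 0)) = {bm, b0, bp}"
    have k: "?u am = c 1" "?u ap = c 1" "?u bm = c 0" "?u bp = c 0"
      using *(8,9) unfolding crit_points_tilted[OF C2] by auto
    have o: "am < p" "q < ap" "bm < p" "q < bp"
      using three[OF *(8,4,5)] three[OF *(9,6,7)] k * p(2) q(2) by (auto simp: order.order_iff_strict)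
    { assume "(a, b) = (am, bm)" then show thesis using k o *(2) by (intro L) simp_all }
    { assume "(a, b) = (ap, bp)" then show thesis using k o *(2) by (intro R) simp_all }
  next
    fix am a0 ap bp
    assume *: "c 0 > V" "V > c 1" "c 1 > v" "am < a0" "a0 < ap" "(a, b) = (ap, bp)"
      "crit_points (tilted U (c 1)) = {am, a0, ap}" "crit_points (tilted U (c 0)) = {bp}"
    have k: "?u ap = c 1" "?u bp = c 0"
      using *(7,8) unfolding crit_points_tilted[OF C2] by auto
    have "q < ap" "q < bp"
      using three(2)[OF *(7,4,5)] one_right[of bp] k *(1-3) q(2)
      by (auto simp: order.order_iff_strict)
    then show thesis using k *(1,2,6) by (intro R) simp_all
  next
    fix am bm b0 bp
    assume *: "V > c 0" "c 0 > v" "v > c 1" "bm < b0" "b0 < bp" "(a, b) = (am, bm)"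
      "crit_points (tilted U (c 1)) = {am}" "crit_points (tilted U (c 0)) = {bm, b0, bp}"
    have k: "?u am = c 1" "?u bm = c 0"
      using *(7,8) unfolding crit_points_tilted[OF C2] by auto
    have "am < p" "bm < p"
      using three(1)[OF *(8,4,5)] one_left[of am] k *(1-3) p(2)
      by (auto simp: order.order_iff_strict)
    then show thesis using k *(2,3,6) by (intro L) simp_all
  qed
qed

section \<open>Euler maps and the switched step\<close>

text \<open>The dynamics on one increasing branch of \<open>u = U'\<close>, which rises from the level \<open>c 1\<close> at \<open>a\<close> to the level
  \<open>c 0\<close> at \<open>b\<close>. The margins \<open>l\<close> and \<open>r\<close> make the drift point back into \<open>{a..b}\<close> from a
  neighbourhood, which confines the solutions.\<close>

locale increasing_branch =
  fixes u u' :: "real \<Rightarrow> real" and c lam :: "nat \<Rightarrow> real" and a b l r :: real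
  assumes deriv_u: "\<And>x. (u has_real_derivative u' x) (at x)"
    and cont_u': "continuous_on UNIV u'"
    and ends: "l < a" "a < b" "b < r"
    and mono_u: "strict_mono_on {l..r} u"
    and u_a: "u a = c 1" and u_b: "u b = c 0"
    and lam_pos: "lam 0 > 0" "lam 1 > 0"
begin

lemma cont_u: "continuous_on S u"
  by (rule DERIV_continuous_on[OF DERIV_subset[OF deriv_u]]) auto

lemma u_strict: "x \<in> {a<..<b} \<Longrightarrow> c 1 < u x \<and> u x < c 0"
  using strict_mono_onD[OF mono_u, of a x] strict_mono_onD[OF mono_u, of x b] ends u_a u_b by auto

lemma u_between: "x \<in> {a..b} \<Longrightarrow> c 1 \<le> u x \<and> u x \<le> c 0"
  using strict_mono_on_leD[OF mono_u, of a x] strict_mono_on_leD[OF mono_u, of x b] ends u_a u_b by auto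

lemma u_above: "x \<in> {b..r} \<Longrightarrow> c 0 \<le> u x"
  using strict_mono_on_leD[OF mono_u, of b x] ends u_b by auto

lemma u_below: "x \<in> {l..a} \<Longrightarrow> u x \<le> c 1"
  using strict_mono_on_leD[OF mono_u, of x a] ends u_a by auto

lemma c_less: "c 1 < c 0"
  using u_strict[of "(a + b) / 2"] ends by auto

definition speed :: real where "speed = c 0 - c 1"

lemma speed_pos: "speed > 0"
  using c_less by (simp add: speed_def)

lemma drift_bound: "x \<in> {a..b} \<Longrightarrow> i \<in> {0, 1} \<Longrightarrow> \<bar>c i - u x\<bar> \<le> speed"
  using u_between[of x] by (auto simp: speed_def)

text \<open>Some Lipschitz constant of \<open>u\<close> on \<open>{a..b}\<close>, positive so that it may serve as a denominator.\<close>

definition Lip :: real where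
  "Lip = (SOME K. K > 0 \<and> (\<forall>x\<in>{a..b}. \<bar>u' x\<bar> \<le> K))"

lemma Lip: "Lip > 0" "x \<in> {a..b} \<Longrightarrow> \<bar>u' x\<bar> \<le> Lip"
proof -
  have "compact (u' ` {a..b})"
    by (intro compact_continuous_image continuous_on_subset[OF cont_u']) auto
  then obtain K where "K > 0" "\<And>x. x \<in> {a..b} \<Longrightarrow> \<bar>u' x\<bar> \<le> K"
    using bounded_pos[of "u' ` {a..b}"] compact_imp_bounded by auto
  then have "\<exists>K. K > 0 \<and> (\<forall>x\<in>{a..b}. \<bar>u' x\<bar> \<le> K)" by blast
  from someI_ex[OF this] show "Lip > 0" "x \<in> {a..b} \<Longrightarrow> \<bar>u' x\<bar> \<le> Lip"
    unfolding Lip_def by blast+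
qed

lemma lipschitz_by_derivative:
  fixes f f' :: "real \<Rightarrow> real"
  assumes "\<And>x. (f has_real_derivative f' x) (at x)" "\<And>x. x \<in> {a..b} \<Longrightarrow> \<bar>f' x\<bar> \<le> K"
    and "x \<in> {a..b}" "y \<in> {a..b}"
  shows "\<bar>f x - f y\<bar> \<le> K * \<bar>x - y\<bar>"
  using field_differentiable_bound[of "{a..b}" f f' K x y] assms
  by (auto intro: DERIV_subset)

lemma u_lipschitz: "x \<in> {a..b} \<Longrightarrow> y \<in> {a..b} \<Longrightarrow> \<bar>u x - u y\<bar> \<le> Lip * \<bar>x - y\<bar>"
  by (rule lipschitz_by_derivative[OF deriv_u Lip(2)])

definition euler :: "real \<Rightarrow> nat \<Rightarrow> real \<Rightarrow> real" where
  "euler h i x = x + h * (c i - u x)"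

text \<open>Step sizes for which the Euler maps preserve \<open>{a..b}\<close> and the numbers \<open>lam i * h\<close> are
  probabilities.\<close>

definition small :: "real \<Rightarrow> bool" where
  "small h \<longleftrightarrow> 0 \<le> h \<and> h * Lip \<le> 1 \<and> h * (lam 0 + lam 1) \<le> 1"

lemma small_rate: "small h \<Longrightarrow> i \<in> {0, 1} \<Longrightarrow> 0 \<le> lam i * h \<and> lam i * h \<le> 1"
proof -
  assume *: "small h" "i \<in> {0, 1}"
  then have "0 \<le> lam 0 * h" "0 \<le> lam 1 * h" "lam 0 * h + lam 1 * h \<le> 1"
    using lam_pos by (auto simp: small_def algebra_simps)
  then show ?thesis using *(2) by auto
qed

lemma small_eventually: "T \<ge> 0 \<Longrightarrow> \<forall>\<^sub>F n in sequentially. small (T / real n)"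
proof -
  assume "T \<ge> 0"
  have 1: "(\<lambda>n. T / real n * K) \<longlonglongrightarrow> 0" for K
    using tendsto_mult[OF lim_const_over_n[of T] tendsto_const[of K]] by simp
  have "\<forall>\<^sub>F n in sequentially. T / real n * K < 1" for K
    using order_tendstoD(2)[OF 1, of 1 K] by simp
  from this[of Lip] this[of "lam 0 + lam 1"] show ?thesis
    by eventually_elim (use \<open>T \<ge> 0\<close> in \<open>auto simp: small_def\<close>)
qed

text \<open>The drift towards an endpoint is at most \<open>Lip\<close> times the distance to it, so a step with
  \<open>h * Lip \<le> 1\<close> cannot overshoot.\<close>

lemma euler_in: 
  assumes "small h" "i \<in> {0, 1}" "x \<in> {a..b}"
  shows "euler h i x \<in> {a..b}"
proof -
  have h: "0 \<le> h" "h * Lip \<le> 1" using assms(1) by (auto simp: small_def)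
  have *: "h * (Lip * d) \<le> d" if "d \<ge> 0" for d
    using mult_right_mono[OF h(2) that] by (simp add: mult.assoc)
  have "c i - u x \<le> Lip * (b - x)"
    using u_lipschitz[of b x] assms(2,3) u_b c_less ends by auto
  then have "h * (c i - u x) \<le> b - x"
    using mult_left_mono[OF _ h(1)] *[of "b - x"] assms(3) by fastforce
  moreover have "u x - c i \<le> Lip * (x - a)"
    using u_lipschitz[of x a] assms(2,3) u_a c_less ends by auto
  then have "h * (u x - c i) \<le> x - a"
    using mult_left_mono[OF _ h(1)] *[of "x - a"] assms(3) by fastforce
  ultimately show ?thesis by (auto simp: euler_def algebra_simps)
qed

lemma euler_lipschitz:
  assumes "0 \<le> h" "x \<in> {a..b}" "y \<in> {a..b}"
  shows "\<bar>euler h i x - euler h i y\<bar> \<le> (1 + h * Lip) * \<bar>x - y\<bar>"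
proof -
  have "euler h i x - euler h i y = (x - y) - h * (u x - u y)"
    by (simp add: euler_def algebra_simps)
  also have "\<bar>\<dots>\<bar> \<le> \<bar>x - y\<bar> + h * \<bar>u x - u y\<bar>"
    using assms(1) abs_triangle_ineq4[of "x - y" "h * (u x - u y)"] by (simp add: abs_mult)
  also have "\<dots> \<le> \<bar>x - y\<bar> + h * (Lip * \<bar>x - y\<bar>)"
    using u_lipschitz[OF assms(2,3)] assms(1) by (intro add_left_mono mult_left_mono) auto
  finally show ?thesis by (simp add: algebra_simps)
qed

lemma euler_near: "0 \<le> h \<Longrightarrow> x \<in> {a..b} \<Longrightarrow> i \<in> {0, 1} \<Longrightarrow> \<bar>euler h i x - x\<bar> \<le> h * speed"
  using drift_bound[of x i] by (auto simp: euler_def abs_mult intro: mult_left_mono)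

lemma euler_deriv: "(euler h i has_real_derivative 1 - h * u' x) (at x)"
  unfolding euler_def by (auto intro!: derivative_eq_intros deriv_u)

lemma cont_euler: "continuous_on S (euler h i)"
  unfolding euler_def by (intro continuous_intros cont_u)

text \<open>The transition operator of the Markov chain that moves the position by the Euler map of the
  current state \<open>i\<close> and then switches the state with probability \<open>lam i * h\<close>.\<close>

definition step :: "real \<Rightarrow> (nat \<Rightarrow> real \<Rightarrow> real) \<Rightarrow> nat \<Rightarrow> real \<Rightarrow> real" where
  "step h f i x = (1 - lam i * h) * f i (euler h i x) + lam i * h * f (1 - i) (euler h i x)"

lemma convex_abs_bound:
  fixes p y z F :: real
  assumes "0 \<le> p" "p \<le> 1" "\<bar>y\<bar> \<le> F" "\<bar>z\<bar> \<le> F"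
  shows "\<bar>(1 - p) * y + p * z\<bar> \<le> F"
proof -
  have "\<bar>(1 - p) * y + p * z\<bar> \<le> (1 - p) * \<bar>y\<bar> + p * \<bar>z\<bar>"
    using assms(1,2) abs_triangle_ineq[of "(1 - p) * y" "p * z"] by (simp add: abs_mult)
  also have "\<dots> \<le> (1 - p) * F + p * F"
    using assms by (intro add_mono mult_left_mono) auto
  finally show ?thesis by (simp add: algebra_simps)
qed

lemma step_bound:
  assumes "small h" "\<And>i x. i \<in> {0, 1} \<Longrightarrow> x \<in> {a..b} \<Longrightarrow> \<bar>f i x\<bar> \<le> F"
    and "i \<in> {0, 1}" "x \<in> {a..b}"
  shows "\<bar>step h f i x\<bar> \<le> F"
  unfolding step_def using euler_in[OF assms(1,3,4)] assms small_rate[OF assms(1,3)]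
  by (intro convex_abs_bound) auto

lemma iterate_bound:
  assumes "small h" "\<And>i x. i \<in> {0, 1} \<Longrightarrow> x \<in> {a..b} \<Longrightarrow> \<bar>f i x\<bar> \<le> F"
  shows "i \<in> {0, 1} \<Longrightarrow> x \<in> {a..b} \<Longrightarrow> \<bar>(step h ^^ n) f i x\<bar> \<le> F"
proof (induction n arbitrary: i x)
  case (Suc n)
  then show ?case using step_bound[OF assms(1), of "(step h ^^ n) f" F i x] by simp
qed (use assms in simp)

lemma iterate_continuous:
  assumes "\<And>i. i \<in> {0, 1} \<Longrightarrow> continuous_on UNIV (f i)"
  shows "i \<in> {0, 1} \<Longrightarrow> continuous_on UNIV ((step h ^^ n) f i)"
proof (induction n arbitrary: i)
  case (Suc n)
  define g where "g = (step h ^^ n) f"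
  have g: "continuous_on UNIV (\<lambda>x. g j (euler h i x))" if "j \<in> {0, 1}" for j
    unfolding g_def by (rule continuous_on_compose2[OF Suc.IH[OF that] cont_euler]) auto
  have "1 - i \<in> {0, 1}" using Suc.prems by auto
  from g[OF Suc.prems] g[OF this]
  have "continuous_on UNIV (\<lambda>x. step h g i x)"
    unfolding step_def by (intro continuous_on_add continuous_on_mult continuous_on_const)
  then show ?case by (simp add: g_def)
qed (use assms in simp)

text \<open>The derivative exists on the whole line but is bounded on \<open>{a..b}\<close> only: this avoids one-sided
  derivatives at the endpoints, and Euler steps from \<open>{a..b}\<close> do not see the outside.\<close>

definition C1_lipschitz :: "real \<Rightarrow> (nat \<Rightarrow> real \<Rightarrow> real) \<Rightarrow> bool" where
  "C1_lipschitz K f \<longleftrightarrow> (\<exists>f'. \<forall>i\<in>{0, 1}. (\<forall>x. (f i has_real_derivative f' i x) (at x)) \<and>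
     continuous_on UNIV (f' i) \<and> (\<forall>x\<in>{a..b}. \<bar>f' i x\<bar> \<le> K))"

lemma step_C1_lipschitz:
  assumes "small h" "C1_lipschitz K f"
  shows "C1_lipschitz ((1 + h * Lip) * K) (step h f)"
proof -
  obtain f' where f': "\<And>i x. i \<in> {0, 1} \<Longrightarrow> (f i has_real_derivative f' i x) (at x)"
    "\<And>i. i \<in> {0, 1} \<Longrightarrow> continuous_on UNIV (f' i)"
    "\<And>i x. i \<in> {0, 1} \<Longrightarrow> x \<in> {a..b} \<Longrightarrow> \<bar>f' i x\<bar> \<le> K"
    using assms(2) unfolding C1_lipschitz_def by blast
  define g where "g i x = (1 - h * u' x) *
    ((1 - lam i * h) * f' i (euler h i x) + lam i * h * f' (1 - i) (euler h i x))" for i x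
  show ?thesis unfolding C1_lipschitz_def
  proof (intro exI ballI conjI allI)
    fix i :: nat and x assume i: "i \<in> {0, 1}"
    define j where "j = 1 - i"
    have j: "j \<in> {0, 1}" using i by (auto simp: j_def)
    show "(step h f i has_real_derivative g i x) (at x)"
      unfolding step_def[abs_def] g_def j_def[symmetric]
      by (auto intro!: derivative_eq_intros DERIV_chain2[OF f'(1)[OF i] euler_deriv]
          DERIV_chain2[OF f'(1)[OF j] euler_deriv] simp: algebra_simps)
    have "continuous_on UNIV (\<lambda>x. f' k (euler h i x))" if "k \<in> {0, 1}" for k
      by (rule continuous_on_compose2[OF f'(2)[OF that] cont_euler]) auto
    from this[OF i] this[OF j] show "continuous_on UNIV (g i)"
      unfolding g_def[abs_def] j_def[symmetric]
      by (intro continuous_on_add continuous_on_mult continuous_on_diff continuous_on_const cont_u')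
    assume x: "x \<in> {a..b}"
    have h: "0 \<le> h" using assms(1) by (simp add: small_def)
    have "\<bar>1 - h * u' x\<bar> \<le> 1 + h * \<bar>u' x\<bar>"
      using abs_triangle_ineq4[of 1 "h * u' x"] h by (simp add: abs_mult)
    also have "\<dots> \<le> 1 + h * Lip"
      using Lip(2)[OF x] h by (intro add_left_mono mult_left_mono)
    finally have "\<bar>1 - h * u' x\<bar> \<le> 1 + h * Lip" .
    moreover have "\<bar>(1 - lam i * h) * f' i (euler h i x) + lam i * h * f' j (euler h i x)\<bar> \<le> K"
      using euler_in[OF assms(1) i x] f'(3) i j small_rate[OF assms(1) i]
      by (intro convex_abs_bound) auto
    ultimately show "\<bar>g i x\<bar> \<le> (1 + h * Lip) * K"
      unfolding g_def abs_mult j_def[symmetric] by (intro mult_mono) auto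
  qed
qed

lemma iterate_C1_lipschitz:
  assumes "small h" "C1_lipschitz K f"
  shows "C1_lipschitz ((1 + h * Lip) ^ n * K) ((step h ^^ n) f)"
proof (induction n)
  case (Suc n)
  then show ?case using step_C1_lipschitz[OF assms(1) Suc] by (simp add: mult.assoc)
qed (use assms in simp)

lemma growth_bound: "0 \<le> h \<Longrightarrow> (1 + h * Lip) ^ n \<le> exp (real n * h * Lip)"
proof -
  assume "0 \<le> h"
  then have "(1 + h * Lip) ^ n \<le> exp (h * Lip) ^ n"
    using Lip(1) exp_ge_add_one_self[of "h * Lip"] by (intro power_mono) auto
  then show ?thesis by (simp add: exp_of_nat_mult[symmetric] mult.assoc)
qed

lemma C1_lipschitz_mono: "C1_lipschitz K f \<Longrightarrow> K \<le> K' \<Longrightarrow> C1_lipschitz K' f"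
  unfolding C1_lipschitz_def by (meson order.trans)

end

section \<open>Paths of the switched equation\<close>

text \<open>By compactness (Bolzano's bisection): every time has a neighbourhood such that the path is
  constant on the part before it and on the part after it. The half-open form \<open>s < d \<le> s'\<close> fits
  right continuity, and it lets each jump be counted in exactly one mesh interval.\<close>

lemma finitely_many_jumps:
  fixes q :: "real \<Rightarrow> 'b"
  assumes "0 \<le> T" and rc: "\<And>t. t \<ge> 0 \<Longrightarrow> \<forall>\<^sub>F s in at_right t. q s = q t"
    and ll: "\<And>t. t > 0 \<Longrightarrow> \<exists>j. \<forall>\<^sub>F s in at_left t. q s = j"
  shows "\<exists>D. finite D \<and> (\<forall>s s'. 0 \<le> s \<and> s < s' \<and> s' \<le> T \<and> q s \<noteq> q s' \<longrightarrow> (\<exists>d\<in>D. s < d \<and> d \<le> s'))"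
proof -
  \<comment> \<open>\<open>P\<close> contains \<open>0 \<le> s\<close> because the local condition concerns all short intervals around a time, also those that reach below \<open>0\<close>.\<close>
  define P where "P = (\<lambda>v w. \<exists>D. finite D \<and>
    (\<forall>s s'. 0 \<le> s \<and> v \<le> s \<and> s < s' \<and> s' \<le> w \<and> q s \<noteq> q s' \<longrightarrow> (\<exists>d\<in>D. s < d \<and> d \<le> s')))"
  have "P 0 T"
  proof (rule Bolzano[OF \<open>0 \<le> T\<close>])
    fix v w z assume trans: "P v w" "P w z"
    obtain D where D: "finite D"
      "\<And>s s'. 0 \<le> s \<Longrightarrow> v \<le> s \<Longrightarrow> s < s' \<Longrightarrow> s' \<le> w \<Longrightarrow> q s \<noteq> q s' \<Longrightarrow> \<exists>d\<in>D. s < d \<and> d \<le> s'"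
      using trans(1) unfolding P_def by blast
    obtain D' where D': "finite D'"
      "\<And>s s'. 0 \<le> s \<Longrightarrow> w \<le> s \<Longrightarrow> s < s' \<Longrightarrow> s' \<le> z \<Longrightarrow> q s \<noteq> q s' \<Longrightarrow> \<exists>d\<in>D'. s < d \<and> d \<le> s'"
      using trans(2) unfolding P_def by blast
    show "P v z"
      unfolding P_def
    proof (intro exI[of _ "insert w (D \<union> D')"] conjI allI impI)
      fix s s' assume *: "0 \<le> s \<and> v \<le> s \<and> s < s' \<and> s' \<le> z \<and> q s \<noteq> q s'"
      show "\<exists>d\<in>insert w (D \<union> D'). s < d \<and> d \<le> s'"
      proof (cases "s < w \<and> w \<le> s'")
        case False
        then have "s' \<le> w \<or> w \<le> s" using * by linarith
        then show ?thesis using D(2)[of s s'] D'(2)[of s s'] * by blast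
      qed auto
    qed (use D(1) D'(1) in auto)
  next
    fix x assume local: "0 \<le> x" "x \<le> T"
    obtain e where e: "e > x" "\<And>s. x < s \<Longrightarrow> s < e \<Longrightarrow> q s = q x"
      using rc[of x] local by (auto simp: eventually_at_right_field)
    obtain f j where f: "f < x" "\<And>s. 0 \<le> s \<Longrightarrow> f < s \<Longrightarrow> s < x \<Longrightarrow> q s = j"
    proof (cases "x = 0")
      case True with that[of "-1" "q 0"] show thesis by auto
    next
      case False
      then obtain j f where "f < x" "\<And>s. f < s \<Longrightarrow> s < x \<Longrightarrow> q s = j"
        using ll[of x] local by (auto simp: eventually_at_left_field)
      with that[of f j] show thesis by blast
    qed
    show "\<exists>d>0. \<forall>v w. v \<le> x \<and> x \<le> w \<and> w - v < d \<longrightarrow> P v w"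
    proof (intro exI[of _ "min (e - x) (x - f)"] conjI allI impI)
      fix v w assume vw: "v \<le> x \<and> x \<le> w \<and> w - v < min (e - x) (x - f)"
      then have n: "f < v" "w < e" by auto
      show "P v w" unfolding P_def
      proof (intro exI[of _ "{x}"] conjI allI impI)
        fix s s' assume *: "0 \<le> s \<and> v \<le> s \<and> s < s' \<and> s' \<le> w \<and> q s \<noteq> q s'"
        have "s < x" 
        proof (rule ccontr)
          assume "\<not> s < x"
          then have "q s = q x" "q s' = q x"
            using e(2)[of s'] e(2)[of s] * n by (cases "s = x"; force)+
          with * show False by simp
        qed
        moreover have "x \<le> s'" 
        proof (rule ccontr)
          assume "\<not> x \<le> s'"
          then have "q s = j" "q s' = j" using * n by (auto intro!: f(2))
          with * show False by simp
        qed
        ultimately show "\<exists>d\<in>{x}. s < d \<and> d \<le> s'" by auto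
      qed auto
    qed (use e f in auto)
  qed
  then show ?thesis unfolding P_def by auto
qed

text \<open>A path above the barrier at time \<open>t\<close> has a last time \<open>s\<close> below it, and just after \<open>s\<close>
  it would have to move above the barrier without increasing.\<close>

lemma stays_below_barrier:
  fixes X :: "real \<Rightarrow> real"
  assumes cont: "continuous_on {0..t} X" and "0 \<le> t" "X 0 \<le> b" "b < r"
    and inc: "\<And>s s'. 0 \<le> s \<Longrightarrow> s < s' \<Longrightarrow> s' \<le> t \<Longrightarrow> (\<And>\<tau>. \<tau> \<in> {s<..s'} \<Longrightarrow> b \<le> X \<tau> \<and> X \<tau> \<le> r)
      \<Longrightarrow> X s' \<le> X s"
  shows "X t \<le> b"
proof (rule ccontr)
  assume gt: "\<not> X t \<le> b"
  have "closed ({0..t} \<inter> X -` {..b})"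
    by (rule continuous_closed_preimage[OF cont closed_atLeastAtMost closed_atMost])
  then have "compact ({0..t} \<inter> X -` {..b})"
    using compact_Int_closed[OF compact_Icc[of 0 t], of "{0..t} \<inter> X -` {..b}"] by (simp add: Int_absorb1)
  moreover have "0 \<in> {0..t} \<inter> X -` {..b}" using assms(2,3) by auto
  then have "{0..t} \<inter> X -` {..b} \<noteq> {}" by blast
  ultimately obtain s where sm: "s \<in> {0..t} \<inter> X -` {..b}" "\<forall>\<tau>\<in>{0..t} \<inter> X -` {..b}. \<tau> \<le> s"
    using compact_attains_sup by meson
  then have s: "0 \<le> s" "s \<le> t" "X s \<le> b"
    and max: "\<And>\<tau>. \<tau> \<in> {0..t} \<Longrightarrow> X \<tau> \<le> b \<Longrightarrow> \<tau> \<le> s"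
    by auto
  have "s < t" using s gt by (cases "s = t") auto
  obtain d where d: "d > 0" "\<And>\<tau>. \<tau> \<in> {0..t} \<Longrightarrow> \<bar>\<tau> - s\<bar> < d \<Longrightarrow> \<bar>X \<tau> - X s\<bar> < r - b"
    using cont[unfolded continuous_on_iff dist_real_def, rule_format, of s "r - b"] s \<open>b < r\<close> by auto
  define s' where "s' = min t (s + d / 2)"
  have s': "s < s'" "s' \<le> t" "s' < s + d" using \<open>s < t\<close> d(1) by (auto simp: s'_def)
  have "X s' \<le> X s"
  proof (rule inc[OF s(1) s'(1,2)])
    fix \<tau> assume \<tau>: "\<tau> \<in> {s<..s'}"
    have "\<bar>X \<tau> - X s\<bar> < r - b" using d(2)[of \<tau>] \<tau> s s' by auto
    moreover have "\<not> X \<tau> \<le> b" using max[of \<tau>] \<tau> s s' by auto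
    ultimately show "b \<le> X \<tau> \<and> X \<tau> \<le> r" using s(3) by linarith
  qed
  then show False using max[of s'] s s' by auto
qed

context increasing_branch
begin

primrec euler_path :: "real \<Rightarrow> (real \<Rightarrow> nat) \<Rightarrow> real \<Rightarrow> nat \<Rightarrow> real" where
  "euler_path h q x 0 = x"
| "euler_path h q x (Suc k) = euler h (q (real k * h)) (euler_path h q x k)"

lemma euler_path_in:
  assumes "small h" "\<And>s. s \<ge> 0 \<Longrightarrow> q s \<in> {0, 1}" "x \<in> {a..b}"
  shows "euler_path h q x k \<in> {a..b}"
proof (induction k)
  case (Suc k)
  have "0 \<le> real k * h" using assms(1) by (auto simp: small_def)
  then show ?case using euler_in[OF assms(1) assms(2) Suc] by simp
qed (use assms in simp)

lemma path_start:
  fixes X :: "real \<Rightarrow> real" and q :: "real \<Rightarrow> nat"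
  assumes X: "\<And>t. t \<ge> 0 \<Longrightarrow> ((\<lambda>s. c (q s) - u (X s)) has_integral (X t - x)) {0..t}"
  shows "X 0 = x"
  using integral_unique[OF X, of 0] by simp

lemma path_increment:
  fixes X :: "real \<Rightarrow> real" and q :: "real \<Rightarrow> nat"
  assumes X: "\<And>t. t \<ge> 0 \<Longrightarrow> ((\<lambda>s. c (q s) - u (X s)) has_integral (X t - x)) {0..t}"
    and "0 \<le> s" "s \<le> t"
  shows "((\<lambda>s. c (q s) - u (X s)) has_integral (X t - X s)) {s..t}"
proof -
  let ?f = "\<lambda>s. c (q s) - u (X s)"
  have t: "?f integrable_on {0..t}" using has_integral_integrable[OF X[of t]] assms by linarith
  have "?f integrable_on {s..t}" by (rule integrable_on_subinterval[OF t]) (use assms in auto)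
  moreover have "integral {0..s} ?f + integral {s..t} ?f = integral {0..t} ?f"
    by (rule Henstock_Kurzweil_Integration.integral_combine[OF assms(2,3) t])
  moreover have "integral {0..s} ?f = X s - x" "integral {0..t} ?f = X t - x"
    using integral_unique[OF X[of s]] integral_unique[OF X[of t]] assms by auto
  ultimately have "?f integrable_on {s..t}" "integral {s..t} ?f = X t - X s" by auto
  then show ?thesis by (metis integrable_integral)
qed

lemma path_in:
  fixes X :: "real \<Rightarrow> real" and q :: "real \<Rightarrow> nat"
  assumes X: "\<And>t. t \<ge> 0 \<Longrightarrow> ((\<lambda>s. c (q s) - u (X s)) has_integral (X t - x)) {0..t}"
    and q: "\<And>s. s \<ge> 0 \<Longrightarrow> q s \<in> {0, 1}" and x: "x \<in> {a..b}" and t: "t \<ge> 0"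
  shows "X t \<in> {a..b}"
proof -
  let ?f = "\<lambda>s. c (q s) - u (X s)"
  note X0 = path_start[OF X]
  have Xt: "X s = x + integral {0..s} ?f" if "s \<in> {0..t}" for s
    using integral_unique[OF X[of s]] that by simp
  have cont: "continuous_on {0..t} X"
    by (subst continuous_on_cong[OF refl Xt])
       (auto intro!: continuous_intros indefinite_integral_continuous_1 has_integral_integrable[OF X[OF t]])
  have "X t \<le> b"
  proof (rule stays_below_barrier[OF cont t _ ends(3)])
    fix s s' assume s: "0 \<le> s" "s < s'" "s' \<le> t" and out: "\<And>\<tau>. \<tau> \<in> {s<..s'} \<Longrightarrow> b \<le> X \<tau> \<and> X \<tau> \<le> r"
    \<comment> \<open>At \<open>s\<close> itself the sign of the drift is unknown; a single point does not matter for the integral.\<close>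
    have "((\<lambda>\<tau>. if \<tau> = s then 0 else ?f \<tau>) has_integral (X s' - X s)) {s..s'}"
      by (rule has_integral_spike_finite[OF _ _ path_increment[OF X], of "{s}"]) (use s in auto)
    then have "X s' - X s \<le> 0"
    proof (rule has_integral_le[OF _ has_integral_0])
      fix \<tau> assume "\<tau> \<in> {s..s'}"
      then show "(if \<tau> = s then 0 else ?f \<tau>) \<le> 0"
        using out[of \<tau>] u_above[of "X \<tau>"] q[of \<tau>] s c_less by fastforce
    qed
    then show "X s' \<le> X s" by simp
  qed (use X0 x in auto)
  moreover have "- X t \<le> - a"
  proof (rule stays_below_barrier[of t "\<lambda>t. - X t" "- a" "- l"])
    fix s s' assume s: "0 \<le> s" "s < s'" "s' \<le> t"
      and out: "\<And>\<tau>. \<tau> \<in> {s<..s'} \<Longrightarrow> - a \<le> - X \<tau> \<and> - X \<tau> \<le> - l"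
    have "((\<lambda>\<tau>. if \<tau> = s then 0 else ?f \<tau>) has_integral (X s' - X s)) {s..s'}"
      by (rule has_integral_spike_finite[OF _ _ path_increment[OF X], of "{s}"]) (use s in auto)
    then have "0 \<le> X s' - X s"
    proof (rule has_integral_le[OF has_integral_0])
      fix \<tau> assume "\<tau> \<in> {s..s'}"
      then show "0 \<le> (if \<tau> = s then 0 else ?f \<tau>)"
        using out[of \<tau>] u_below[of "X \<tau>"] q[of \<tau>] s c_less by fastforce
    qed
    then show "- X s' \<le> - X s" by simp
  qed (use X0 x t ends cont in \<open>auto intro!: continuous_intros\<close>)
  ultimately show ?thesis by simp
qed

text \<open>On a mesh interval without a jump the Euler step has an error of second order in the mesh;
  the finitely many other intervals contribute an error of first order each.\<close>

lemma euler_path_converges: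
  fixes X :: "real \<Rightarrow> real" and q :: "real \<Rightarrow> nat"
  assumes X: "\<And>t. t \<ge> 0 \<Longrightarrow> ((\<lambda>s. c (q s) - u (X s)) has_integral (X t - x)) {0..t}"
    and q: "\<And>s. s \<ge> 0 \<Longrightarrow> q s \<in> {0, 1}" and x: "x \<in> {a..b}" and T: "T \<ge> 0"
    and rc: "\<And>t. t \<ge> 0 \<Longrightarrow> \<forall>\<^sub>F s in at_right t. q s = q t"
    and ll: "\<And>t. t > 0 \<Longrightarrow> \<exists>j. \<forall>\<^sub>F s in at_left t. q s = j"
  shows "(\<lambda>n. euler_path (T / real n) q x n) \<longlonglongrightarrow> X T"
proof -
  note inside = path_in[OF X q x, simplified]
  note X0 = path_start[OF X]
  have XL: "\<bar>X t - X s\<bar> \<le> speed * (t - s)" if "0 \<le> s" "s \<le> t" for s t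
  proof -
    have "norm (X t - X s) \<le> speed * measure lborel (cbox s t)"
      using path_increment[OF X that] speed_pos that
      by (intro has_integral_bound) (auto intro!: drift_bound[OF _ q, simplified] simp: inside)
    then show ?thesis using that by simp
  qed
  obtain D where D: "finite D"
    "\<And>s s'. 0 \<le> s \<Longrightarrow> s < s' \<Longrightarrow> s' \<le> T \<Longrightarrow> q s \<noteq> q s' \<Longrightarrow> \<exists>d\<in>D. s < d \<and> d \<le> s'"
    using finitely_many_jumps[OF T rc ll] by blast
  define B where "B h = exp (T * Lip) * (h * speed * card D + Lip * speed * T * h)" for h
  have bound: "\<bar>X T - euler_path (T / real n) q x n\<bar> \<le> B (T / real n)"
    if n: "n > 0" "small (T / real n)" for n
  proof -
    define h where "h = T / real n"
    have h: "0 \<le> h" "real n * h = T" "small h" using n T by (auto simp: h_def)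
    \<comment> \<open>\<open>N k\<close> counts the jumps in the \<open>k\<close>-th mesh interval; by disjointness these numbers add up to at most \<open>card D\<close>.\<close>
    define N where "N k = card {d \<in> D. real k * h < d \<and> d \<le> real (Suc k) * h}" for k
    define Y where "Y = euler_path h q x"
    define E where "E k = \<bar>X (real k * h) - Y k\<bar>" for k
    define \<epsilon> where "\<epsilon> k = h * (speed * N k + Lip * speed * h)" for k
    have \<epsilon>: "\<epsilon> k \<ge> 0" for k using h(1) Lip(1) speed_pos by (simp add: \<epsilon>_def)
    have tk: "real k * h \<ge> 0" for k using h(1) by simp
    have local: "\<bar>X (real (Suc k) * h) - euler h (q (real k * h)) (X (real k * h))\<bar> \<le> \<epsilon> k"
      if k: "k < n" for k
    proof -
      let ?s = "real k * h" and ?t = "real (Suc k) * h"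
      have st: "?s \<le> ?t" "?t - ?s = h" using h(1) by (auto simp: algebra_simps)
      have "?t \<le> T" unfolding h(2)[symmetric] using k h(1) by (intro mult_right_mono) auto
      have "((\<lambda>s. c (q s) - u (X s) - (c (q ?s) - u (X ?s))) has_integral
          (X ?t - X ?s - h * (c (q ?s) - u (X ?s)))) {?s..?t}"
        using has_integral_diff[OF path_increment[OF X tk[of k] st(1)]
          has_integral_const_real[of "c (q ?s) - u (X ?s)" ?s ?t]] st by simp
      then have "norm (X ?t - X ?s - h * (c (q ?s) - u (X ?s)))
          \<le> (speed * N k + Lip * speed * h) * measure lborel (cbox ?s ?t)"
      proof (intro has_integral_bound)
        fix s assume "s \<in> cbox ?s ?t"
        then have s: "?s \<le> s" "s \<le> ?t" by auto
        have "\<bar>c (q s) - c (q ?s)\<bar> \<le> speed * N k"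
        proof (cases "q s = q ?s")
          case False
          then have "?s < s" using s by (cases "?s = s") auto
          then obtain d where "d \<in> D" "?s < d" "d \<le> s"
            using D(2)[of ?s s] False s tk[of k] \<open>?t \<le> T\<close> by auto
          with s(2) have "d \<in> {d \<in> D. ?s < d \<and> d \<le> ?t}" by auto
          then have "{d \<in> D. ?s < d \<and> d \<le> ?t} \<noteq> {}" by blast
          moreover have "finite {d \<in> D. ?s < d \<and> d \<le> ?t}" using D(1) by simp
          ultimately have "0 < card {d \<in> D. ?s < d \<and> d \<le> ?t}" unfolding card_gt_0_iff by blast
          then have "N k \<ge> 1" unfolding N_def by linarith
          then have "speed * 1 \<le> speed * N k" using speed_pos by (intro mult_left_mono) auto
          moreover have "\<bar>c (q s) - c (q ?s)\<bar> \<le> speed"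
            using q[of s] q[of ?s] tk[of k] s c_less by (auto simp: speed_def)
          ultimately show ?thesis by simp
        qed (use speed_pos in simp)
        moreover have "\<bar>u (X s) - u (X ?s)\<bar> \<le> Lip * speed * h"
        proof -
          have "\<bar>u (X s) - u (X ?s)\<bar> \<le> Lip * \<bar>X s - X ?s\<bar>"
            using s tk[of k] by (intro u_lipschitz) (auto simp: inside)
          also have "\<dots> \<le> Lip * (speed * (s - ?s))"
            using XL[OF tk[of k] s(1)] Lip(1) by (intro mult_left_mono) auto
          also have "\<dots> \<le> Lip * (speed * h)"
            using s st(2) Lip(1) speed_pos by (intro mult_left_mono) auto
          finally show ?thesis by simp
        qed
        ultimately show "norm (c (q s) - u (X s) - (c (q ?s) - u (X ?s))) \<le> speed * N k + Lip * speed * h"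
          unfolding real_norm_def by linarith
      qed (use Lip(1) speed_pos h(1) in auto)
      then show ?thesis using st by (simp add: euler_def \<epsilon>_def mult.commute diff_diff_eq)
    qed
    have step: "E (Suc k) \<le> (1 + h * Lip) * E k + \<epsilon> k" if "k < n" for k
    proof -
      have "\<bar>euler h (q (real k * h)) (X (real k * h)) - Y (Suc k)\<bar> \<le> (1 + h * Lip) * E k"
        unfolding E_def Y_def euler_path.simps
        using euler_lipschitz[OF h(1)] inside[OF tk] euler_path_in[OF h(3) q x] by auto
      with local[OF that] show ?thesis unfolding E_def by linarith
    qed
    have one: "1 \<le> 1 + h * Lip" using h(1) Lip(1) by simp
    have "E k \<le> (1 + h * Lip) ^ k * (\<Sum>j<k. \<epsilon> j)" if "k \<le> n" for k
      using that
    proof (induction k)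
      case 0 then show ?case by (simp add: E_def Y_def X0)
    next
      case (Suc k)
      have "E (Suc k) \<le> (1 + h * Lip) * ((1 + h * Lip) ^ k * (\<Sum>j<k. \<epsilon> j)) + \<epsilon> k"
        using step[of k] Suc one mult_left_mono[OF Suc.IH, of "1 + h * Lip"] by linarith
      also have "\<epsilon> k \<le> (1 + h * Lip) ^ Suc k * \<epsilon> k"
        using mult_right_mono[OF one_le_power[OF one, of "Suc k"] \<epsilon>[of k]] by simp
      finally show ?case by (simp add: algebra_simps)
    qed
    from this[of n] have "E n \<le> (1 + h * Lip) ^ n * (\<Sum>j<n. \<epsilon> j)" by simp
    also have "\<dots> \<le> exp (T * Lip) * (\<Sum>j<n. \<epsilon> j)"
      using growth_bound[OF h(1), of n] h(2) \<epsilon> by (intro mult_right_mono sum_nonneg) auto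
    also have "(\<Sum>j<n. \<epsilon> j) = h * speed * real (\<Sum>j<n. N j) + Lip * speed * h * (real n * h)"
      by (simp add: \<epsilon>_def sum.distrib sum_distrib_left algebra_simps)
    also have "(\<Sum>j<n. N j) = card (\<Union>j<n. {d \<in> D. real j * h < d \<and> d \<le> real (Suc j) * h})"
      unfolding N_def
    proof (rule card_UN_disjoint[symmetric])
      have "\<not> (real i * h < d \<and> d \<le> real (Suc i) * h \<and> real j * h < d)" if "i < j" for i j d
      proof -
        have "real (Suc i) * h \<le> real j * h" using that h(1) by (intro mult_right_mono) auto
        then show ?thesis by linarith
      qed
      then show "\<forall>i\<in>{..<n}. \<forall>j\<in>{..<n}. i \<noteq> j \<longrightarrow> {d \<in> D. real i * h < d \<and> d \<le> real (Suc i) * h} \<inter>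
          {d \<in> D. real j * h < d \<and> d \<le> real (Suc j) * h} = {}"
        by (auto simp: neq_iff)
    qed (use D(1) in auto)
    also have "h * speed * real (card (\<Union>j<n. {d \<in> D. real j * h < d \<and> d \<le> real (Suc j) * h}))
        + Lip * speed * h * (real n * h) \<le> h * speed * real (card D) + Lip * speed * T * h"
    proof -
      have "card (\<Union>j<n. {d \<in> D. real j * h < d \<and> d \<le> real (Suc j) * h}) \<le> card D"
        using D(1) by (intro card_mono) auto
      then show ?thesis unfolding h(2) using h(1) speed_pos
        by (intro add_mono mult_left_mono) auto
    qed
    finally show ?thesis unfolding E_def B_def h_def[symmetric] h(2) Y_def by simp
  qed
  have "(\<lambda>n. B (T / real n)) \<longlonglongrightarrow> exp (T * Lip) * (0 * speed * card D + Lip * speed * T * 0)"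
    unfolding B_def by (intro tendsto_intros lim_const_over_n)
  then have B0: "(\<lambda>n. B (T / real n)) \<longlonglongrightarrow> 0" by simp
  have "\<forall>\<^sub>F n in sequentially. \<bar>X T - euler_path (T / real n) q x n\<bar> \<le> B (T / real n)"
    using small_eventually[OF T] eventually_gt_at_top[of 0]
  proof eventually_elim
    case (elim n)
    then show ?case using bound[of n] by blast
  qed
  then have "(\<lambda>n. euler_path (T / real n) q x n - X T) \<longlonglongrightarrow> 0"
    by (intro Lim_null_comparison[OF _ B0]) (simp add: abs_minus_commute)
  then show ?thesis by (simp add: LIM_zero_iff)
qed

end

section \<open>Expectations as limits of iterated steps\<close>

lemma integral_finite_range:
  fixes \<psi> :: "'b \<Rightarrow> real"
  assumes "finite_measure M" "finite S" "\<And>\<omega>. \<omega> \<in> space M \<Longrightarrow> Y \<omega> \<in> S"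
    and sets: "\<And>y. {\<omega> \<in> space M. Y \<omega> = y} \<in> sets M" "B \<in> sets M"
  shows "(\<integral>\<omega>. \<psi> (Y \<omega>) * indicator B \<omega> \<partial>M)
    = (\<Sum>y\<in>S. \<psi> y * measure M ({\<omega> \<in> space M. Y \<omega> = y} \<inter> B))"
proof -
  interpret finite_measure M by fact
  let ?E = "\<lambda>y. {\<omega> \<in> space M. Y \<omega> = y} \<inter> B"
  have "(\<integral>\<omega>. \<psi> (Y \<omega>) * indicator B \<omega> \<partial>M) = (\<integral>\<omega>. (\<Sum>y\<in>S. \<psi> y * indicator (?E y) \<omega>) \<partial>M)"
  proof (rule Bochner_Integration.integral_cong[OF refl])
    fix \<omega> assume \<omega>: "\<omega> \<in> space M"
    have "(\<Sum>y\<in>S. \<psi> y * indicator (?E y) \<omega>) = (\<Sum>y\<in>S. if Y \<omega> = y then \<psi> y * indicator B \<omega> else 0)"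
      using \<omega> by (intro sum.cong) (auto simp: indicator_def)
    also have "\<dots> = \<psi> (Y \<omega>) * indicator B \<omega>"
      using assms(2,3) \<omega> by simp
    finally show "\<psi> (Y \<omega>) * indicator B \<omega> = (\<Sum>y\<in>S. \<psi> y * indicator (?E y) \<omega>)" by simp
  qed
  also have "\<dots> = (\<Sum>y\<in>S. \<integral>\<omega>. \<psi> y * indicator (?E y) \<omega> \<partial>M)"
    by (rule Bochner_Integration.integral_sum, rule integrable_mult_right)
      (simp add: sets emeasure_eq_measure sets.Int integrable_indicator_iff)
  also have "\<dots> = (\<Sum>y\<in>S. \<psi> y * measure M (?E y))"
    using sets by (intro sum.cong) (auto intro!: arg_cong[where f = "measure M"] dest: sets.sets_into_space)
  finally show ?thesis .
qed

definition past :: "'w measure \<Rightarrow> (real \<Rightarrow> 'w \<Rightarrow> nat) \<Rightarrow> real \<Rightarrow> 'w measure" where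
  "past M \<xi> s = sigma (space M) {\<xi> u -` {k} \<inter> space M | u k. 0 \<le> u \<and> u \<le> s}"

lemma space_past: "space (past M \<xi> s) = space M"
  unfolding past_def by (rule space_measure_of) auto

lemma sets_past: "sets (past M \<xi> s) = past_events M \<xi> s"
  unfolding past_def past_events_def by (rule sets_measure_of) auto

lemma state_measurable_past:
  assumes "0 \<le> u" "u \<le> s"
  shows "\<xi> u \<in> measurable (past M \<xi> s) (count_space UNIV)"
  unfolding measurable_count_space_eq_countable[OF countableI_type[of UNIV]] space_past sets_past past_events_def
  using assms by (auto intro!: sigma_sets.Basic)

text \<open>An observable of the past with finitely many values is a linear combination of indicators of
  past events.\<close>

lemma markov_finite_range:
  fixes p :: "real \<Rightarrow> nat \<Rightarrow> nat \<Rightarrow> real" and \<psi> :: "real \<Rightarrow> real"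
  assumes M: "finite_measure M" and Y: "Y \<in> borel_measurable (past M \<xi> s)" "finite S" "\<And>\<omega>. \<omega> \<in> space M \<Longrightarrow> Y \<omega> \<in> S"
    and \<xi>: "\<And>t. t \<ge> 0 \<Longrightarrow> \<xi> t \<in> measurable M (count_space UNIV)" and "0 \<le> s" "0 \<le> h"
    and markov: "\<And>E. E \<in> past_events M \<xi> s \<Longrightarrow>
      measure M (E \<inter> {\<omega>\<in>space M. \<xi> s \<omega> = j \<and> \<xi> (s + h) \<omega> = k}) =
           p h j k * measure M (E \<inter> {\<omega>\<in>space M. \<xi> s \<omega> = j})"
  shows "(\<integral>\<omega>. \<psi> (Y \<omega>) * indicator {\<omega>\<in>space M. \<xi> s \<omega> = j \<and> \<xi> (s + h) \<omega> = k} \<omega> \<partial>M)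
    = p h j k * (\<integral>\<omega>. \<psi> (Y \<omega>) * indicator {\<omega>\<in>space M. \<xi> s \<omega> = j} \<omega> \<partial>M)"
proof -
  have [measurable]: "\<xi> s \<in> measurable M (count_space UNIV)" "\<xi> (s + h) \<in> measurable M (count_space UNIV)"
    using \<xi> \<open>0 \<le> s\<close> \<open>0 \<le> h\<close> by auto
  have ev: "{\<omega> \<in> space M. Y \<omega> = y} \<in> past_events M \<xi> s" for y
  proof -
    have "{\<omega> \<in> space (past M \<xi> s). Y \<omega> = y} \<in> sets (past M \<xi> s)" using Y(1) by measurable
    then show ?thesis by (simp add: space_past sets_past)
  qed
  have "past_events M \<xi> s \<subseteq> sets M"
    unfolding past_events_def
  proof (rule sets.sigma_sets_subset, safe)
    fix u :: real and k assume "0 \<le> u"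
    from measurable_sets[OF \<xi>[OF this], of "{k}"] show "\<xi> u -` {k} \<inter> space M \<in> sets M" by simp
  qed
  with ev have evM: "{\<omega> \<in> space M. Y \<omega> = y} \<in> sets M" for y by blast
  show ?thesis
    by (subst (1 2) integral_finite_range[OF M Y(2,3) evM])
      (auto simp: sum_distrib_left markov[OF ev] intro!: sum.cong)
qed

context increasing_branch
begin

lemma euler_path_measurable:
  assumes "\<And>j. j < k \<Longrightarrow> \<xi> (real j * h) \<in> measurable N (count_space UNIV)"
  shows "(\<lambda>\<omega>. euler_path h (\<lambda>s. \<xi> s \<omega>) x k) \<in> borel_measurable N"
  using assms
proof (induction k)
  case (Suc k)
  then have [measurable]: "(\<lambda>\<omega>. euler_path h (\<lambda>s. \<xi> s \<omega>) x k) \<in> borel_measurable N"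
    "\<xi> (real k * h) \<in> measurable N (count_space UNIV)" by auto
  have [measurable]: "u \<in> borel_measurable borel"
    by (intro borel_measurable_continuous_onI cont_u)
  have "(\<lambda>\<omega>. c (\<xi> (real k * h) \<omega>)) \<in> borel_measurable N"
    by (rule measurable_compose[OF Suc.prems[of k]]) auto
  then show ?case unfolding euler_path.simps euler_def by measurable
qed simp

text \<open>The Euler path is a function of finitely many states. The finite range is what allows the
  Markov property, which speaks of events, to be applied to it.\<close>

lemma euler_path_finite_range:
  assumes "\<And>\<omega> s. \<omega> \<in> \<Omega> \<Longrightarrow> 0 \<le> s \<Longrightarrow> \<xi> s \<omega> \<in> {0, 1::nat}" "0 \<le> h"
  shows "\<exists>S. finite S \<and> (\<forall>\<omega>\<in>\<Omega>. euler_path h (\<lambda>s. \<xi> s \<omega>) x k \<in> S)"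
proof (induction k)
  case (Suc k)
  then obtain S where S: "finite S" "\<And>\<omega>. \<omega> \<in> \<Omega> \<Longrightarrow> euler_path h (\<lambda>s. \<xi> s \<omega>) x k \<in> S" by auto
  have "euler_path h (\<lambda>s. \<xi> s \<omega>) x (Suc k) \<in> (\<Union>j\<in>{0,1}. euler h j ` S)" if "\<omega> \<in> \<Omega>" for \<omega>
    using S(2)[OF that] assms(1)[OF that, of "real k * h"] assms(2) by auto
  with S(1) show ?case by (intro exI[of _ "\<Union>j\<in>{0,1}. euler h j ` S"]) auto
qed (auto intro: exI[of _ "{x}"])

text \<open>The operator \<open>step\<close> switches with probability \<open>lam j * h\<close>, the process with probability
  \<open>p h j (1 - j)\<close>. Given the past the two one-step expectations differ by the difference of
  these probabilities times \<open>\<psi>\<close>, the effect of a switch.\<close>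

lemma one_step_error:
  fixes \<phi> :: "nat \<Rightarrow> real \<Rightarrow> real"
  assumes M: "prob_space M" and \<xi>: "\<And>t. t \<ge> 0 \<Longrightarrow> \<xi> t \<in> measurable M (count_space {0, 1})"
    and markov: "\<And>s h E j k. 0 \<le> s \<Longrightarrow> 0 \<le> h \<Longrightarrow> E \<in> past_events M \<xi> s \<Longrightarrow> j \<in> {0, 1} \<Longrightarrow> k \<in> {0, 1} \<Longrightarrow>
      measure M (E \<inter> {\<omega>\<in>space M. \<xi> s \<omega> = j \<and> \<xi> (s + h) \<omega> = k}) =
           p h j k * measure M (E \<inter> {\<omega>\<in>space M. \<xi> s \<omega> = j})"
    and h: "small h" and x: "x \<in> {a..b}"
    and \<phi>: "\<And>i. i \<in> {0, 1} \<Longrightarrow> continuous_on UNIV (\<phi> i)"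
      "\<And>i x. i \<in> {0, 1} \<Longrightarrow> x \<in> {a..b} \<Longrightarrow> \<bar>\<phi> i x\<bar> \<le> F"
  shows "\<bar>(\<integral>\<omega>. \<phi> (\<xi> (real (Suc k) * h) \<omega>) (euler_path h (\<lambda>s. \<xi> s \<omega>) x (Suc k)) \<partial>M)
      - (\<integral>\<omega>. step h \<phi> (\<xi> (real k * h) \<omega>) (euler_path h (\<lambda>s. \<xi> s \<omega>) x k) \<partial>M)\<bar>
    \<le> 2 * F * (\<bar>p h 0 1 - lam 0 * h\<bar> + \<bar>p h 1 0 - lam 1 * h\<bar>)"
proof -
  interpret prob_space M by fact
  have h0: "0 \<le> h" using h by (simp add: small_def)
  have \<xi>': "\<xi> t \<in> measurable M (count_space UNIV)" if "t \<ge> 0" for t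
    by (rule measurable_compose[OF \<xi>[OF that]]) simp
  have \<xi>01: "\<xi> t \<omega> \<in> {0, 1}" if "\<omega> \<in> space M" "t \<ge> 0" for t \<omega>
    using measurable_space[OF \<xi>[OF that(2)] that(1)] by simp
  define s where "s = real k * h"
  have s: "0 \<le> s" "real (Suc k) * h = s + h" using h0 by (auto simp: s_def algebra_simps)
  define Y where "Y \<omega> = euler_path h (\<lambda>s. \<xi> s \<omega>) x k" for \<omega>
  have Y_in: "Y \<omega> \<in> {a..b}" if "\<omega> \<in> space M" for \<omega>
    unfolding Y_def using \<xi>01 that by (intro euler_path_in[OF h _ x]) auto
  have jh: "0 \<le> real j * h" "j \<le> k \<Longrightarrow> real j * h \<le> s" for j
    using h0 by (auto simp: s_def intro: mult_right_mono)
  have Y_past: "Y \<in> borel_measurable (past M \<xi> s)"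
    unfolding Y_def by (intro euler_path_measurable state_measurable_past) (auto simp: jh)
  have YM[measurable]: "Y \<in> borel_measurable M"
    unfolding Y_def by (intro euler_path_measurable \<xi>') (auto simp: jh)
  have sh: "0 \<le> s + h" using s(1) h0 by simp
  note [measurable] = \<xi>'[OF s(1)] \<xi>'[OF sh]
  obtain S where S: "finite S" "\<And>\<omega>. \<omega> \<in> space M \<Longrightarrow> Y \<omega> \<in> S"
    using euler_path_finite_range[of "space M" \<xi> h x k] \<xi>01 h0 unfolding Y_def by auto
  define \<psi> where "\<psi> j y = \<phi> (1 - j) (euler h j y) - \<phi> j (euler h j y)" for j y
  define B where "B j = {\<omega>\<in>space M. \<xi> s \<omega> = j}" for j
  define B' where "B' j = {\<omega>\<in>space M. \<xi> s \<omega> = j \<and> \<xi> (s + h) \<omega> = 1 - j}" for j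
  have \<phi>e: "continuous_on UNIV (\<lambda>y. \<phi> l (euler h j y))" if "l \<in> {0, 1}" for l j
    by (rule continuous_on_compose2[OF \<phi>(1)[OF that] cont_euler]) auto
  have \<phi>m: "\<phi> l \<in> borel_measurable borel" "(\<lambda>y. \<phi> l (euler h j y)) \<in> borel_measurable borel" if "l \<in> {0, 1}" for l j
    using \<phi>(1)[OF that] \<phi>e[OF that] by (auto intro: borel_measurable_continuous_onI)
  have \<psi>m: "\<psi> j \<in> borel_measurable borel" if "j \<in> {0, 1}" for j
    unfolding \<psi>_def[abs_def] by (intro borel_measurable_diff \<phi>m that) auto
  have [measurable]: "\<phi> 0 \<in> borel_measurable borel" "\<phi> 1 \<in> borel_measurable borel"
    by (auto intro: \<phi>m)
  have B[measurable]: "B j \<in> sets M" "B' j \<in> sets M" for j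
    unfolding B_def B'_def by measurable
  have \<psi>_bound: "\<bar>\<psi> j (Y \<omega>)\<bar> \<le> 2 * F" if "\<omega> \<in> space M" "j \<in> {0, 1}" for j \<omega>
  proof -
    have "euler h j (Y \<omega>) \<in> {a..b}" using euler_in[OF h that(2) Y_in[OF that(1)]] .
    moreover have "1 - j \<in> {0, 1}" by auto
    ultimately show ?thesis using \<phi>(2)[of j] \<phi>(2)[of "1 - j"] that(2)
      unfolding \<psi>_def by (smt (verit))
  qed
  have F: "0 \<le> F" using \<phi>(2)[of 0 x] x by auto
  have \<psi>_int: "integrable M (\<lambda>\<omega>. \<psi> j (Y \<omega>) * indicator A \<omega>)" if [measurable]: "A \<in> sets M" and j: "j \<in> {0, 1}" for A j
  proof (rule integrable_const_bound[of _ "2 * F"])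
    show "AE \<omega> in M. norm (\<psi> j (Y \<omega>) * indicator A \<omega>) \<le> 2 * F"
      using \<psi>_bound[OF _ j] F by (auto simp: indicator_def)
    show "(\<lambda>\<omega>. \<psi> j (Y \<omega>) * indicator A \<omega>) \<in> borel_measurable M"
      using measurable_compose[OF YM \<psi>m[OF j]] by measurable
  qed
  have mk: "(\<integral>\<omega>. \<psi> j (Y \<omega>) * indicator (B' j) \<omega> \<partial>M) = p h j (1 - j) * (\<integral>\<omega>. \<psi> j (Y \<omega>) * indicator (B j) \<omega> \<partial>M)"
    if j: "j \<in> {0, 1}" for j
    unfolding B_def B'_def
    by (rule markov_finite_range[OF _ Y_past S \<xi>' s(1) h0]) (use j s(1) h0 in \<open>auto intro!: markov finite_measure_axioms\<close>)
  let ?A = "\<lambda>\<omega>. \<phi> (\<xi> (s + h) \<omega>) (euler h (\<xi> s \<omega>) (Y \<omega>))" and ?R = "\<lambda>\<omega>. step h \<phi> (\<xi> s \<omega>) (Y \<omega>)"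
  \<comment> \<open>On each event \<open>B j\<close> both sides start from \<open>\<phi> j\<close> after the Euler step; only the switch remains.\<close>
  have dec: "?A \<omega> - ?R \<omega> = (\<Sum>j\<in>{0, 1}. \<psi> j (Y \<omega>) * indicator (B' j) \<omega> - lam j * h * (\<psi> j (Y \<omega>) * indicator (B j) \<omega>))"
    if "\<omega> \<in> space M" for \<omega>
    using \<xi>01[OF that s(1)] \<xi>01[OF that, of "s + h"] s(1) h0 that
    by (auto simp: B_def B'_def \<psi>_def step_def indicator_def algebra_simps)
  have Rint: "integrable M ?R"
  proof (rule integrable_const_bound[of _ F])
    show "AE \<omega> in M. norm (?R \<omega>) \<le> F"
      using step_bound[OF h \<phi>(2)] \<xi>01[OF _ s(1)] Y_in by auto
    have "step h \<phi> i \<in> borel_measurable borel" if "i \<in> {0, 1}" for i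
      using iterate_continuous[where f = \<phi> and i = i and h = h and n = 1] \<phi>(1) that by (auto intro: borel_measurable_continuous_onI)
    then have [measurable]: "step h \<phi> 0 \<in> borel_measurable borel" "step h \<phi> 1 \<in> borel_measurable borel" by auto
    have "(\<lambda>\<omega>. if \<xi> s \<omega> = 0 then step h \<phi> 0 (Y \<omega>) else step h \<phi> 1 (Y \<omega>)) \<in> borel_measurable M"
      by measurable
    moreover have "(if \<xi> s \<omega> = 0 then step h \<phi> 0 (Y \<omega>) else step h \<phi> 1 (Y \<omega>)) = ?R \<omega>" if "\<omega> \<in> space M" for \<omega>
      using \<xi>01[OF that s(1)] by auto
    ultimately show "?R \<in> borel_measurable M" by (simp cong: measurable_cong)
  qed
  let ?D = "\<lambda>\<omega>. \<Sum>j\<in>{0, 1}. \<psi> j (Y \<omega>) * indicator (B' j) \<omega> - lam j * h * (\<psi> j (Y \<omega>) * indicator (B j) \<omega>)"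
  have Dint: "integrable M ?D"
    by (intro Bochner_Integration.integrable_sum Bochner_Integration.integrable_diff integrable_mult_right \<psi>_int B)
  have "(\<integral>\<omega>. ?A \<omega> \<partial>M) = (\<integral>\<omega>. ?R \<omega> + ?D \<omega> \<partial>M)"
    by (rule Bochner_Integration.integral_cong[OF refl]) (use dec in force)
  also have "\<dots> = (\<integral>\<omega>. ?R \<omega> \<partial>M) + (\<integral>\<omega>. ?D \<omega> \<partial>M)"
    by (rule Bochner_Integration.integral_add[OF Rint Dint])
  also have "(\<integral>\<omega>. ?D \<omega> \<partial>M) = (\<Sum>j\<in>{0, 1}. (p h j (1 - j) - lam j * h) * (\<integral>\<omega>. \<psi> j (Y \<omega>) * indicator (B j) \<omega> \<partial>M))"
  proof -
    have "(\<integral>\<omega>. \<psi> j (Y \<omega>) * indicator (B' j) \<omega> - lam j * h * (\<psi> j (Y \<omega>) * indicator (B j) \<omega>) \<partial>M)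
        = (p h j (1 - j) - lam j * h) * (\<integral>\<omega>. \<psi> j (Y \<omega>) * indicator (B j) \<omega> \<partial>M)"
      if j: "j \<in> {0, 1}" for j
      by (subst Bochner_Integration.integral_diff)
        (simp_all only: \<psi>_int[OF B(1) j] \<psi>_int[OF B(2) j] mk[OF j] integrable_mult_right integral_mult_right_zero left_diff_distrib)
    moreover have "integrable M (\<lambda>\<omega>. \<psi> j (Y \<omega>) * indicator (B' j) \<omega> - lam j * h * (\<psi> j (Y \<omega>) * indicator (B j) \<omega>))"
      if j: "j \<in> {0, 1}" for j
      by (intro Bochner_Integration.integrable_diff integrable_mult_right \<psi>_int B j)
    ultimately show ?thesis
      by (subst Bochner_Integration.integral_sum) (auto simp del: sum.insert intro!: sum.cong)
  qed
  finally have eq: "(\<integral>\<omega>. ?A \<omega> \<partial>M) - (\<integral>\<omega>. ?R \<omega> \<partial>M)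
      = (\<Sum>j\<in>{0, 1}. (p h j (1 - j) - lam j * h) * (\<integral>\<omega>. \<psi> j (Y \<omega>) * indicator (B j) \<omega> \<partial>M))" by simp
  have le: "\<bar>\<integral>\<omega>. \<psi> j (Y \<omega>) * indicator (B j) \<omega> \<partial>M\<bar> \<le> 2 * F" if j: "j \<in> {0, 1}" for j
  proof -
    have "\<bar>\<integral>\<omega>. \<psi> j (Y \<omega>) * indicator (B j) \<omega> \<partial>M\<bar> \<le> (\<integral>\<omega>. 2 * F \<partial>M)"
    proof (rule order.trans[OF integral_abs_bound integral_mono])
      show "integrable M (\<lambda>\<omega>. \<bar>\<psi> j (Y \<omega>) * indicator (B j) \<omega>\<bar>)"
        using \<psi>_int[OF B(1) j] by (rule integrable_abs)
      show "\<bar>\<psi> j (Y \<omega>) * indicator (B j) \<omega>\<bar> \<le> 2 * F" if "\<omega> \<in> space M" for \<omega>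
        using \<psi>_bound[OF that j] F by (simp add: indicator_def)
    qed simp
    then show ?thesis by (simp add: prob_space)
  qed
  have "\<bar>(\<integral>\<omega>. ?A \<omega> \<partial>M) - (\<integral>\<omega>. ?R \<omega> \<partial>M)\<bar> \<le> (\<Sum>j\<in>{0, 1}. \<bar>p h j (1 - j) - lam j * h\<bar> * (2 * F))"
    unfolding eq by (rule order.trans[OF sum_abs], rule sum_mono) (auto simp: abs_mult intro!: mult_left_mono le)
  then show ?thesis unfolding s(2) euler_path.simps s_def[symmetric] Y_def[symmetric]
    by (simp add: algebra_simps)
qed

text \<open>The law of the process enters only through this limit. Conditioning on the past at mesh times
  turns the expectation along the Euler scheme into iterates of \<open>step\<close>, up to an error \<open>o(1/n)\<close>
  in each of the \<open>n\<close> steps.\<close>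

lemma expectation_limit_of_iterates:
  fixes g :: "nat \<Rightarrow> real \<Rightarrow> real"
  assumes mk: "two_state_markov M lam i \<xi>" and sol: "solves_switched_ode M U c \<xi> x X" and U: "deriv U = u"
    and i: "i \<in> {0, 1}" and x: "x \<in> {a..b}" and T: "T \<ge> 0"
    and g: "\<And>i. i \<in> {0, 1} \<Longrightarrow> continuous_on UNIV (g i)" "\<And>i x. i \<in> {0, 1} \<Longrightarrow> \<bar>g i x\<bar> \<le> F"
  shows "(\<lambda>n. (step (T / real n) ^^ n) g i x) \<longlonglongrightarrow> (\<integral>\<omega>. g (\<xi> T \<omega>) (X T \<omega>) \<partial>M)"
proof -
  from mk obtain p :: "real \<Rightarrow> nat \<Rightarrow> nat \<Rightarrow> real" where M: "prob_space M"
    and \<xi>: "\<And>t. t \<ge> 0 \<Longrightarrow> \<xi> t \<in> measurable M (count_space {0, 1})"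
    and start: "AE \<omega> in M. \<xi> 0 \<omega> = i"
    and paths: "AE \<omega> in M. (\<forall>t\<ge>0. \<forall>\<^sub>F s in at_right t. \<xi> s \<omega> = \<xi> t \<omega>) \<and>
                  (\<forall>t>0. \<exists>j. \<forall>\<^sub>F s in at_left t. \<xi> s \<omega> = j)"
    and markov: "\<And>s h E j k. 0 \<le> s \<Longrightarrow> 0 \<le> h \<Longrightarrow> E \<in> past_events M \<xi> s \<Longrightarrow> j \<in> {0, 1} \<Longrightarrow> k \<in> {0, 1} \<Longrightarrow>
      measure M (E \<inter> {\<omega>\<in>space M. \<xi> s \<omega> = j \<and> \<xi> (s + h) \<omega> = k}) =
           p h j k * measure M (E \<inter> {\<omega>\<in>space M. \<xi> s \<omega> = j})"
    and rate: "\<And>j. j \<in> {0, 1} \<Longrightarrow> ((\<lambda>h. p h j (1 - j) / h) \<longlongrightarrow> lam j) (at_right 0)"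
    unfolding two_state_markov_def by blast
  interpret prob_space M by fact
  have \<xi>': "\<xi> t \<in> measurable M (count_space UNIV)" if "t \<ge> 0" for t
    by (rule measurable_compose[OF \<xi>[OF that]]) simp
  have \<xi>01: "\<xi> t \<omega> \<in> {0, 1}" if "\<omega> \<in> space M" "t \<ge> 0" for t \<omega>
    using measurable_space[OF \<xi>[OF that(2)] that(1)] by simp
  have X[measurable]: "X T \<in> borel_measurable M" using sol T by (auto simp: solves_switched_ode_def)
  have ode: "AE \<omega> in M. \<forall>t\<ge>0. ((\<lambda>s. c (\<xi> s \<omega>) - u (X s \<omega>)) has_integral (X t \<omega> - x)) {0..t}"
    using sol U by (simp add: solves_switched_ode_def)
  have gm[measurable]: "g 0 \<in> borel_measurable borel" "g 1 \<in> borel_measurable borel"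
    using g(1) by (auto intro: borel_measurable_continuous_onI)
  have g_meas: "(\<lambda>\<omega>. g (\<xi> t \<omega>) (Z \<omega>)) \<in> borel_measurable M"
    if [measurable]: "Z \<in> borel_measurable M" and t: "t \<ge> 0" for Z t
  proof -
    note [measurable] = \<xi>'[OF t]
    have "(\<lambda>\<omega>. if \<xi> t \<omega> = 0 then g 0 (Z \<omega>) else g 1 (Z \<omega>)) \<in> borel_measurable M"
      by measurable
    moreover have "(if \<xi> t \<omega> = 0 then g 0 (Z \<omega>) else g 1 (Z \<omega>)) = g (\<xi> t \<omega>) (Z \<omega>)" if "\<omega> \<in> space M" for \<omega>
      using \<xi>01[OF that t] by auto
    ultimately show ?thesis by (simp cong: measurable_cong)
  qed
  \<comment> \<open>The rates are limits as \<open>h\<close> tends to \<open>0\<close> from the right, so a mesh of width \<open>0\<close> is treated separately.\<close>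
  show ?thesis
  proof (cases "T = 0")
    case True
    have fix0: "step 0 g = g"
      by (simp add: step_def euler_def fun_eq_iff)
    have iter0: "(step 0 ^^ n) g = g" for n
    proof (induction n)
      case (Suc n)
      then show ?case by (simp only: funpow.simps comp_apply fix0)
    qed simp
    have "(\<integral>\<omega>. g (\<xi> T \<omega>) (X T \<omega>) \<partial>M) = (\<integral>\<omega>. g i x \<partial>M)"
    proof (rule integral_cong_AE)
      show "AE \<omega> in M. g (\<xi> T \<omega>) (X T \<omega>) = g i x"
        using start ode
      proof eventually_elim
        case (elim \<omega>)
        then have "X 0 \<omega> = x" using path_start[of "\<lambda>s. \<xi> s \<omega>" "\<lambda>s. X s \<omega>" x] by simp
        with elim True show ?case by simp
      qed
    qed (auto intro: g_meas T)
    then show ?thesis using True by (simp add: prob_space iter0)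
  next
    case False
    with T have "T > 0" by simp
    define Y where "Y n \<omega> = euler_path (T / real n) (\<lambda>s. \<xi> s \<omega>) x n" for n \<omega>
    have [measurable]: "Y n \<in> borel_measurable M" for n
      unfolding Y_def using T by (intro euler_path_measurable \<xi>') auto
    have lim: "(\<lambda>n. \<integral>\<omega>. g (\<xi> T \<omega>) (Y n \<omega>) \<partial>M) \<longlonglongrightarrow> (\<integral>\<omega>. g (\<xi> T \<omega>) (X T \<omega>) \<partial>M)"
    proof (rule integral_dominated_convergence[where w = "\<lambda>_. F"])
      show "AE \<omega> in M. (\<lambda>n. g (\<xi> T \<omega>) (Y n \<omega>)) \<longlonglongrightarrow> g (\<xi> T \<omega>) (X T \<omega>)"
        using ode paths AE_space
      proof eventually_elim
        case (elim \<omega>)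
        then have "(\<lambda>n. Y n \<omega>) \<longlonglongrightarrow> X T \<omega>"
          unfolding Y_def using \<xi>01 T x by (intro euler_path_converges) auto
        moreover have "isCont (g (\<xi> T \<omega>)) (X T \<omega>)"
          using g(1)[OF \<xi>01[OF elim(3) T]] by (simp add: continuous_on_eq_continuous_at)
        ultimately show ?case by (rule isCont_tendsto_compose[rotated])
      qed
      show "AE \<omega> in M. norm (g (\<xi> T \<omega>) (Y n \<omega>)) \<le> F" for n
        using g(2) \<xi>01[OF _ T] by auto
    qed (auto intro: g_meas T)
    define e where "e h = \<bar>p h 0 1 - lam 0 * h\<bar> + \<bar>p h 1 0 - lam 1 * h\<bar>" for h
    have many: "\<bar>(\<integral>\<omega>. \<phi> (\<xi> (real m * h) \<omega>) (euler_path h (\<lambda>s. \<xi> s \<omega>) x m) \<partial>M) - (step h ^^ m) \<phi> i x\<bar>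
        \<le> real m * (2 * F * e h)"
      if h: "small h" and \<phi>: "\<And>i. i \<in> {0, 1} \<Longrightarrow> continuous_on UNIV (\<phi> i)"
        "\<And>i x. i \<in> {0, 1} \<Longrightarrow> x \<in> {a..b} \<Longrightarrow> \<bar>\<phi> i x\<bar> \<le> F" for h m \<phi>
      using \<phi>
    proof (induction m arbitrary: \<phi>)
      case 0
      have "\<phi> j \<in> borel_measurable borel" if "j \<in> {0, 1}" for j
        using 0(1)[OF that] by (intro borel_measurable_continuous_onI)
      then have "(\<integral>\<omega>. \<phi> (\<xi> 0 \<omega>) x \<partial>M) = (\<integral>\<omega>. \<phi> i x \<partial>M)"
        using start by (intro integral_cong_AE measurable_compose[OF \<xi>'[of 0]]) (auto elim: eventually_mono)
      then show ?case by (simp add: prob_space)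
    next
      case (Suc m)
      have c: "continuous_on UNIV (step h \<phi> j)" if "j \<in> {0, 1}" for j
        using iterate_continuous[where f = \<phi> and i = j and h = h and n = 1] Suc.prems(1) that by simp
      have bd: "\<bar>step h \<phi> j y\<bar> \<le> F" if "j \<in> {0, 1}" "y \<in> {a..b}" for j y
        using step_bound[OF h Suc.prems(2) that] .
      let ?A = "\<lambda>m \<phi>. \<integral>\<omega>. \<phi> (\<xi> (real m * h) \<omega>) (euler_path h (\<lambda>s. \<xi> s \<omega>) x m) \<partial>M"
      have "\<bar>?A (Suc m) \<phi> - ?A m (step h \<phi>)\<bar> \<le> 2 * F * e h"
        unfolding e_def by (rule one_step_error[OF M _ _ h x]; fact \<xi> markov Suc.prems)
      moreover have "\<bar>?A m (step h \<phi>) - (step h ^^ m) (step h \<phi>) i x\<bar> \<le> real m * (2 * F * e h)"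
        by (rule Suc.IH[OF c bd])
      moreover have "(step h ^^ m) (step h \<phi>) = (step h ^^ Suc m) \<phi>"
        by (simp only: funpow_Suc_right comp_apply)
      moreover have "real (Suc m) * (2 * F * e h) = real m * (2 * F * e h) + 2 * F * e h"
        by (simp add: algebra_simps)
      ultimately show ?case by (smt (verit))
    qed
    have r0: "((\<lambda>h. 2 * F * (e h / h)) \<longlongrightarrow> 2 * F * (\<bar>lam 0 - lam 0\<bar> + \<bar>lam 1 - lam 1\<bar>)) (at_right 0)"
    proof (rule tendsto_cong[THEN iffD1])
      show "\<forall>\<^sub>F h in at_right 0. 2 * F * (\<bar>p h 0 1 / h - lam 0\<bar> + \<bar>p h 1 0 / h - lam 1\<bar>) = 2 * F * (e h / h)"
        using eventually_at_right_less[of 0]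
      proof eventually_elim
        case (elim h)
        have "\<bar>p h 0 1 / h - lam 0\<bar> = \<bar>p h 0 1 - lam 0 * h\<bar> / h" "\<bar>p h 1 0 / h - lam 1\<bar> = \<bar>p h 1 0 - lam 1 * h\<bar> / h"
          using elim by (simp_all add: abs_if field_simps)
        then show ?case by (simp add: e_def add_divide_distrib)
      qed
      show "((\<lambda>h. 2 * F * (\<bar>p h 0 1 / h - lam 0\<bar> + \<bar>p h 1 0 / h - lam 1\<bar>)) \<longlongrightarrow>
          2 * F * (\<bar>lam 0 - lam 0\<bar> + \<bar>lam 1 - lam 1\<bar>)) (at_right 0)"
        using rate[of 0] rate[of 1] by (intro tendsto_intros) simp_all
    qed
    have hn: "filterlim (\<lambda>n. T / real n) (at_right 0) sequentially"
      unfolding filterlim_at using lim_const_over_n[of T] \<open>T > 0\<close>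
      by (auto intro!: eventually_mono[OF eventually_gt_at_top[of 0]])
    have "(\<lambda>n. T * (2 * F * (e (T / real n) / (T / real n)))) \<longlonglongrightarrow> T * 0"
      using filterlim_compose[OF r0 hn] by (intro tendsto_mult tendsto_const) simp
    then have err: "(\<lambda>n. T * (2 * F * (e (T / real n) / (T / real n)))) \<longlonglongrightarrow> 0" by simp
    have "\<forall>\<^sub>F n in sequentially. norm ((\<integral>\<omega>. g (\<xi> T \<omega>) (Y n \<omega>) \<partial>M) - (step (T / real n) ^^ n) g i x)
        \<le> T * (2 * F * (e (T / real n) / (T / real n)))"
      using small_eventually[OF T] eventually_gt_at_top[of 0]
    proof eventually_elim
      case (elim n)
      have nT: "real n * (T / real n) = T" using elim by simp
      have e: "real n * (2 * F * e (T / real n)) = T * (2 * F * (e (T / real n) / (T / real n)))"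
        using elim \<open>T > 0\<close> by simp
      have "\<bar>(\<integral>\<omega>. g (\<xi> (real n * (T / real n)) \<omega>) (Y n \<omega>) \<partial>M) - (step (T / real n) ^^ n) g i x\<bar>
        \<le> real n * (2 * F * e (T / real n))"
      proof -
        have bd: "\<bar>g j y\<bar> \<le> F" if "j \<in> {0, 1}" "y \<in> {a..b}" for j y by (rule g(2)[OF that(1)])
        show ?thesis unfolding Y_def by (rule many[of "T / real n" g n, OF elim(1) g(1) bd])
      qed
      then show ?case unfolding nT e real_norm_def .
    qed
    then have "(\<lambda>n. (\<integral>\<omega>. g (\<xi> T \<omega>) (Y n \<omega>) \<partial>M) - (step (T / real n) ^^ n) g i x) \<longlonglongrightarrow> 0"
      by (rule Lim_null_comparison[OF _ err])
    from tendsto_diff[OF lim this] show ?thesis by simp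
  qed
qed

end

section \<open>The stationary flux and its weights\<close>

text \<open>\<open>F\<close> grows at least like \<open>- \<kappa> ln (z - y)\<close>, because \<open>F y + \<kappa> ln (z - y) + K y\<close> is
  nondecreasing.\<close>

lemma exp_minus_vanishes_at_left:
  fixes F f :: "real \<Rightarrow> real"
  assumes "m < z" "\<kappa> > 0"
    and F: "\<And>y. m \<le> y \<Longrightarrow> y < z \<Longrightarrow> (F has_real_derivative f y) (at y)"
    and f: "\<And>y. m \<le> y \<Longrightarrow> y < z \<Longrightarrow> \<kappa> / (z - y) - K \<le> f y"
  shows "((\<lambda>y. exp (- F y)) \<longlongrightarrow> 0) (at_left z)"
proof -
  define G where "G y = F y + \<kappa> * ln (z - y) + K * y" for y
  have G: "G m \<le> G y" if y: "m \<le> y" "y < z" for y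
  proof (rule DERIV_nonneg_imp_nondecreasing[OF y(1)])
    fix t assume t: "m \<le> t" "t \<le> y"
    then have "(G has_real_derivative f t - \<kappa> / (z - t) + K) (at t)"
      unfolding G_def[abs_def] using y by (auto intro!: derivative_eq_intros F)
    with f[of t] t y show "\<exists>d. (G has_real_derivative d) (at t) \<and> 0 \<le> d" by force
  qed
  have sub: "filterlim (\<lambda>y. z - y) (at_right 0) (at_left z)"
    unfolding filterlim_at
    by (auto intro!: tendsto_eq_intros eventually_at_leftI[of "z - 1"])
  have "filterlim (\<lambda>y. (K * y - G m) + \<kappa> * ln (z - y)) at_bot (at_left z)"
    by (rule filterlim_tendsto_add_at_bot_iff[THEN iffD2, of _ "K * z - G m"])
      (auto intro!: tendsto_intros filterlim_tendsto_pos_mult_at_bot[OF tendsto_const \<open>\<kappa> > 0\<close>]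
        filterlim_compose[OF ln_at_0 sub])
  then have lim: "((\<lambda>y. exp ((K * y - G m) + \<kappa> * ln (z - y))) \<longlongrightarrow> 0) (at_left z)"
    by (rule filterlim_compose[OF exp_at_bot])
  have "\<forall>\<^sub>F y in at_left z. y \<in> {m<..<z}"
    using \<open>m < z\<close> by (rule eventually_at_left_real)
  then have "\<forall>\<^sub>F y in at_left z. norm (exp (- F y)) \<le> exp ((K * y - G m) + \<kappa> * ln (z - y))"
  proof eventually_elim
    case (elim y)
    with G[of y] show ?case by (simp add: G_def)
  qed
  then show ?thesis by (rule Lim_null_comparison[OF _ lim])
qed

locale stationary_branch = increasing_branch +
  fixes \<Phi> :: "nat \<Rightarrow> real \<Rightarrow> real"
  assumes deriv_\<Phi>: "i \<in> {0, 1} \<Longrightarrow> y \<in> {a<..<b} \<Longrightarrow> (\<Phi> i has_real_derivative 1 / (c i - u y)) (at y)"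
begin

text \<open>Extended by \<open>0\<close>, the function \<open>\<Psi>\<inverse>\<close> is continuous on the whole line.\<close>

definition flux :: "real \<Rightarrow> real" where
  "flux x = (if x \<in> {a<..<b} then Psi_inv lam \<Phi> x else 0)"

lemma flux_nonneg: "0 \<le> flux x"
  by (simp add: flux_def Psi_inv_def)

lemma flux_pos: "x \<in> {a<..<b} \<Longrightarrow> 0 < flux x"
  by (simp add: flux_def Psi_inv_def)

lemma flux_outside: "x \<notin> {a<..<b} \<Longrightarrow> flux x = 0"
  by (auto simp: flux_def)

text \<open>The stationary densities up to normalisation. Outside \<open>(a, b)\<close> they vanish with the flux; at the
  endpoint where the denominator is \<open>0\<close> this agrees with \<open>0 / 0 = 0\<close>.\<close>

definition weight :: "nat \<Rightarrow> real \<Rightarrow> real" where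
  "weight i x = flux x / \<bar>c i - u x\<bar>"

lemma weight_nonneg: "0 \<le> weight i x"
  by (simp add: weight_def flux_nonneg)

lemma weight_outside: "x \<notin> {a<..<b} \<Longrightarrow> weight i x = 0"
  by (simp add: weight_def flux_outside)

lemma drift_weight: "(c 0 - u x) * weight 0 x = flux x" "(c 1 - u x) * weight 1 x = - flux x"
proof -
  have "(c 0 - u x) * weight 0 x = flux x \<and> (c 1 - u x) * weight 1 x = - flux x"
  proof (cases "x \<in> {a<..<b}")
    case True
    with u_strict[OF True] show ?thesis by (simp add: weight_def field_simps)
  qed (simp add: weight_outside flux_outside)
  then show "(c 0 - u x) * weight 0 x = flux x" "(c 1 - u x) * weight 1 x = - flux x" by auto
qed

lemma flux_deriv: 
  assumes "x \<in> {a<..<b}"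
  shows "(flux has_real_derivative lam 1 * weight 1 x - lam 0 * weight 0 x) (at x)"
proof -
  have "((\<lambda>x. Psi_inv lam \<Phi> x) has_real_derivative
      Psi_inv lam \<Phi> x * (- lam 0 * (1 / (c 0 - u x)) - lam 1 * (1 / (c 1 - u x)))) (at x)"
    unfolding Psi_inv_def using assms
    by (auto intro!: derivative_eq_intros deriv_\<Phi>[of 0] deriv_\<Phi>[of 1, simplified])
  moreover have "Psi_inv lam \<Phi> x * (- lam 0 * (1 / (c 0 - u x)) - lam 1 * (1 / (c 1 - u x)))
      = lam 1 * weight 1 x - lam 0 * weight 0 x"
  proof -
    have "weight 0 x = Psi_inv lam \<Phi> x * (1 / (c 0 - u x))" "weight 1 x = - (Psi_inv lam \<Phi> x * (1 / (c 1 - u x)))"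
      using u_strict[OF assms] assms by (auto simp: weight_def flux_def minus_divide_right)
    then show ?thesis by (simp add: algebra_simps)
  qed
  ultimately have "((\<lambda>x. Psi_inv lam \<Phi> x) has_real_derivative lam 1 * weight 1 x - lam 0 * weight 0 x) (at x)"
    by simp
  then show ?thesis
    by (rule has_field_derivative_transform_within_open[of _ _ _ "{a<..<b}"])
      (use assms in \<open>auto simp: flux_def\<close>)
qed

text \<open>Near \<open>b\<close> the function \<open>\<Phi> 0\<close> tends to infinity, because the drift vanishes at most linearly,
  whereas \<open>\<Phi> 1\<close> stays bounded; near \<open>a\<close> the roles are exchanged.\<close>

lemma Psi_inv_vanishes:
  "(Psi_inv lam \<Phi> \<longlongrightarrow> 0) (at_left b)" "(Psi_inv lam \<Phi> \<longlongrightarrow> 0) (at_right a)"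
proof -
  define m where "m = (a + b) / 2"
  have m: "a < m" "m < b" using ends by (auto simp: m_def)
  define F where "F y = lam 0 * \<Phi> 0 y + lam 1 * \<Phi> 1 y" for y
  define f where "f y = lam 0 * (1 / (c 0 - u y)) + lam 1 * (1 / (c 1 - u y))" for y
  have F: "(F has_real_derivative f y) (at y)" if "y \<in> {a<..<b}" for y
    unfolding F_def[abs_def] f_def using that
    by (auto intro!: derivative_eq_intros deriv_\<Phi>[of 0] deriv_\<Phi>[of 1, simplified])
  have Psi: "Psi_inv lam \<Phi> = (\<lambda>y. exp (- F y))"
    by (simp add: Psi_inv_def F_def fun_eq_iff)
  have um: "u y \<le> u y'" if "a < y" "y \<le> y'" "y' < b" for y y'
    using strict_mono_on_leD[OF mono_u, of y y'] that ends by auto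
  have "((\<lambda>y. exp (- F y)) \<longlongrightarrow> 0) (at_left b)"
  proof (rule exp_minus_vanishes_at_left[OF m(2), where \<kappa> = "lam 0 / Lip" and K = "lam 1 / (u m - c 1)"])
    fix y assume y: "m \<le> y" "y < b"
    then have yi: "y \<in> {a<..<b}" using m by auto
    show "(F has_real_derivative f y) (at y)" by (rule F[OF yi])
    have "c 0 - u y \<le> Lip * (b - y)"
      using u_lipschitz[of b y] yi u_b u_between[of y] by auto
    then have "1 / (Lip * (b - y)) \<le> 1 / (c 0 - u y)"
      using u_strict[OF yi] by (intro divide_left_mono) auto
    then have "lam 0 * (1 / (Lip * (b - y))) \<le> lam 0 * (1 / (c 0 - u y))"
      using lam_pos by (intro mult_left_mono) auto
    moreover have "1 / (u y - c 1) \<le> 1 / (u m - c 1)"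
      using u_strict[OF yi] u_strict[of m] um[of m y] m y by (intro divide_left_mono) auto
    then have "lam 1 * (1 / (u y - c 1)) \<le> lam 1 * (1 / (u m - c 1))"
      using lam_pos by (intro mult_left_mono) auto
    moreover have "1 / (c 1 - u y) = - (1 / (u y - c 1))"
      by (simp add: minus_divide_right)
    ultimately show "lam 0 / Lip / (b - y) - lam 1 / (u m - c 1) \<le> f y"
      unfolding f_def by simp
  qed (use lam_pos Lip(1) in auto)
  then show "(Psi_inv lam \<Phi> \<longlongrightarrow> 0) (at_left b)" by (simp add: Psi)
  have "((\<lambda>y. exp (- F (- y))) \<longlongrightarrow> 0) (at_left (- a))"
  proof (rule exp_minus_vanishes_at_left[where m = "- m" and \<kappa> = "lam 1 / Lip" and K = "lam 0 / (c 0 - u m)" and f = "\<lambda>y. - f (- y)"])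
    fix y assume y: "- m \<le> y" "y < - a"
    then have yi: "- y \<in> {a<..<b}" using m by auto
    show "((\<lambda>y. F (- y)) has_real_derivative - f (- y)) (at y)"
      using DERIV_chain2[OF F[OF yi] DERIV_minus[OF DERIV_ident]] by simp
    have "u (- y) - c 1 \<le> Lip * (- y - a)"
      using u_lipschitz[of "- y" a] yi u_a u_between[of "- y"] by auto
    then have "1 / (Lip * (- y - a)) \<le> 1 / (u (- y) - c 1)"
      using u_strict[OF yi] by (intro divide_left_mono) auto
    then have "lam 1 * (1 / (Lip * (- y - a))) \<le> lam 1 * (1 / (u (- y) - c 1))"
      using lam_pos by (intro mult_left_mono) auto
    moreover have "1 / (c 0 - u (- y)) \<le> 1 / (c 0 - u m)"
      using u_strict[OF yi] u_strict[of m] um[of "- y" m] m y by (intro divide_left_mono) auto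
    then have "lam 0 * (1 / (c 0 - u (- y))) \<le> lam 0 * (1 / (c 0 - u m))"
      using lam_pos by (intro mult_left_mono) auto
    moreover have "1 / (c 1 - u (- y)) = - (1 / (u (- y) - c 1))"
      by (simp add: minus_divide_right)
    moreover have e: "- a - y = - y - a" by simp
    ultimately show "lam 1 / Lip / (- a - y) - lam 0 / (c 0 - u m) \<le> - f (- y)"
      unfolding f_def e by (simp del: minus_diff_commute)
  qed (use lam_pos Lip(1) m in auto)
  then show "(Psi_inv lam \<Phi> \<longlongrightarrow> 0) (at_right a)"
    by (simp add: Psi at_right_minus filterlim_filtermap)
qed

lemma cont_flux: "continuous_on S flux"
proof -
  have "isCont flux x" for x
  proof -
    consider "x \<in> {a<..<b}" | "x < a" | "b < x" | "x = a" | "x = b" by force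
    then show ?thesis
    proof cases
      case 1 then show ?thesis using flux_deriv DERIV_isCont by blast
    next
      case 2
      then have "\<forall>\<^sub>F t in nhds x. t \<in> {..<a}" by (intro eventually_nhds_in_open) auto
      then have "\<forall>\<^sub>F t in nhds x. flux t = 0" by eventually_elim (auto simp: flux_def)
      then have "isCont flux x \<longleftrightarrow> isCont (\<lambda>_. 0 :: real) x" by (rule isCont_cong)
      then show ?thesis by simp
    next
      case 3
      then have "\<forall>\<^sub>F t in nhds x. t \<in> {b<..}" by (intro eventually_nhds_in_open) auto
      then have "\<forall>\<^sub>F t in nhds x. flux t = 0" by eventually_elim (auto simp: flux_def)
      then have "isCont flux x \<longleftrightarrow> isCont (\<lambda>_. 0 :: real) x" by (rule isCont_cong)
      then show ?thesis by simp
    next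
      case 4
      have "\<forall>\<^sub>F t in at_left a. flux t = 0" 
        using eventually_at_left_real[of "a - 1" a] by (auto elim!: eventually_mono simp: flux_def)
      then have "(flux \<longlongrightarrow> 0) (at_left a)" by (rule tendsto_eventually)
      moreover have "\<forall>\<^sub>F t in at_right a. flux t = Psi_inv lam \<Phi> t"
        using eventually_at_right_real[OF ends(2)] by (auto elim!: eventually_mono simp: flux_def)
      then have "(flux \<longlongrightarrow> 0) (at_right a)"
        using Psi_inv_vanishes(2) by (rule tendsto_cong[THEN iffD2])
      ultimately show ?thesis using 4 by (simp add: isCont_def flux_outside filterlim_at_split)
    next
      case 5
      have "\<forall>\<^sub>F t in at_right b. flux t = 0" 
        using eventually_at_right_real[of b "b + 1"] by (auto elim!: eventually_mono simp: flux_def)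
      then have "(flux \<longlongrightarrow> 0) (at_right b)" by (rule tendsto_eventually)
      moreover have "\<forall>\<^sub>F t in at_left b. flux t = Psi_inv lam \<Phi> t"
        using eventually_at_left_real[OF ends(2)] by (auto elim!: eventually_mono simp: flux_def)
      then have "(flux \<longlongrightarrow> 0) (at_left b)"
        using Psi_inv_vanishes(1) by (rule tendsto_cong[THEN iffD2])
      ultimately show ?thesis using 5 by (simp add: isCont_def flux_outside filterlim_at_split)
    qed
  qed
  then show ?thesis by (simp add: continuous_at_imp_continuous_on)
qed

lemma measurable_u[measurable]: "u \<in> borel_measurable borel"
  by (intro borel_measurable_continuous_onI cont_u)

lemma measurable_flux[measurable]: "flux \<in> borel_measurable borel"
  by (intro borel_measurable_continuous_onI cont_flux)

lemma measurable_weight[measurable]: "weight i \<in> borel_measurable borel"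
  unfolding weight_def[abs_def] by measurable

text \<open>Each weight is continuous up to the endpoint at which its denominator does not vanish; on
  the other half it differs from a continuous function by a multiple of \<open>flux'\<close>, whose
  integral exists because \<open>flux\<close> is continuous. Nonnegativity makes the integral absolute.\<close>

lemma weight_integrable_on: "weight 0 integrable_on {a..b}" "weight 1 integrable_on {a..b}"
proof -
  define m where "m = (a + b) / 2"
  have m: "a < m" "m < b" using ends by (auto simp: m_def)
  have flux': "(\<lambda>x. lam 1 * weight 1 x - lam 0 * weight 0 x) integrable_on {s..t}"
    if "a \<le> s" "s \<le> t" "t \<le> b" for s t
    using fundamental_theorem_of_calculus_interior[OF that(2) cont_flux, of "\<lambda>x. lam 1 * weight 1 x - lam 0 * weight 0 x"]
      flux_deriv that by (force simp: has_real_derivative_iff_has_vector_derivative)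
  have c0: "c 0 - u x \<noteq> 0" if "x \<in> {a..m}" for x
    using strict_mono_onD[OF mono_u, of x b] that m ends u_b by auto
  have c1: "c 1 - u x \<noteq> 0" if "x \<in> {m..b}" for x
    using strict_mono_onD[OF mono_u, of a x] that m ends u_a by auto
  have w0: "weight 0 integrable_on {a..m}" unfolding weight_def[abs_def]
    using c0 by (intro integrable_continuous_real continuous_intros cont_flux cont_u) auto
  have w1: "weight 1 integrable_on {m..b}" unfolding weight_def[abs_def]
    using c1 by (intro integrable_continuous_real continuous_intros cont_flux cont_u) auto
  have "(\<lambda>x. (1 / lam 0) * (lam 1 * weight 1 x - (lam 1 * weight 1 x - lam 0 * weight 0 x))) integrable_on {m..b}"
    by (intro integrable_on_mult_right integrable_diff[OF integrable_on_mult_right[OF w1] flux']) (use m in auto)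
  then have "weight 0 integrable_on {m..b}" using lam_pos by (simp add: field_simps)
  with w0 show "weight 0 integrable_on {a..b}"
    using Henstock_Kurzweil_Integration.integrable_combine[of a m b "weight 0"] m by auto
  have "(\<lambda>x. (1 / lam 1) * (lam 0 * weight 0 x + (lam 1 * weight 1 x - lam 0 * weight 0 x))) integrable_on {a..m}"
    by (intro integrable_on_mult_right integrable_add[OF integrable_on_mult_right[OF w0] flux']) (use m in auto)
  then have "weight 1 integrable_on {a..m}" using lam_pos by (simp add: field_simps)
  with w1 show "weight 1 integrable_on {a..b}"
    using Henstock_Kurzweil_Integration.integrable_combine[of a m b "weight 1"] m by auto
qed

lemma weight_integrable: "i \<in> {0, 1} \<Longrightarrow> integrable lborel (weight i)"
proof -
  assume "i \<in> {0, 1}"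
  then have "weight i integrable_on {a..b}" using weight_integrable_on by auto
  then have "weight i absolutely_integrable_on {a..b}"
    by (rule nonnegative_absolutely_integrable_1) (rule weight_nonneg)
  moreover have "(\<lambda>x. indicat_real {a..b} x *\<^sub>R weight i x) = weight i"
  proof (rule ext)
    fix x show "indicat_real {a..b} x *\<^sub>R weight i x = weight i x"
      by (cases "x \<in> {a..b}") (auto simp: weight_outside)
  qed
  ultimately have "integrable lebesgue (weight i)" by (simp add: set_integrable_def)
  then show ?thesis by (simp add: integrable_completion)
qed

lemma weight_mult_integrable:
  assumes [measurable]: "f \<in> borel_measurable borel" and f: "\<And>x. x \<in> {a..b} \<Longrightarrow> \<bar>f x\<bar> \<le> K" and i: "i \<in> {0, 1}"
  shows "integrable lborel (\<lambda>x. f x * weight i x)"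
    and "\<bar>\<integral>x. f x * weight i x \<partial>lborel\<bar> \<le> K * (\<integral>x. weight i x \<partial>lborel)"
proof -
  have le: "\<bar>f x * weight i x\<bar> \<le> K * weight i x" for x
  proof (cases "x \<in> {a<..<b}")
    case True then show ?thesis using f[of x] weight_nonneg[of i x] by (simp add: abs_mult mult_right_mono)
  qed (simp add: weight_outside)
  have K: "integrable lborel (\<lambda>x. K * weight i x)" using weight_integrable[OF i] by simp
  show I: "integrable lborel (\<lambda>x. f x * weight i x)"
    by (rule Bochner_Integration.integrable_bound[OF K]) (use le in \<open>auto simp: order.trans[OF _ abs_ge_self]\<close>)
  have "\<bar>\<integral>x. f x * weight i x \<partial>lborel\<bar> \<le> (\<integral>x. K * weight i x \<partial>lborel)"
    by (rule order.trans[OF integral_abs_bound integral_mono]) (use I K le in auto)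
  then show "\<bar>\<integral>x. f x * weight i x \<partial>lborel\<bar> \<le> K * (\<integral>x. weight i x \<partial>lborel)" by simp
qed

lemma flux_integrable: "integrable lborel flux"
proof -
  have "flux absolutely_integrable_on {a..b}"
    by (intro nonnegative_absolutely_integrable_1 integrable_continuous_real cont_flux flux_nonneg)
  moreover have "(\<lambda>x. indicat_real {a..b} x *\<^sub>R flux x) = flux"
  proof (rule ext)
    fix x show "indicat_real {a..b} x *\<^sub>R flux x = flux x"
      by (cases "x \<in> {a..b}") (auto simp: flux_outside)
  qed
  ultimately have "integrable lebesgue flux" by (simp add: set_integrable_def)
  then show ?thesis by (simp add: integrable_completion)
qed

lemma flux_mult_integrable:
  assumes [measurable]: "f \<in> borel_measurable borel" and f: "\<And>x. x \<in> {a..b} \<Longrightarrow> \<bar>f x\<bar> \<le> K"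
  shows "integrable lborel (\<lambda>x. f x * flux x)"
    and "\<bar>\<integral>x. f x * flux x \<partial>lborel\<bar> \<le> K * (\<integral>x. flux x \<partial>lborel)"
proof -
  have le: "\<bar>f x * flux x\<bar> \<le> K * flux x" for x
  proof (cases "x \<in> {a<..<b}")
    case True then show ?thesis using f[of x] flux_nonneg[of x] by (simp add: abs_mult mult_right_mono)
  qed (simp add: flux_outside)
  have K: "integrable lborel (\<lambda>x. K * flux x)" using flux_integrable by simp
  show I: "integrable lborel (\<lambda>x. f x * flux x)"
    by (rule Bochner_Integration.integrable_bound[OF K]) (use le in \<open>auto simp: order.trans[OF _ abs_ge_self]\<close>)
  have "\<bar>\<integral>x. f x * flux x \<partial>lborel\<bar> \<le> (\<integral>x. K * flux x \<partial>lborel)"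
    by (rule order.trans[OF integral_abs_bound integral_mono]) (use I K le in auto)
  then show "\<bar>\<integral>x. f x * flux x \<partial>lborel\<bar> \<le> K * (\<integral>x. flux x \<partial>lborel)" by simp
qed

lemma integral_lborel_eq:
  fixes g :: "real \<Rightarrow> real"
  assumes "integrable lborel g" "\<And>x. x \<notin> {a..b} \<Longrightarrow> g x = 0"
  shows "(\<integral>x. g x \<partial>lborel) = integral {a..b} g"
proof -
  have *: "(\<lambda>x. indicat_real {a..b} x *\<^sub>R g x) = g"
    using assms(2) by (fastforce simp: indicator_def fun_eq_iff)
  then have "set_integrable lborel {a..b} g" using assms(1) by (simp add: set_integrable_def)
  from set_borel_integral_eq_integral(2)[OF this] show ?thesis
    by (simp only: set_lebesgue_integral_def *)
qed

text \<open>The stationary equation \<open>flux' = \<lambda>\<^sub>1 weight 1 - \<lambda>\<^sub>0 weight 0\<close> in weak form; there is no boundary term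
  because \<open>flux\<close> vanishes at both endpoints.\<close>

lemma flux_integration_by_parts:
  assumes F: "\<And>x. (F has_real_derivative F' x) (at x)" and F': "continuous_on UNIV F'"
  shows "(\<integral>x. F' x * flux x \<partial>lborel)
    = lam 0 * (\<integral>x. F x * weight 0 x \<partial>lborel) - lam 1 * (\<integral>x. F x * weight 1 x \<partial>lborel)"
proof -
  have cF: "continuous_on UNIV F" by (rule DERIV_continuous_on[OF DERIV_subset[OF F]]) auto
  note [measurable] = borel_measurable_continuous_onI[OF cF] borel_measurable_continuous_onI[OF F']
  obtain K K' where K: "\<And>x. x \<in> {a..b} \<Longrightarrow> \<bar>F x\<bar> \<le> K" "\<And>x. x \<in> {a..b} \<Longrightarrow> \<bar>F' x\<bar> \<le> K'"
  proof -
    have "bounded (F ` {a..b})" "bounded (F' ` {a..b})"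
      by (auto intro!: compact_imp_bounded compact_continuous_image continuous_on_subset[OF cF] continuous_on_subset[OF F'])
    with that show thesis unfolding bounded_iff by force
  qed
  note I = weight_mult_integrable(1)[OF _ K(1), where i = 0] weight_mult_integrable(1)[OF _ K(1), where i = 1] flux_mult_integrable(1)[OF _ K(2)]
  let ?g = "\<lambda>x. F' x * flux x + (lam 1 * (F x * weight 1 x) - lam 0 * (F x * weight 0 x))"
  have gi: "integrable lborel ?g"
    by (intro Bochner_Integration.integrable_add Bochner_Integration.integrable_diff integrable_mult_right I) auto
  have "(?g has_integral (F b * flux b - F a * flux a)) {a..b}"
  proof (rule fundamental_theorem_of_calculus_interior)
    show "continuous_on {a..b} (\<lambda>x. F x * flux x)"
      by (intro continuous_intros cont_flux continuous_on_subset[OF cF]) auto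
    fix x assume "x \<in> {a<..<b}"
    from DERIV_mult[OF F flux_deriv[OF this]]
    show "((\<lambda>x. F x * flux x) has_vector_derivative ?g x) (at x)"
      by (simp add: has_real_derivative_iff_has_vector_derivative algebra_simps)
  qed (use ends in auto)
  then have "integral {a..b} ?g = 0" by (simp add: integral_unique flux_outside)
  moreover have "(\<integral>x. ?g x \<partial>lborel) = integral {a..b} ?g"
    by (rule integral_lborel_eq[OF gi]) (auto simp: flux_outside weight_outside)
  moreover have "(\<integral>x. ?g x \<partial>lborel) = (\<integral>x. F' x * flux x \<partial>lborel)
      + (lam 1 * (\<integral>x. F x * weight 1 x \<partial>lborel) - lam 0 * (\<integral>x. F x * weight 0 x \<partial>lborel))"
    using I by simp
  ultimately show ?thesis by simp
qed

definition mass :: "nat \<Rightarrow> real" where "mass i = (\<integral>x. weight i x \<partial>lborel)"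

lemma mass_pos: "i \<in> {0, 1} \<Longrightarrow> mass i > 0"
proof -
  assume i: "i \<in> {0, 1}"
  have "mass i \<noteq> 0"
  proof
    assume "mass i = 0"
    then have "AE x in lborel. weight i x = 0"
      using integral_nonneg_eq_0_iff_AE[OF weight_integrable[OF i]] weight_nonneg by (auto simp: mass_def)
    then have "AE x in lborel. x \<notin> {a<..<b}"
    proof eventually_elim
      case (elim x)
      then show ?case using flux_pos[of x] u_strict[of x] i by (auto simp: weight_def)
    qed
    then have "emeasure lborel {a<..<b} = 0"
      by (subst (asm) AE_iff_measurable[of "{a<..<b}"]) auto
    then show False using ends by simp
  qed
  moreover have "mass i \<ge> 0" unfolding mass_def by (simp add: weight_nonneg)
  ultimately show ?thesis by simp
qed

lemma mass_balance: "lam 0 * mass 0 = lam 1 * mass 1"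
  using flux_integration_by_parts[of "\<lambda>_. 1" "\<lambda>_. 0"] by (simp add: mass_def)

end

section \<open>Invariance of the stationary functional\<close>

context stationary_branch
begin

definition stat_fun :: "(nat \<Rightarrow> real \<Rightarrow> real) \<Rightarrow> real" where
  "stat_fun f = (\<integral>x. f 0 x * weight 0 x \<partial>lborel) + (\<integral>x. f 1 x * weight 1 x \<partial>lborel)"

text \<open>By \<open>flux_integration_by_parts\<close> this is the integral of \<open>f'\<close> against \<open>flux\<close>; in this form it is
  defined for every bounded measurable \<open>f\<close> and controlled by the size of \<open>f\<close>.\<close>

definition flux_pairing :: "(real \<Rightarrow> real) \<Rightarrow> real" where
  "flux_pairing f = lam 0 * (\<integral>x. f x * weight 0 x \<partial>lborel) - lam 1 * (\<integral>x. f x * weight 1 x \<partial>lborel)"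

definition drift_const :: real where
  "drift_const = speed * (lam 0 * mass 0 + lam 1 * mass 1) + Lip * (\<integral>x. flux x \<partial>lborel)"

lemma drift_const_nonneg: "0 \<le> drift_const"
  unfolding drift_const_def using speed_pos lam_pos mass_pos[of 0] mass_pos[of 1] Lip(1)
  by (intro add_nonneg_nonneg mult_nonneg_nonneg) (auto simp: flux_nonneg)

lemma small_mono: "small h \<Longrightarrow> 0 \<le> s \<Longrightarrow> s \<le> h \<Longrightarrow> small s"
proof -
  assume *: "small h" "0 \<le> s" "s \<le> h"
  then have "s * Lip \<le> h * Lip" "s * (lam 0 + lam 1) \<le> h * (lam 0 + lam 1)"
    using Lip(1) lam_pos by (auto intro!: mult_right_mono)
  with * show ?thesis by (auto simp: small_def)
qed

text \<open>Integration by parts moves the derivative onto the flux, so that only differences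
  \<open>f (euler s i x) - f x\<close> remain; these are of order \<open>K * s\<close>, uniformly over all \<open>f\<close> with
  Lipschitz constant \<open>K\<close>, and so is the term from the factor \<open>1 - s * u' x\<close> of the chain rule.\<close>

lemma displaced_flux_pairing:
  assumes f: "\<And>x. (f has_real_derivative f' x) (at x)" and f': "continuous_on UNIV f'"
    and K: "\<And>x. x \<in> {a..b} \<Longrightarrow> \<bar>f' x\<bar> \<le> K" and s: "small s" and i: "i \<in> {0, 1}"
  shows "\<bar>(\<integral>x. f' (euler s i x) * flux x \<partial>lborel) - flux_pairing f\<bar> \<le> K * drift_const * s"
proof -
  have s0: "0 \<le> s" using s by (simp add: small_def)
  have cf: "continuous_on UNIV f" by (rule DERIV_continuous_on[OF DERIV_subset[OF f]]) auto
  have ce: "continuous_on UNIV (\<lambda>x. f (euler s i x))" "continuous_on UNIV (\<lambda>x. f' (euler s i x))"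
    by (rule continuous_on_compose2[OF cf cont_euler] continuous_on_compose2[OF f' cont_euler]; simp)+
  note [measurable] = borel_measurable_continuous_onI[OF cf] borel_measurable_continuous_onI[OF ce(1)]
    borel_measurable_continuous_onI[OF ce(2)] borel_measurable_continuous_onI[OF cont_u']
  have K0: "0 \<le> K" using K[of a] ends by auto
  define F where "F x = f (euler s i x)" for x
  define F' where "F' x = f' (euler s i x) * (1 - s * u' x)" for x
  have F: "(F has_real_derivative F' x) (at x)" for x
    unfolding F_def[abs_def] F'_def by (rule DERIV_chain2[OF f euler_deriv])
  have cF': "continuous_on UNIV F'"
    unfolding F'_def[abs_def]
    by (intro continuous_on_mult continuous_on_diff continuous_on_const ce cont_u')
  obtain K1 where K1: "\<And>x. x \<in> {a..b} \<Longrightarrow> \<bar>F' x\<bar> \<le> K1"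
    using compact_imp_bounded[OF compact_continuous_image[OF continuous_on_subset[OF cF'] compact_Icc[of a b]]]
    unfolding bounded_iff by force
  obtain Kf where Kf: "\<And>x. x \<in> {a..b} \<Longrightarrow> \<bar>f x\<bar> \<le> Kf"
    using compact_imp_bounded[OF compact_continuous_image[OF continuous_on_subset[OF cf] compact_Icc[of a b]]]
    unfolding bounded_iff by force
  have KF: "\<bar>F x\<bar> \<le> Kf" if "x \<in> {a..b}" for x
    unfolding F_def using Kf euler_in[OF s i that] by auto
  have [measurable]: "F' \<in> borel_measurable borel" by (rule borel_measurable_continuous_onI[OF cF'])
  have [measurable]: "F \<in> borel_measurable borel" unfolding F_def[abs_def] by measurable
  have b2: "\<bar>f' (euler s i x) * u' x\<bar> \<le> K * Lip" if "x \<in> {a..b}" for x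
    unfolding abs_mult using K[OF euler_in[OF s i that]] Lip(2)[OF that] K0 by (intro mult_mono) auto
  have "(\<integral>x. f' (euler s i x) * flux x \<partial>lborel) = (\<integral>x. F' x * flux x + s * (f' (euler s i x) * u' x * flux x) \<partial>lborel)"
    by (rule Bochner_Integration.integral_cong) (auto simp: F'_def algebra_simps)
  also have "\<dots> = (\<integral>x. F' x * flux x \<partial>lborel) + s * (\<integral>x. f' (euler s i x) * u' x * flux x \<partial>lborel)"
    using flux_mult_integrable(1)[OF _ K1] flux_mult_integrable(1)[OF _ b2] by simp
  also have "(\<integral>x. F' x * flux x \<partial>lborel) = flux_pairing F"
    unfolding flux_pairing_def by (rule flux_integration_by_parts[OF F cF'])
  finally have eq: "(\<integral>x. f' (euler s i x) * flux x \<partial>lborel) - flux_pairing f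
      = (flux_pairing F - flux_pairing f) + s * (\<integral>x. f' (euler s i x) * u' x * flux x \<partial>lborel)" by simp
  have d: "\<bar>F x - f x\<bar> \<le> K * (s * speed)" if "x \<in> {a..b}" for x
  proof -
    have "\<bar>F x - f x\<bar> \<le> K * \<bar>euler s i x - x\<bar>"
      unfolding F_def by (rule lipschitz_by_derivative[OF f K euler_in[OF s i that] that])
    also have "\<dots> \<le> K * (s * speed)"
      using euler_near[OF s0 that i] K0 by (intro mult_left_mono) auto
    finally show ?thesis .
  qed
  have part: "\<bar>(\<integral>x. F x * weight j x \<partial>lborel) - (\<integral>x. f x * weight j x \<partial>lborel)\<bar> \<le> K * (s * speed) * mass j"
    if j: "j \<in> {0, 1}" for j
  proof -
    have "(\<integral>x. F x * weight j x \<partial>lborel) - (\<integral>x. f x * weight j x \<partial>lborel) = (\<integral>x. (F x - f x) * weight j x \<partial>lborel)"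
      using weight_mult_integrable(1)[OF _ KF j] weight_mult_integrable(1)[OF _ Kf j]
      by (simp add: left_diff_distrib)
    then show ?thesis using weight_mult_integrable(2)[OF _ d j] by (simp add: mass_def)
  qed
  have "\<bar>flux_pairing F - flux_pairing f\<bar>
      \<le> lam 0 * \<bar>(\<integral>x. F x * weight 0 x \<partial>lborel) - (\<integral>x. f x * weight 0 x \<partial>lborel)\<bar>
        + lam 1 * \<bar>(\<integral>x. F x * weight 1 x \<partial>lborel) - (\<integral>x. f x * weight 1 x \<partial>lborel)\<bar>"
  proof -
    have tri: "\<bar>(p * A - q * B) - (p * C - q * D)\<bar> \<le> p * \<bar>A - C\<bar> + q * \<bar>B - D\<bar>"
      if "0 < p" "0 < q" for p q A B C D :: real
    proof -
      have "(p * A - q * B) - (p * C - q * D) = p * (A - C) - q * (B - D)" by (simp add: algebra_simps)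
      also have "\<bar>\<dots>\<bar> \<le> \<bar>p * (A - C)\<bar> + \<bar>q * (B - D)\<bar>" by (rule abs_triangle_ineq4)
      finally show ?thesis using that by (simp add: abs_mult)
    qed
    show ?thesis unfolding flux_pairing_def by (rule tri) (use lam_pos in auto)
  qed
  also have "\<dots> \<le> lam 0 * (K * (s * speed) * mass 0) + lam 1 * (K * (s * speed) * mass 1)"
    using part[of 0] part[of 1] lam_pos by (intro add_mono mult_left_mono) auto
  finally have 1: "\<bar>flux_pairing F - flux_pairing f\<bar> \<le> K * s * (speed * (lam 0 * mass 0 + lam 1 * mass 1))"
    by (simp add: algebra_simps)
  have "\<bar>\<integral>x. f' (euler s i x) * u' x * flux x \<partial>lborel\<bar> \<le> K * Lip * (\<integral>x. flux x \<partial>lborel)"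
    by (rule flux_mult_integrable(2)[OF _ b2]) auto
  then have 2: "\<bar>s * (\<integral>x. f' (euler s i x) * u' x * flux x \<partial>lborel)\<bar> \<le> s * (K * Lip * (\<integral>x. flux x \<partial>lborel))"
    using s0 by (simp add: abs_mult mult_left_mono)
  show ?thesis unfolding eq
    using order.trans[OF abs_triangle_ineq add_mono[OF 1 2]]
    by (simp add: drift_const_def algebra_simps)
qed

text \<open>As \<open>c i - u\<close> times \<open>weight i\<close> is \<open>\<plusminus> flux\<close>, the integrand is \<open>\<plusminus> flux x\<close> times the integral of
  \<open>f' (euler s i x)\<close> over \<open>s \<in> {0..h}\<close>. Interchanging the integrals reduces the claim to
  \<open>displaced_flux_pairing\<close>. The sign \<open>\<sigma>\<close> is the direction of motion in state \<open>i\<close>.\<close>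

lemma drift_increment:
  assumes f: "\<And>x. (f has_real_derivative f' x) (at x)" and f': "continuous_on UNIV f'"
    and K: "\<And>x. x \<in> {a..b} \<Longrightarrow> \<bar>f' x\<bar> \<le> K" and h: "small h" and i: "i \<in> {0, 1}"
  defines "\<sigma> \<equiv> (if i = 0 then 1 else - 1 :: real)"
  shows "\<bar>(\<integral>x. (f (euler h i x) - f x) * weight i x \<partial>lborel) - \<sigma> * h * flux_pairing f\<bar>
    \<le> K * drift_const * h\<^sup>2"
proof -
  have h0: "0 \<le> h" using h by (simp add: small_def)
  have cf: "continuous_on UNIV f" by (rule DERIV_continuous_on[OF DERIV_subset[OF f]]) auto
  have ce: "continuous_on UNIV (\<lambda>x. f (euler h i x))"
    by (rule continuous_on_compose2[OF cf cont_euler]; simp)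
  note [measurable] = borel_measurable_continuous_onI[OF cf] borel_measurable_continuous_onI[OF ce]
  have K0: "0 \<le> K" using K[of a] ends by auto
  have d: "\<bar>f (euler h i x) - f x\<bar> \<le> K * (h * speed)" if "x \<in> {a..b}" for x
  proof -
    have "\<bar>f (euler h i x) - f x\<bar> \<le> K * \<bar>euler h i x - x\<bar>"
      by (rule lipschitz_by_derivative[OF f K euler_in[OF h i that] that])
    also have "\<dots> \<le> K * (h * speed)"
      using euler_near[OF h0 that i] K0 by (intro mult_left_mono) auto
    finally show ?thesis .
  qed
  define k where "k x s = f' (euler s i x) * flux x" for x s
  have sw: "(c i - u x) * weight i x = \<sigma> * flux x" for x
    using drift_weight[of x] i by (auto simp: \<sigma>_def)
  have inner: "(f (euler h i x) - f x) * weight i x = \<sigma> * integral {0..h} (k x)" for x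
  proof -
    have "((\<lambda>s. f' (euler s i x) * (c i - u x)) has_integral (f (euler h i x) - f (euler 0 i x))) {0..h}"
    proof (rule fundamental_theorem_of_calculus[OF h0])
      fix s
      have "((\<lambda>s. euler s i x) has_real_derivative (c i - u x)) (at s within {0..h})"
        unfolding euler_def by (auto intro!: derivative_eq_intros)
      from DERIV_chain2[OF f this]
      show "((\<lambda>s. f (euler s i x)) has_vector_derivative f' (euler s i x) * (c i - u x)) (at s within {0..h})"
        by (simp add: has_real_derivative_iff_has_vector_derivative)
    qed
    from has_integral_mult_left[OF this, of "weight i x"]
    have "((\<lambda>s. f' (euler s i x) * (\<sigma> * flux x)) has_integral (f (euler h i x) - f x) * weight i x) {0..h}"
      by (simp add: mult.assoc sw euler_def)
    from integral_unique[OF this] have "(f (euler h i x) - f x) * weight i x = integral {0..h} (\<lambda>s. \<sigma> * k x s)"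
      by (simp add: k_def mult.left_commute)
    then show ?thesis by simp
  qed
  have ck0: "continuous_on UNIV (\<lambda>p. k (fst p) (snd p))"
  proof -
    have "continuous_on UNIV (\<lambda>p :: real \<times> real. fst p + snd p * (c i - u (fst p)))"
      by (intro continuous_intros continuous_on_compose2[OF cont_u[of UNIV] continuous_on_fst]) auto
    then have "continuous_on UNIV (\<lambda>p :: real \<times> real. f' (fst p + snd p * (c i - u (fst p))) * flux (fst p))"
      by (intro continuous_on_mult continuous_on_compose2[OF f'] continuous_on_compose2[OF cont_flux[of UNIV] continuous_on_fst[OF continuous_on_id]]) auto
    then show ?thesis by (simp add: k_def euler_def)
  qed
  have ck: "continuous_on (cbox (a, 0) (b, h)) (\<lambda>(x, s). k x s)"
    unfolding case_prod_beta by (rule continuous_on_subset[OF ck0]) auto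
  have int0: "integrable lborel (\<lambda>x. (f (euler h i x) - f x) * weight i x)"
    by (rule weight_mult_integrable(1)[OF _ d i]) auto
  have "(\<integral>x. (f (euler h i x) - f x) * weight i x \<partial>lborel) = integral {a..b} (\<lambda>x. (f (euler h i x) - f x) * weight i x)"
    by (rule integral_lborel_eq[OF int0]) (auto simp: weight_outside)
  also have "\<dots> = \<sigma> * integral {a..b} (\<lambda>x. integral {0..h} (k x))" by (simp add: inner)
  also have "integral {a..b} (\<lambda>x. integral {0..h} (k x)) = integral {0..h} (\<lambda>s. integral {a..b} (\<lambda>x. k x s))"
    using integral_swap_continuous[OF ck] by simp
  finally have eq: "(\<integral>x. (f (euler h i x) - f x) * weight i x \<partial>lborel) = \<sigma> * integral {0..h} (\<lambda>s. integral {a..b} (\<lambda>x. k x s))" .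
  have pt: "\<bar>integral {a..b} (\<lambda>x. k x s) - flux_pairing f\<bar> \<le> K * drift_const * h" if s: "s \<in> {0..h}" for s
  proof -
    have ss: "small s" using small_mono[OF h] s by auto
    have [measurable]: "(\<lambda>x. f' (euler s i x)) \<in> borel_measurable borel"
      by (rule borel_measurable_continuous_onI[OF continuous_on_compose2[OF f' cont_euler]]) auto
    have "integrable lborel (\<lambda>x. k x s)"
      unfolding k_def by (rule flux_mult_integrable(1)[OF _ K]) (use euler_in[OF ss i] in auto)
    then have "integral {a..b} (\<lambda>x. k x s) = (\<integral>x. k x s \<partial>lborel)"
      by (rule integral_lborel_eq[symmetric]) (auto simp: k_def flux_outside)
    then have "\<bar>integral {a..b} (\<lambda>x. k x s) - flux_pairing f\<bar> \<le> K * drift_const * s"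
      using displaced_flux_pairing[OF f f' K ss i] by (simp add: k_def)
    also have "\<dots> \<le> K * drift_const * h" using s K0 drift_const_nonneg by (intro mult_left_mono) auto
    finally show ?thesis .
  qed
  have cont: "continuous_on {0..h} (\<lambda>s. integral {a..b} (\<lambda>x. k x s))"
  proof -
    have "continuous_on UNIV (\<lambda>p. k (snd p) (fst p))"
      using continuous_on_compose2[OF ck0, of UNIV "\<lambda>p. (snd p, fst p)"]
      by (simp add: continuous_on_Pair continuous_on_fst continuous_on_snd)
    then have "continuous_on ({0..h} \<times> cbox a b) (\<lambda>(s, x). k x s)"
      unfolding case_prod_beta by (rule continuous_on_subset) auto
    from integral_continuous_on_param[OF this] show ?thesis by simp
  qed
  have "((\<lambda>s. integral {a..b} (\<lambda>x. k x s) - flux_pairing f) has_integral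
      (integral {0..h} (\<lambda>s. integral {a..b} (\<lambda>x. k x s)) - h * flux_pairing f)) {0..h}"
    using has_integral_diff[OF integrable_integral[OF integrable_continuous_real[OF cont]] has_integral_const_real[of "flux_pairing f" 0 h]] h0
    by simp
  then have "norm (integral {0..h} (\<lambda>s. integral {a..b} (\<lambda>x. k x s)) - h * flux_pairing f) \<le> K * drift_const * h * measure lborel (cbox 0 h)"
    using pt K0 drift_const_nonneg h0 by (intro has_integral_bound) auto
  \<comment> \<open>The length \<open>h\<close> of the interval supplies the second factor \<open>h\<close>.\<close>
  then have "\<bar>integral {0..h} (\<lambda>s. integral {a..b} (\<lambda>x. k x s)) - h * flux_pairing f\<bar> \<le> K * drift_const * h\<^sup>2"
    using h0 by (simp add: power2_eq_square mult.assoc)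
  moreover have "\<bar>\<sigma>\<bar> = 1" by (simp add: \<sigma>_def)
  moreover have "\<bar>\<sigma> * A - \<sigma> * h * B\<bar> = \<bar>\<sigma>\<bar> * \<bar>A - h * B\<bar>" for A B :: real
    by (simp add: abs_mult[symmetric] algebra_simps)
  ultimately show ?thesis unfolding eq by simp
qed

definition defect_const :: real where
  "defect_const = 2 * drift_const + 2 * speed * (lam 0 * mass 0 + lam 1 * mass 1)"

text \<open>The terms of first order in \<open>h\<close> are drift \<open>flux_pairing (f 0) - flux_pairing (f 1)\<close> and
  switching \<open>lam 0 * J0 0 + lam 1 * J0 1\<close>; they cancel, which is the stationarity of the weights.\<close>

lemma stat_fun_step:
  assumes h: "small h" and f: "C1_lipschitz K f"
  shows "\<bar>stat_fun (step h f) - stat_fun f\<bar> \<le> K * defect_const * h\<^sup>2"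
proof -
  obtain f' where f': "\<And>i x. i \<in> {0, 1} \<Longrightarrow> (f i has_real_derivative f' i x) (at x)"
    "\<And>i. i \<in> {0, 1} \<Longrightarrow> continuous_on UNIV (f' i)"
    "\<And>i x. i \<in> {0, 1} \<Longrightarrow> x \<in> {a..b} \<Longrightarrow> \<bar>f' i x\<bar> \<le> K"
    using f unfolding C1_lipschitz_def by blast
  have h0: "0 \<le> h" using h by (simp add: small_def)
  have K0: "0 \<le> K" using f'(3)[of 0 a] ends by auto
  have cf: "continuous_on UNIV (f i)" if "i \<in> {0, 1}" for i
    by (rule DERIV_continuous_on[OF DERIV_subset[OF f'(1)[OF that]]]) auto
  have ce: "continuous_on UNIV (\<lambda>x. f j (euler h i x))" if "j \<in> {0, 1}" for i j
    by (rule continuous_on_compose2[OF cf[OF that] cont_euler]; simp)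
  have mf: "f j \<in> borel_measurable borel" "(\<lambda>x. f j (euler h i x)) \<in> borel_measurable borel"
    if "j \<in> {0, 1}" for i j
    using borel_measurable_continuous_onI[OF cf[OF that]] borel_measurable_continuous_onI[OF ce[OF that]] by auto
  obtain F0 F1 where "\<And>x. x \<in> {a..b} \<Longrightarrow> \<bar>f 0 x\<bar> \<le> F0" "\<And>x. x \<in> {a..b} \<Longrightarrow> \<bar>f 1 x\<bar> \<le> F1"
  proof -
    have "bounded (f 0 ` {a..b})" "bounded (f 1 ` {a..b})"
      by (auto intro!: compact_imp_bounded compact_continuous_image continuous_on_subset[OF cf])
    with that show thesis unfolding bounded_iff by force
  qed
  then have Fb: "\<bar>f i x\<bar> \<le> max F0 F1" if "i \<in> {0, 1}" "x \<in> {a..b}" for i x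
    using that by (auto simp: le_max_iff_disj)
  define F where "F = max F0 F1"
  have Fe: "\<bar>f j (euler h i x)\<bar> \<le> F" if "i \<in> {0, 1}" "j \<in> {0, 1}" "x \<in> {a..b}" for i j x
    unfolding F_def by (rule Fb[OF that(2) euler_in[OF h that(1,3)]])
  define D where "D i = (\<integral>x. (f i (euler h i x) - f i x) * weight i x \<partial>lborel)" for i
  define J where "J i = (\<integral>x. (f (1 - i) (euler h i x) - f i (euler h i x)) * weight i x \<partial>lborel)" for i
  define J0 where "J0 i = (\<integral>x. (f (1 - i) x - f i x) * weight i x \<partial>lborel)" for i
  define A where "A j i = (\<integral>x. f j x * weight i x \<partial>lborel)" for i j
  have int: "integrable lborel (\<lambda>x. f j x * weight i x)" "integrable lborel (\<lambda>x. f j (euler h i x) * weight i x)"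
    if "i \<in> {0, 1}" "j \<in> {0, 1}" for i j
    using weight_mult_integrable(1)[OF mf(1)[OF that(2)] Fb[OF that(2)] that(1)]
      weight_mult_integrable(1)[OF mf(2)[OF that(2)] Fe[OF that] that(1)] by auto
  have dec: "(\<integral>x. step h f i x * weight i x \<partial>lborel) - A i i = D i + lam i * h * J i" if i: "i \<in> {0, 1}" for i
  proof -
    have j: "1 - i \<in> {0, 1}" by auto
    have "(\<integral>x. step h f i x * weight i x \<partial>lborel) = (\<integral>x. f i (euler h i x) * weight i x
       + lam i * h * (f (1 - i) (euler h i x) * weight i x - f i (euler h i x) * weight i x) \<partial>lborel)"
      by (rule Bochner_Integration.integral_cong) (auto simp: step_def algebra_simps)
    then show ?thesis
      unfolding D_def J_def A_def left_diff_distrib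
      using int[OF i i] int[OF i j] by simp
  qed
  have Jdiff: "\<bar>J i - J0 i\<bar> \<le> 2 * K * (h * speed) * mass i" if i: "i \<in> {0, 1}" for i
  proof -
    have j: "1 - i \<in> {0, 1}" by auto
    have Jeq: "J i - J0 i = (\<integral>x. ((f (1 - i) (euler h i x) - f (1 - i) x) - (f i (euler h i x) - f i x)) * weight i x \<partial>lborel)"
      unfolding J_def J0_def left_diff_distrib using int[OF i i] int[OF i j] by simp
    have le: "\<bar>(f (1 - i) (euler h i x) - f (1 - i) x) - (f i (euler h i x) - f i x)\<bar> \<le> 2 * K * (h * speed)"
      if x: "x \<in> {a..b}" for x
    proof -
      have "\<bar>f k (euler h i x) - f k x\<bar> \<le> K * (h * speed)" if k: "k \<in> {0, 1}" for k
      proof -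
        have "\<bar>f k (euler h i x) - f k x\<bar> \<le> K * \<bar>euler h i x - x\<bar>"
          by (rule lipschitz_by_derivative[OF f'(1)[OF k] f'(3)[OF k] euler_in[OF h i x] x])
        also have "\<dots> \<le> K * (h * speed)"
          using euler_near[OF h0 x i] K0 by (intro mult_left_mono) auto
        finally show ?thesis .
      qed
      from this[OF i] this[OF j] show ?thesis by linarith
    qed
    show ?thesis unfolding Jeq mass_def
      by (rule weight_mult_integrable(2)[OF _ le i]) (intro borel_measurable_diff mf i j)
  qed
  have D: "\<bar>D 0 - h * flux_pairing (f 0)\<bar> \<le> K * drift_const * h\<^sup>2" "\<bar>D 1 + h * flux_pairing (f 1)\<bar> \<le> K * drift_const * h\<^sup>2"
    using drift_increment[OF f'(1) f'(2) f'(3) h, of 0 0] drift_increment[OF f'(1) f'(2) f'(3) h, of 1 1]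
    by (simp_all add: D_def)
  have J0: "J0 0 = A 1 0 - A 0 0" "J0 1 = A 0 1 - A 1 1"
    using int by (simp_all add: J0_def A_def left_diff_distrib)
  have cancel: "flux_pairing (f 0) - flux_pairing (f 1) + lam 0 * J0 0 + lam 1 * J0 1 = 0"
    unfolding J0 flux_pairing_def A_def by (simp add: algebra_simps)
  have "stat_fun (step h f) - stat_fun f = (D 0 + lam 0 * h * J 0) + (D 1 + lam 1 * h * J 1)"
    using dec[of 0] dec[of 1] unfolding stat_fun_def A_def by simp
  also have "\<dots> = (D 0 - h * flux_pairing (f 0)) + (D 1 + h * flux_pairing (f 1))
      + lam 0 * h * (J 0 - J0 0) + lam 1 * h * (J 1 - J0 1)
      + h * (flux_pairing (f 0) - flux_pairing (f 1) + lam 0 * J0 0 + lam 1 * J0 1)"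
    by (simp add: algebra_simps)
  also have "\<dots> = (D 0 - h * flux_pairing (f 0)) + (D 1 + h * flux_pairing (f 1))
      + lam 0 * h * (J 0 - J0 0) + lam 1 * h * (J 1 - J0 1)"
    unfolding cancel by simp
  finally have "\<bar>stat_fun (step h f) - stat_fun f\<bar> \<le> \<bar>D 0 - h * flux_pairing (f 0)\<bar> + \<bar>D 1 + h * flux_pairing (f 1)\<bar>
      + \<bar>lam 0 * h * (J 0 - J0 0)\<bar> + \<bar>lam 1 * h * (J 1 - J0 1)\<bar>" by linarith
  also have "\<dots> \<le> K * drift_const * h\<^sup>2 + K * drift_const * h\<^sup>2
      + lam 0 * h * (2 * K * (h * speed) * mass 0) + lam 1 * h * (2 * K * (h * speed) * mass 1)"
    using D Jdiff[of 0] Jdiff[of 1] lam_pos h0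
    by (intro add_mono) (auto simp: abs_mult intro!: mult_left_mono)
  also have "\<dots> = K * defect_const * h\<^sup>2"
    by (simp add: defect_const_def algebra_simps power2_eq_square)
  finally show ?thesis .
qed

text \<open>One step changes the stationary functional by \<open>O(h\<^sup>2)\<close> only, so \<open>n\<close> steps of length
  \<open>T/n\<close> change it by \<open>O(1/n)\<close>.\<close>

lemma stat_fun_invariant:
  assumes T: "T \<ge> 0" and g: "C1_lipschitz K g" and F: "\<And>i x. i \<in> {0, 1} \<Longrightarrow> x \<in> {a..b} \<Longrightarrow> \<bar>g i x\<bar> \<le> F"
    and P: "\<And>i x. i \<in> {0, 1} \<Longrightarrow> x \<in> {a<..<b} \<Longrightarrow> (\<lambda>n. (step (T / real n) ^^ n) g i x) \<longlonglongrightarrow> P i x"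
  shows "stat_fun P = stat_fun g"
proof -
  obtain g' where g': "\<And>i x. i \<in> {0, 1} \<Longrightarrow> (g i has_real_derivative g' i x) (at x)"
    "\<And>i x. i \<in> {0, 1} \<Longrightarrow> x \<in> {a..b} \<Longrightarrow> \<bar>g' i x\<bar> \<le> K"
    using g unfolding C1_lipschitz_def by blast
  have K0: "0 \<le> K" using g'(2)[of 0 a] ends by auto
  have defect0: "0 \<le> defect_const"
    unfolding defect_const_def using drift_const_nonneg speed_pos lam_pos mass_pos[of 0] mass_pos[of 1]
    by (intro add_nonneg_nonneg mult_nonneg_nonneg) auto
  have it: "\<bar>stat_fun ((step h ^^ n) g) - stat_fun g\<bar> \<le> real n * (exp (real n * h * Lip) * K * defect_const * h\<^sup>2)"
    if h: "small h" for n h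
  proof -
    have h0: "0 \<le> h" using h by (simp add: small_def)
    have "\<bar>stat_fun ((step h ^^ k) g) - stat_fun g\<bar> \<le> real k * (exp (real n * h * Lip) * K * defect_const * h\<^sup>2)"
      if "k \<le> n" for k
      using that
    proof (induction k)
      case (Suc k)
      have "(1 + h * Lip) ^ k \<le> (1 + h * Lip) ^ n"
        using Suc.prems h0 Lip(1) by (intro power_increasing) auto
      then have "(1 + h * Lip) ^ k * K \<le> exp (real n * h * Lip) * K"
        using growth_bound[OF h0, of n] K0 by (intro mult_right_mono) auto
      then have "C1_lipschitz (exp (real n * h * Lip) * K) ((step h ^^ k) g)"
        by (rule C1_lipschitz_mono[OF iterate_C1_lipschitz[OF h g]])
      from stat_fun_step[OF h this]
      have "\<bar>stat_fun ((step h ^^ Suc k) g) - stat_fun ((step h ^^ k) g)\<bar> \<le> exp (real n * h * Lip) * K * defect_const * h\<^sup>2"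
        by simp
      moreover have "real (Suc k) * B = real k * B + B" for B by (simp add: algebra_simps)
      ultimately show ?case using Suc by (smt (verit) Suc_leD)
    qed simp
    then show ?thesis by blast
  qed
  have "(\<lambda>n. T * (exp (T * Lip) * K * defect_const) * (T / real n)) \<longlonglongrightarrow> T * (exp (T * Lip) * K * defect_const) * 0"
    by (intro tendsto_mult tendsto_const lim_const_over_n)
  then have err: "(\<lambda>n. T * (exp (T * Lip) * K * defect_const) * (T / real n)) \<longlonglongrightarrow> 0" by simp
  have "\<forall>\<^sub>F n in sequentially. norm (stat_fun ((step (T / real n) ^^ n) g) - stat_fun g)
      \<le> T * (exp (T * Lip) * K * defect_const) * (T / real n)"
    using small_eventually[OF T] eventually_gt_at_top[of 0]
  proof eventually_elim
    case (elim n)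
    have "real n * (exp (real n * (T / real n) * Lip) * K * defect_const * (T / real n)\<^sup>2)
        = T * (exp (T * Lip) * K * defect_const) * (T / real n)"
      using elim(2) by (simp add: power2_eq_square field_simps)
    then show ?case using it[OF elim(1), of n] by simp
  qed
  then have "(\<lambda>n. stat_fun ((step (T / real n) ^^ n) g) - stat_fun g) \<longlonglongrightarrow> 0"
    by (rule Lim_null_comparison[OF _ err])
  then have lim1: "(\<lambda>n. stat_fun ((step (T / real n) ^^ n) g)) \<longlonglongrightarrow> stat_fun g"
    by (simp add: LIM_zero_iff)
  have cg: "continuous_on UNIV (g i)" if "i \<in> {0, 1}" for i
    by (rule DERIV_continuous_on[OF DERIV_subset[OF g'(1)[OF that]]]) auto
  obtain N where N: "\<And>n. n \<ge> N \<Longrightarrow> small (T / real n)"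
    using small_eventually[OF T] unfolding eventually_sequentially by blast
  have comp: "(\<lambda>n. \<integral>x. (step (T / real (n + N)) ^^ (n + N)) g i x * weight i x \<partial>lborel)
      \<longlonglongrightarrow> (\<integral>x. P i x * weight i x \<partial>lborel)" if i: "i \<in> {0, 1}" for i
  proof -
    let ?s = "\<lambda>n x. (step (T / real (n + N)) ^^ (n + N)) g i x * weight i x"
    have meas: "?s n \<in> borel_measurable lborel" for n
      using borel_measurable_continuous_onI[OF iterate_continuous[of g i]] cg i by simp
    have lim: "(\<lambda>n. ?s n x) \<longlonglongrightarrow> P i x * weight i x" for x
    proof (cases "x \<in> {a<..<b}")
      case True
      show ?thesis by (intro tendsto_mult tendsto_const LIMSEQ_ignore_initial_segment[OF P[OF i True]])
    qed (simp add: weight_outside)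
    show ?thesis
    proof (rule integral_dominated_convergence[where w = "\<lambda>x. F * weight i x"])
      show "AE x in lborel. norm (?s n x) \<le> F * weight i x" for n
      proof (rule AE_I2)
        fix x show "norm (?s n x) \<le> F * weight i x"
        proof (cases "x \<in> {a<..<b}")
          case True
          then have "\<bar>(step (T / real (n + N)) ^^ (n + N)) g i x\<bar> \<le> F"
            using i by (intro iterate_bound[OF N F]) auto
          then show ?thesis using weight_nonneg[of i x] by (simp add: abs_mult mult_right_mono)
        qed (simp add: weight_outside)
      qed
      show "(\<lambda>x. P i x * weight i x) \<in> borel_measurable lborel"
        by (rule borel_measurable_LIMSEQ_real[OF lim meas])
    qed (use lim meas weight_integrable[OF i] in auto)
  qed
  have "(\<lambda>n. stat_fun ((step (T / real (n + N)) ^^ (n + N)) g)) \<longlonglongrightarrow> stat_fun P"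
    unfolding stat_fun_def by (intro tendsto_add comp) auto
  moreover have "(\<lambda>n. stat_fun ((step (T / real (n + N)) ^^ (n + N)) g)) \<longlonglongrightarrow> stat_fun g"
    by (rule LIMSEQ_ignore_initial_segment[OF lim1])
  ultimately show ?thesis by (rule LIMSEQ_unique)
qed

end

section \<open>Measures on the state space\<close>

lemma space_state_space: "space state_space = UNIV \<times> {0, 1}"
  by (simp add: space_pair_measure)

lemma state_measurable:
  assumes "\<And>i. i \<in> {0, 1} \<Longrightarrow> g i \<in> borel_measurable borel"
  shows "(\<lambda>z. g (snd z) (fst z)) \<in> borel_measurable state_space"
proof -
  have [measurable]: "g 0 \<in> borel_measurable borel" "g 1 \<in> borel_measurable borel" using assms by auto
  have s: "snd \<in> measurable state_space (count_space UNIV)"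
    by (rule measurable_compose[OF measurable_snd]) simp
  note [measurable] = s
  have m1: "(\<lambda>z. if snd z = 0 then g 0 (fst z) else g 1 (fst z)) \<in> borel_measurable state_space"
    by measurable
  have eq1: "(if snd z = 0 then g 0 (fst z) else g 1 (fst z)) = g (snd z) (fst z)"
    if "z \<in> space state_space" for z
    using that unfolding space_state_space by auto
  show ?thesis by (rule measurable_cong[THEN iffD1, OF eq1 m1])
qed

text \<open>A generator of the state space that is closed under intersection and whose indicators are limits
  of test functions.\<close>

definition rays :: "(real \<times> nat) set set" where
  "rays = {A \<times> B | A B. A \<in> range greaterThan \<and> B \<in> Pow {0, 1}}"

lemma sets_state_space: "sets state_space = sigma_sets (UNIV \<times> {0, 1}) rays"
proof -
  have "sets state_space = sets (sigma (space (borel :: real measure) \<times> space (count_space {0, 1 :: nat})) rays)"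
    unfolding rays_def
  proof (rule sets_pair_eq[where Ca = "range (\<lambda>n. {- real n<..})" and Cb = "{{0, 1}}"])
    show "sets borel = sigma_sets (space borel) (range greaterThan :: real set set)"
      unfolding borel_Ioi by (simp add: sets_measure_of)
    have "\<exists>n. - real n < x" for x :: real
      using reals_Archimedean2[of "- x"] by (auto simp: minus_less_iff)
    then show "\<Union> (range (\<lambda>n. {- real n<..})) = space borel" by auto
    show "sets (count_space {0, 1}) = sigma_sets (space (count_space {0, 1})) (Pow {0, 1 :: nat})"
      using sets.sigma_sets_eq[of "count_space {0, 1 :: nat}"] by simp
  qed auto
  then show ?thesis by (subst (asm) sets_measure_of) (auto simp: rays_def)
qed

lemma Int_stable_rays: "Int_stable rays"
  unfolding Int_stable_def
proof (intro ballI)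
  fix X Y assume "X \<in> rays" "Y \<in> rays"
  then obtain p q B D where XY: "X = {p<..} \<times> B" "Y = {q<..} \<times> D" "B \<subseteq> {0, 1}" "D \<subseteq> {0, 1}"
    unfolding rays_def by auto
  then have "X \<inter> Y = {max p q<..} \<times> (B \<inter> D)" by auto
  moreover have "B \<inter> D \<in> Pow {0, 1}" using XY by auto
  ultimately show "X \<inter> Y \<in> rays" unfolding rays_def by blast
qed

text \<open>Rich enough to determine a measure, and smooth enough for the generator to act on them.\<close>

definition test_function :: "(nat \<Rightarrow> real \<Rightarrow> real) \<Rightarrow> bool" where
  "test_function f \<longleftrightarrow> (\<exists>f' F. \<forall>i\<in>{0, 1}. (\<forall>x. (f i has_real_derivative f' i x) (at x)) \<and>
     continuous_on UNIV (f' i) \<and> (\<forall>x. \<bar>f i x\<bar> \<le> F))"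

lemma test_function_D:
  assumes "test_function f" "i \<in> {0, 1}"
  shows "continuous_on UNIV (f i)" "f i \<in> borel_measurable borel"
proof -
  obtain f' where "\<And>x. (f i has_real_derivative f' x) (at x)"
    using assms unfolding test_function_def by blast
  then show "continuous_on UNIV (f i)"
    by (intro DERIV_continuous_on[OF DERIV_subset]) auto
  then show "f i \<in> borel_measurable borel" by (rule borel_measurable_continuous_onI)
qed

lemma test_function_bounded:
  assumes "test_function f" obtains F where "\<And>i x. i \<in> {0, 1} \<Longrightarrow> \<bar>f i x\<bar> \<le> F"
  using assms unfolding test_function_def by blast

lemma has_derivative_square_pos_part: "((\<lambda>x::real. (max 0 x)\<^sup>2) has_real_derivative 2 * max 0 x) (at x)"
proof (cases x "0::real" rule: linorder_cases)
  case less
  have "((\<lambda>_. 0) has_real_derivative 0) (at x)" by simp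
  then have "((\<lambda>x. (max 0 x)\<^sup>2) has_real_derivative 0) (at x)"
    by (rule has_field_derivative_transform_within_open[of _ _ _ "{..<0}"]) (use less in auto)
  with less show ?thesis by simp
next
  case equal
  have "(\<lambda>h::real. (max 0 h)\<^sup>2 / h) = (\<lambda>h. max 0 h)"
    by (auto simp: fun_eq_iff max_def power2_eq_square)
  moreover have "((\<lambda>h::real. max 0 h) \<longlongrightarrow> max 0 0) (at 0)" by (intro tendsto_intros)
  ultimately show ?thesis using equal by (simp add: DERIV_def)
next
  case greater
  have "((\<lambda>x. x\<^sup>2) has_real_derivative 2 * x) (at x)" by (auto intro!: derivative_eq_intros)
  then have "((\<lambda>x. (max 0 x)\<^sup>2) has_real_derivative 2 * x) (at x)"
    by (rule has_field_derivative_transform_within_open[of _ _ _ "{0<..}"]) (use greater in auto)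
  with greater show ?thesis by simp
qed

text \<open>Continuously differentiable, \<open>0\<close> on the negative half-line and tending to \<open>1\<close> at infinity, so
  that \<open>ramp (n * (x - p))\<close> tends to the indicator of \<open>{p<..}\<close>, also at \<open>x = p\<close>.\<close>

definition ramp :: "real \<Rightarrow> real" where
  "ramp x = (max 0 x)\<^sup>2 / (1 + (max 0 x)\<^sup>2)"

lemma ramp_range: "0 \<le> ramp x" "ramp x \<le> 1"
  by (auto simp: ramp_def divide_le_eq_1 add_pos_nonneg)

lemma ramp_deriv: "(ramp has_real_derivative 2 * max 0 x / (1 + (max 0 x)\<^sup>2)\<^sup>2) (at x)"
proof -
  have nz: "1 + (max 0 x)\<^sup>2 \<noteq> 0" using zero_le_power2[of "max 0 x"] by linarith
  note d = has_derivative_square_pos_part[of x]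
  have "(ramp has_real_derivative
      (2 * max 0 x * (1 + (max 0 x)\<^sup>2) - (max 0 x)\<^sup>2 * (0 + 2 * max 0 x)) / ((1 + (max 0 x)\<^sup>2) * (1 + (max 0 x)\<^sup>2))) (at x)"
    unfolding ramp_def[abs_def] by (rule DERIV_divide[OF d DERIV_add[OF DERIV_const d] nz])
  then show ?thesis by (simp add: algebra_simps power2_eq_square)
qed

lemma ramp_limit: "(\<lambda>n. ramp (real n * (x - p))) \<longlonglongrightarrow> indicator {p<..} x"
proof (cases "p < x")
  case True
  have "filterlim (\<lambda>n. real n * (x - p)) at_top sequentially"
    using True by (intro filterlim_at_top_mult_tendsto_pos[OF tendsto_const] filterlim_real_sequentially) auto
  moreover have "(ramp \<longlongrightarrow> 1) at_top"
  proof (rule tendsto_cong[THEN iffD1])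
    show "\<forall>\<^sub>F x in at_top. 1 - 1 / (1 + x\<^sup>2) = ramp x"
      using eventually_gt_at_top[of 0]
    proof eventually_elim
      case (elim x)
      have "1 + x\<^sup>2 \<noteq> 0" using zero_le_power2[of x] by linarith
      then show ?case using elim by (simp add: ramp_def field_simps)
    qed
    have "filterlim (\<lambda>x::real. 1 + x\<^sup>2) at_top at_top"
      by (intro filterlim_tendsto_add_at_top[OF tendsto_const] filterlim_pow_at_top filterlim_ident) auto
    then have "((\<lambda>x::real. 1 / (1 + x\<^sup>2)) \<longlongrightarrow> 0) at_top"
      by (intro tendsto_divide_0[OF tendsto_const] filterlim_at_top_imp_at_infinity)
    then have "((\<lambda>x::real. 1 - 1 / (1 + x\<^sup>2)) \<longlongrightarrow> 1 - 0) at_top"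
      by (intro tendsto_diff tendsto_const)
    then show "((\<lambda>x::real. 1 - 1 / (1 + x\<^sup>2)) \<longlongrightarrow> 1) at_top" by simp
  qed
  ultimately have "(\<lambda>n. ramp (real n * (x - p))) \<longlonglongrightarrow> 1" by (rule filterlim_compose[rotated])
  with True show ?thesis by simp
next
  case False
  then have "real n * (x - p) \<le> 0" for n by (intro mult_nonneg_nonpos) auto
  then have "ramp (real n * (x - p)) = 0" for n by (simp add: ramp_def max_absorb1)
  with False show ?thesis by simp
qed

definition ramp_test :: "real \<Rightarrow> nat set \<Rightarrow> nat \<Rightarrow> nat \<Rightarrow> real \<Rightarrow> real" where
  "ramp_test p B n i x = indicator B i * ramp (real n * (x - p))"

lemma ramp_test_function: "test_function (ramp_test p B n)"
  unfolding test_function_def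
proof (intro exI ballI conjI allI)
  fix i :: nat and x :: real
  let ?y = "\<lambda>x. real n * (x - p)"
  have "(?y has_real_derivative real n) (at x)" by (auto intro!: derivative_eq_intros)
  from DERIV_cmult[OF DERIV_chain2[OF ramp_deriv this]]
  show "(ramp_test p B n i has_real_derivative indicator B i * (2 * max 0 (?y x) / (1 + (max 0 (?y x))\<^sup>2)\<^sup>2 * real n)) (at x)"
    unfolding ramp_test_def[abs_def] .
  have "(1 + (max 0 (?y x))\<^sup>2)\<^sup>2 \<noteq> 0" for x
    using zero_le_power2[of "max 0 (?y x)"] by (simp add: add_nonneg_eq_0_iff)
  then show "continuous_on UNIV (\<lambda>x. indicator B i * (2 * max 0 (?y x) / (1 + (max 0 (?y x))\<^sup>2)\<^sup>2 * real n))"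
    by (intro continuous_intros) auto
  show "\<bar>ramp_test p B n i x\<bar> \<le> 1"
    using ramp_range[of "?y x"] by (simp add: ramp_test_def indicator_def)
qed

lemma ramp_test_limit:
  assumes M: "finite_measure M" and [simp, measurable_cong]: "sets M = sets state_space" and B: "B \<subseteq> {0, 1}"
  shows "(\<lambda>n. \<integral>z. ramp_test p B n (snd z) (fst z) \<partial>M) \<longlonglongrightarrow> measure M ({p<..} \<times> B)"
proof -
  interpret finite_measure M by fact
  have A: "{p<..} \<times> B \<in> sets M" using B by (auto intro!: pair_measureI)
  have m: "(\<lambda>z. ramp_test p B n (snd z) (fst z)) \<in> borel_measurable M" for n
    unfolding measurable_cong_sets[OF \<open>sets M = sets state_space\<close> refl]
    by (intro state_measurable test_function_D[OF ramp_test_function])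
  have "(\<lambda>n. \<integral>z. ramp_test p B n (snd z) (fst z) \<partial>M) \<longlonglongrightarrow> (\<integral>z. indicator ({p<..} \<times> B) z \<partial>M)"
  proof (rule integral_dominated_convergence[where w = "\<lambda>_. 1"])
    show "AE z in M. (\<lambda>n. ramp_test p B n (snd z) (fst z)) \<longlonglongrightarrow> indicator ({p<..} \<times> B) z"
    proof (rule AE_I2)
      fix z
      have "(\<lambda>n. indicator B (snd z) * ramp (real n * (fst z - p))) \<longlonglongrightarrow> indicator B (snd z) * indicator {p<..} (fst z)"
        by (intro tendsto_mult tendsto_const ramp_limit)
      moreover have "indicator B (snd z) * indicator {p<..} (fst z) = (indicator ({p<..} \<times> B) z :: real)"
        by (cases z) (auto simp: indicator_def)
      ultimately show "(\<lambda>n. ramp_test p B n (snd z) (fst z)) \<longlonglongrightarrow> indicator ({p<..} \<times> B) z"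
        by (simp add: ramp_test_def)
    qed
    show "AE z in M. norm (ramp_test p B n (snd z) (fst z)) \<le> 1" for n
      using ramp_range by (intro AE_I2) (simp add: ramp_test_def indicator_def)
  qed (use m A in auto)
  then show ?thesis using A by simp
qed

lemma measure_eqI_test_functions:
  assumes M: "finite_measure M" "sets M = sets state_space" and N: "finite_measure N" "sets N = sets state_space"
    and eq: "\<And>f. test_function f \<Longrightarrow> (\<integral>z. f (snd z) (fst z) \<partial>M) = (\<integral>z. f (snd z) (fst z) \<partial>N)"
  shows "M = N"
proof (rule measure_eqI_generator_eq[OF Int_stable_rays])
  interpret M: finite_measure M by fact
  interpret N: finite_measure N by fact
  show "rays \<subseteq> Pow (UNIV \<times> {0, 1})" by (auto simp: rays_def)
  show "sets M = sigma_sets (UNIV \<times> {0, 1}) rays" "sets N = sigma_sets (UNIV \<times> {0, 1}) rays"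
    using M(2) N(2) sets_state_space by auto
  show "emeasure M X = emeasure N X" if "X \<in> rays" for X
  proof -
    obtain p B where X: "X = {p<..} \<times> B" "B \<subseteq> {0, 1}" using \<open>X \<in> rays\<close> unfolding rays_def by auto
    have "measure M X = measure N X"
      using LIMSEQ_unique[OF ramp_test_limit[OF M X(2)]] ramp_test_limit[OF N X(2)]
      unfolding X(1) eq[OF ramp_test_function] by blast
    then show ?thesis by (simp add: M.emeasure_eq_measure N.emeasure_eq_measure)
  qed
  show "range (\<lambda>n. {- real n<..} \<times> {0, 1}) \<subseteq> rays" unfolding rays_def by blast
  have "\<exists>n. - real n < x" for x :: real
    using reals_Archimedean2[of "- x"] by (auto simp: minus_less_iff)
  then show "(\<Union>n. {- real n<..} \<times> {0, 1}) = UNIV \<times> {0, 1}" by auto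
  show "emeasure M ({- real n<..} \<times> {0, 1}) \<noteq> \<infinity>" for n
    using M.emeasure_finite by simp
qed

text \<open>The probabilities of the sets in \<open>rays\<close> are limits of integrals of test functions; the monotone
  class argument for kernels extends measurability to all sets.\<close>

lemma kernel_measurable_test_functions:
  assumes K: "\<And>z. z \<in> space state_space \<Longrightarrow> prob_space (K z)" "\<And>z. z \<in> space state_space \<Longrightarrow> sets (K z) = sets state_space"
    and m: "\<And>f. test_function f \<Longrightarrow> (\<lambda>z. \<integral>y. f (snd y) (fst y) \<partial>K z) \<in> borel_measurable state_space"
  shows "K \<in> measurable state_space (subprob_algebra state_space)"
proof (rule measurable_subprob_algebra_generated[OF sets_state_space Int_stable_rays])
  show "rays \<subseteq> Pow (UNIV \<times> {0, 1})" by (auto simp: rays_def)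
  show "subprob_space (K z)" if "z \<in> space state_space" for z
    using K(1)[OF that] by (rule prob_space_imp_subprob_space)
  show "(\<lambda>z. emeasure (K z) X) \<in> borel_measurable state_space" if "X \<in> rays" for X
  proof -
    obtain p B where X: "X = {p<..} \<times> B" "B \<subseteq> {0, 1}" using \<open>X \<in> rays\<close> unfolding rays_def by auto
    have fin: "finite_measure (K z)" if "z \<in> space state_space" for z
      using K(1)[OF that] by (simp add: prob_space.finite_measure)
    have "(\<lambda>z. measure (K z) X) \<in> borel_measurable state_space"
      unfolding X(1)
      by (rule borel_measurable_LIMSEQ_real[OF ramp_test_limit[OF fin K(2) X(2)] m[OF ramp_test_function]])
    then have "(\<lambda>z. ennreal (measure (K z) X)) \<in> borel_measurable state_space" by simp
    then show ?thesis
      by (rule measurable_cong[THEN iffD1, rotated]) (simp add: finite_measure.emeasure_eq_measure[OF fin])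
  qed
  have "emeasure (K z) (UNIV \<times> {0, 1}) = 1" if "z \<in> space state_space" for z
    using prob_space.emeasure_space_1[OF K(1)[OF that]]
    unfolding sets_eq_imp_space_eq[OF K(2)[OF that]] space_state_space .
  then show "(\<lambda>z. emeasure (K z) (UNIV \<times> {0, 1})) \<in> borel_measurable state_space"
    by (subst measurable_cong[where g = "\<lambda>_. 1"]) auto
qed (use K in auto)

lemma state_integral:
  fixes g :: "nat \<Rightarrow> real \<Rightarrow> real"
  assumes g: "\<And>i. i \<in> {0, 1} \<Longrightarrow> integrable lborel (g i)"
  shows "integrable (lborel \<Otimes>\<^sub>M count_space {0, 1}) (\<lambda>z. g (snd z) (fst z))"
    and "(\<integral>z. g (snd z) (fst z) \<partial>(lborel \<Otimes>\<^sub>M count_space {0, 1})) = (\<integral>x. g 0 x \<partial>lborel) + (\<integral>x. g 1 x \<partial>lborel)"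
proof -
  interpret C: finite_measure "count_space {0, 1 :: nat}" by (rule finite_measure_count_space) simp
  interpret pair_sigma_finite lborel "count_space {0, 1 :: nat}" ..
  have m: "(\<lambda>z. g (snd z) (fst z)) \<in> borel_measurable (lborel \<Otimes>\<^sub>M count_space {0, 1})"
    using state_measurable[of g] g by (auto dest: borel_measurable_integrable cong: measurable_cong_sets sets_pair_measure_cong)
  show I: "integrable (lborel \<Otimes>\<^sub>M count_space {0, 1}) (\<lambda>z. g (snd z) (fst z))"
  proof (rule Fubini_integrable[OF m])
    have "integrable lborel (\<lambda>x. \<bar>g 0 x\<bar> + \<bar>g 1 x\<bar>)" using g by (intro Bochner_Integration.integrable_add integrable_abs) auto
    then show "integrable lborel (\<lambda>x. \<integral>y. norm (g (snd (x, y)) (fst (x, y))) \<partial>count_space {0, 1})"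
      by (simp add: lebesgue_integral_count_space_finite)
  qed (auto intro!: AE_I2 integrable_count_space)
  show "(\<integral>z. g (snd z) (fst z) \<partial>(lborel \<Otimes>\<^sub>M count_space {0, 1})) = (\<integral>x. g 0 x \<partial>lborel) + (\<integral>x. g 1 x \<partial>lborel)"
    using integral_fst'[OF I] g by (simp add: lebesgue_integral_count_space_finite)
qed

section \<open>The transition kernel on the attractor\<close>

(* The index set {0, 1} also occurs inside measure types such as count_space {0, 1}; rewriting 1 to
   Suc 0 would hide the equality of such terms. *)
declare One_nat_def [simp del]

locale switched_flow = stationary_branch +
  fixes U :: "real \<Rightarrow> real" and M :: "nat \<Rightarrow> 'w measure" and \<xi> :: "nat \<Rightarrow> real \<Rightarrow> 'w \<Rightarrow> nat"
    and X :: "nat \<Rightarrow> real \<Rightarrow> real \<Rightarrow> 'w \<Rightarrow> real"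
  assumes deriv_U: "deriv U = u"
    and markov: "i \<in> {0, 1} \<Longrightarrow> two_state_markov (M i) lam i (\<xi> i)"
    and solves: "i \<in> {0, 1} \<Longrightarrow> x \<in> {a<..<b} \<Longrightarrow> solves_switched_ode (M i) U c (\<xi> i) x (X i x)"
begin

definition transition_operator :: "real \<Rightarrow> (nat \<Rightarrow> real \<Rightarrow> real) \<Rightarrow> nat \<Rightarrow> real \<Rightarrow> real" where
  "transition_operator t f i x = (\<integral>\<omega>. f (\<xi> i t \<omega>) (X i x t \<omega>) \<partial>M i)"

lemma transition_operator_limit:
  assumes f: "test_function f" and i: "i \<in> {0, 1}" and x: "x \<in> {a<..<b}" and t: "t \<ge> 0"
  shows "(\<lambda>n. (step (t / real n) ^^ n) f i x) \<longlonglongrightarrow> transition_operator t f i x"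
proof -
  obtain F where F: "\<And>i x. i \<in> {0, 1} \<Longrightarrow> \<bar>f i x\<bar> \<le> F" using test_function_bounded[OF f] by blast
  have x': "x \<in> {a..b}" using x by auto
  show ?thesis unfolding transition_operator_def
    by (rule expectation_limit_of_iterates[OF markov[OF i] solves[OF i x] deriv_U i x' t test_function_D(1)[OF f] F])
qed

lemma process_measurable:
  assumes "i \<in> {0, 1}" "x \<in> {a<..<b}" "t \<ge> 0"
  shows "(\<lambda>\<omega>. (X i x t \<omega>, \<xi> i t \<omega>)) \<in> measurable (M i) state_space"
  using markov[OF assms(1)] solves[OF assms(1,2)] assms(3)
  unfolding two_state_markov_def solves_switched_ode_def by (intro measurable_Pair) auto

lemma prob_space_M: "i \<in> {0, 1} \<Longrightarrow> prob_space (M i)"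
  using markov unfolding two_state_markov_def by blast

text \<open>Nothing is known about \<open>X\<close> for starting points outside \<open>(a, b)\<close>, where the transition kernel may
  fail to be measurable. A law that lives on \<open>(a, b)\<close> does not notice a point mass put there instead.\<close>

definition inner_kernel :: "real \<Rightarrow> real \<times> nat \<Rightarrow> (real \<times> nat) measure" where
  "inner_kernel t z = (if fst z \<in> {a<..<b} then transition M \<xi> X t z else return state_space (a, 0))"

lemma inner_kernel_inside: "x \<in> {a<..<b} \<Longrightarrow> inner_kernel t (x, i) = distr (M i) state_space (\<lambda>\<omega>. (X i x t \<omega>, \<xi> i t \<omega>))"
  by (simp add: inner_kernel_def transition_def)

lemma inner_kernel_prob:
  assumes "z \<in> space state_space" "t \<ge> 0"
  shows "prob_space (inner_kernel t z)" "sets (inner_kernel t z) = sets state_space"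
proof -
  obtain x i where z: "z = (x, i)" "i \<in> {0, 1}" using assms(1) unfolding space_state_space by auto
  have "prob_space (inner_kernel t z) \<and> sets (inner_kernel t z) = sets state_space"
  proof (cases "x \<in> {a<..<b}")
    case True
    then show ?thesis unfolding z(1) inner_kernel_inside[OF True]
      using prob_space.prob_space_distr[OF prob_space_M[OF z(2)] process_measurable[OF z(2) True assms(2)]] by simp
  next
    case False
    then have "inner_kernel t z = return state_space (a, 0)" by (auto simp: z(1) inner_kernel_def)
    then show ?thesis by (simp add: prob_space_return space_state_space)
  qed
  then show "prob_space (inner_kernel t z)" "sets (inner_kernel t z) = sets state_space" by auto
qed

lemma inner_kernel_integral:
  assumes f: "test_function f" and i: "i \<in> {0, 1}" and t: "t \<ge> 0"
  shows "(\<integral>y. f (snd y) (fst y) \<partial>inner_kernel t (x, i)) = (if x \<in> {a<..<b} then transition_operator t f i x else f 0 a)"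
proof (cases "x \<in> {a<..<b}")
  case True
  have "(\<lambda>z. f (snd z) (fst z)) \<in> borel_measurable state_space"
    by (intro state_measurable test_function_D[OF f])
  from integral_distr[OF process_measurable[OF i True t] this] True show ?thesis
    by (simp add: inner_kernel_inside transition_operator_def)
next
  case False
  then have "inner_kernel t (x, i) = return state_space (a, 0)" by (auto simp: inner_kernel_def)
  moreover have "(\<lambda>z. f (snd z) (fst z)) \<in> borel_measurable state_space"
    by (intro state_measurable test_function_D[OF f])
  ultimately show ?thesis using False by (auto simp: integral_return space_state_space)
qed

text \<open>A pointwise limit of the continuous functions \<open>(step (t / n) ^^ n) f i\<close>.\<close>

lemma transition_operator_measurable:
  assumes f: "test_function f" and i: "i \<in> {0, 1}" and t: "t \<ge> 0"
  shows "(\<lambda>x. if x \<in> {a<..<b} then transition_operator t f i x else f 0 a) \<in> borel_measurable borel"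
proof (rule borel_measurable_LIMSEQ_real)
  fix x
  show "(\<lambda>n. if x \<in> {a<..<b} then (step (t / real n) ^^ n) f i x else f 0 a)
      \<longlonglongrightarrow> (if x \<in> {a<..<b} then transition_operator t f i x else f 0 a)"
    using transition_operator_limit[OF f i _ t] by auto
next
  fix n
  have [measurable]: "(step (t / real n) ^^ n) f i \<in> borel_measurable borel"
    using iterate_continuous[of f, OF test_function_D(1)[OF f] i] by (rule borel_measurable_continuous_onI)
  show "(\<lambda>x. if x \<in> {a<..<b} then (step (t / real n) ^^ n) f i x else f 0 a) \<in> borel_measurable borel"
    by measurable
qed

lemma inner_kernel_measurable:
  assumes t: "t \<ge> 0"
  shows "inner_kernel t \<in> measurable state_space (subprob_algebra state_space)"
proof (rule kernel_measurable_test_functions)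
  fix f assume f: "test_function f"
  have m: "(\<lambda>z. (if fst z \<in> {a<..<b} then transition_operator t f (snd z) (fst z) else f 0 a)) \<in> borel_measurable state_space"
    using state_measurable[of "\<lambda>i x. if x \<in> {a<..<b} then transition_operator t f i x else f 0 a"] transition_operator_measurable[OF f _ t] by simp
  have e: "(if fst z \<in> {a<..<b} then transition_operator t f (snd z) (fst z) else f 0 a) = (\<integral>y. f (snd y) (fst y) \<partial>inner_kernel t z)"
    if zs: "z \<in> space state_space" for z
  proof -
    obtain x i where z: "z = (x, i)" "i \<in> {0, 1}" using zs unfolding space_state_space by auto
    show ?thesis unfolding z(1) using inner_kernel_integral[OF f z(2) t] by simp
  qed
  show "(\<lambda>z. \<integral>y. f (snd y) (fst y) \<partial>inner_kernel t z) \<in> borel_measurable state_space"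
    by (rule measurable_cong[THEN iffD1, OF e m])
qed (use inner_kernel_prob t in auto)

lemma measurable_from_state_space:
  "sets \<mu> = sets state_space \<Longrightarrow> measurable \<mu> N = measurable state_space N"
  by (rule measurable_cong_sets) auto

lemma invariant_measure_iff_bind:
  assumes sets: "sets \<mu> = sets state_space" and G: "AE z in \<mu>. fst z \<in> {a<..<b}"
  shows "invariant_measure (transition M \<xi> X) \<mu> \<longleftrightarrow> prob_space \<mu> \<and> (\<forall>t\<ge>0. \<mu> \<bind> inner_kernel t = \<mu>)"
proof -
  have sp: "space \<mu> \<noteq> {}" using sets_eq_imp_space_eq[OF sets] by (simp add: space_state_space)
  have km: "inner_kernel t \<in> measurable \<mu> (subprob_algebra state_space)" if "t \<ge> 0" for t
    using inner_kernel_measurable[OF that] unfolding measurable_from_state_space[OF sets] .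
  have eq: "emeasure (\<mu> \<bind> inner_kernel t) A = (\<integral>\<^sup>+ z. emeasure (transition M \<xi> X t z) A \<partial>\<mu>)"
    if "t \<ge> 0" "A \<in> sets state_space" for t A
    unfolding emeasure_bind[OF sp km[OF that(1)] that(2)]
    using G by (intro nn_integral_cong_AE) (auto simp: inner_kernel_def elim: eventually_mono)
  have sb: "sets (\<mu> \<bind> inner_kernel t) = sets state_space" if "t \<ge> 0" for t
    using sets_bind[of \<mu> "inner_kernel t" state_space] sets_kernel[OF km[OF that]] sp by auto
  have "\<mu> \<bind> inner_kernel t = \<mu> \<longleftrightarrow> (\<forall>A\<in>sets state_space. (\<integral>\<^sup>+ z. emeasure (transition M \<xi> X t z) A \<partial>\<mu>) = emeasure \<mu> A)"
    if "t \<ge> 0" for t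
  proof
    assume "\<mu> \<bind> inner_kernel t = \<mu>"
    then show "\<forall>A\<in>sets state_space. (\<integral>\<^sup>+ z. emeasure (transition M \<xi> X t z) A \<partial>\<mu>) = emeasure \<mu> A"
      using eq[OF that] by simp
  next
    assume *: "\<forall>A\<in>sets state_space. (\<integral>\<^sup>+ z. emeasure (transition M \<xi> X t z) A \<partial>\<mu>) = emeasure \<mu> A"
    show "\<mu> \<bind> inner_kernel t = \<mu>"
    proof (rule measure_eqI)
      show "sets (\<mu> \<bind> inner_kernel t) = sets \<mu>" using sb[OF that] sets by simp
      fix A assume "A \<in> sets (\<mu> \<bind> inner_kernel t)"
      then show "emeasure (\<mu> \<bind> inner_kernel t) A = emeasure \<mu> A" using eq[OF that] * sb[OF that] by auto
    qed
  qed
  then show ?thesis unfolding invariant_measure_def using sets by blast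
qed

lemma integral_bind_inner_kernel:
  assumes \<mu>: "prob_space \<mu>" and sets: "sets \<mu> = sets state_space" and f: "test_function f" and t: "t \<ge> 0"
  shows "(\<integral>z. f (snd z) (fst z) \<partial>(\<mu> \<bind> inner_kernel t))
    = (\<integral>z. (if fst z \<in> {a<..<b} then transition_operator t f (snd z) (fst z) else f 0 a) \<partial>\<mu>)"
proof -
  interpret prob_space \<mu> by fact
  obtain F where F: "\<And>i x. i \<in> {0, 1} \<Longrightarrow> \<bar>f i x\<bar> \<le> F" using test_function_bounded[OF f] by blast
  have sp: "space \<mu> = UNIV \<times> {0, 1}" using sets_eq_imp_space_eq[OF sets] by (simp add: space_state_space)
  have km: "inner_kernel t \<in> measurable \<mu> (subprob_algebra state_space)"
    using inner_kernel_measurable[OF t] unfolding measurable_from_state_space[OF sets] .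
  have "(\<integral>z. f (snd z) (fst z) \<partial>(\<mu> \<bind> inner_kernel t)) = (\<integral>z. (\<integral>y. f (snd y) (fst y) \<partial>inner_kernel t z) \<partial>\<mu>)"
  proof (rule integral_bind[OF _ _ km, where B = F and B' = 1])
    show "(\<lambda>z. f (snd z) (fst z)) \<in> borel_measurable state_space"
      by (intro state_measurable test_function_D[OF f])
    show "\<bar>f (snd z) (fst z)\<bar> \<le> F" if "z \<in> space state_space" for z
      using that F unfolding space_state_space by auto
    show "AE z in \<mu>. emeasure (inner_kernel t z) (space (inner_kernel t z)) \<le> ennreal 1"
      using inner_kernel_prob(1)[OF _ t] sets_eq_imp_space_eq[OF sets]
      by (intro AE_I2) (simp add: prob_space.emeasure_space_1)
  qed (rule finite_measure_axioms)
  also have "\<dots> = (\<integral>z. (if fst z \<in> {a<..<b} then transition_operator t f (snd z) (fst z) else f 0 a) \<partial>\<mu>)"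
  proof (rule Bochner_Integration.integral_cong[OF refl])
    fix z assume "z \<in> space \<mu>"
    then obtain x i where z: "z = (x, i)" "i \<in> {0, 1}" unfolding sp by auto
    show "(\<integral>y. f (snd y) (fst y) \<partial>inner_kernel t z) = (if fst z \<in> {a<..<b} then transition_operator t f (snd z) (fst z) else f 0 a)"
      unfolding z(1) using inner_kernel_integral[OF f z(2) t] by simp
  qed
  finally show ?thesis .
qed

section \<open>Existence\<close>

definition norm_const :: real where "norm_const = 1 / (mass 0 + mass 1)"

definition stat_measure :: "(real \<times> nat) measure" where
  "stat_measure = density (lborel \<Otimes>\<^sub>M count_space {0, 1}) (\<lambda>z. ennreal (norm_const * weight (snd z) (fst z)))"

lemma norm_const_pos: "norm_const > 0"
  using mass_pos[of 0] mass_pos[of 1] by (simp add: norm_const_def)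

lemma sets_lborel_state: "sets (lborel \<Otimes>\<^sub>M count_space {0, 1 :: nat}) = sets state_space"
  by (intro sets_pair_measure_cong) auto

lemma sets_stat_measure: "sets stat_measure = sets state_space"
  by (simp add: stat_measure_def sets_lborel_state)

lemma weight_state_measurable:
  "(\<lambda>z. norm_const * weight (snd z) (fst z)) \<in> borel_measurable (lborel \<Otimes>\<^sub>M count_space {0, 1})"
  unfolding measurable_from_state_space[OF sets_lborel_state]
  using state_measurable[of "\<lambda>i x. norm_const * weight i x"] by simp

lemma stat_measure_prob: "prob_space stat_measure"
proof
  have I: "integrable lborel (\<lambda>x. norm_const * weight i x)" if "i \<in> {0, 1}" for i
    using weight_integrable[OF that] by simp
  have "emeasure stat_measure (space stat_measure)
      = (\<integral>\<^sup>+ z. ennreal (norm_const * weight (snd z) (fst z)) \<partial>(lborel \<Otimes>\<^sub>M count_space {0, 1}))"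
    unfolding stat_measure_def using weight_state_measurable
    by (subst emeasure_density) (auto intro!: nn_integral_cong)
  also have "\<dots> = ennreal (\<integral>z. norm_const * weight (snd z) (fst z) \<partial>(lborel \<Otimes>\<^sub>M count_space {0, 1}))"
    using state_integral(1)[of "\<lambda>i x. norm_const * weight i x", OF I] norm_const_pos weight_nonneg
    by (intro nn_integral_eq_integral) auto
  also have "\<dots> = 1"
    using state_integral(2)[of "\<lambda>i x. norm_const * weight i x", OF I] mass_pos[of 0] mass_pos[of 1]
    by (simp add: norm_const_def mass_def[symmetric] add_divide_distrib[symmetric])
  finally show "emeasure stat_measure (space stat_measure) = 1" .
qed

lemma stat_measure_inside: "AE z in stat_measure. fst z \<in> {a<..<b}"
  unfolding stat_measure_def
proof (subst AE_density)
  show "AE z in lborel \<Otimes>\<^sub>M count_space {0, 1}. 0 < ennreal (norm_const * weight (snd z) (fst z)) \<longrightarrow> fst z \<in> {a<..<b}"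
    using weight_outside by (intro AE_I2) fastforce
qed (use weight_state_measurable in measurable)

lemma stat_measure_integral:
  assumes m: "\<And>i. i \<in> {0, 1} \<Longrightarrow> f i \<in> borel_measurable borel"
    and F: "\<And>i x. i \<in> {0, 1} \<Longrightarrow> x \<in> {a<..<b} \<Longrightarrow> \<bar>f i x\<bar> \<le> F"
  shows "(\<integral>z. f (snd z) (fst z) \<partial>stat_measure) = norm_const * stat_fun f"
proof -
  have w: "(\<lambda>x. f i x * weight i x) = (\<lambda>x. (indicator {a<..<b} x * f i x) * weight i x)" for i
  proof (rule ext)
    fix x show "f i x * weight i x = (indicator {a<..<b} x * f i x) * weight i x"
      by (cases "x \<in> {a<..<b}") (auto simp: weight_outside)
  qed
  have "0 \<le> F" using F[of 0 "(a + b) / 2"] ends by auto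
  then have I: "integrable lborel (\<lambda>x. f i x * weight i x)" if i: "i \<in> {0, 1}" for i
    unfolding w using F[OF i] m[OF i] by (intro weight_mult_integrable(1)[OF _ _ i, of _ F]) (auto simp: indicator_def)
  then have I': "integrable lborel (\<lambda>x. norm_const * (f i x * weight i x))" if "i \<in> {0, 1}" for i
    using that by simp
  have "(\<integral>z. f (snd z) (fst z) \<partial>stat_measure)
      = (\<integral>z. norm_const * (f (snd z) (fst z) * weight (snd z) (fst z)) \<partial>(lborel \<Otimes>\<^sub>M count_space {0, 1}))"
    unfolding stat_measure_def using weight_state_measurable state_measurable[OF m] norm_const_pos weight_nonneg
    by (subst integral_density) (auto simp: measurable_from_state_space[OF sets_lborel_state] mult_ac)
  also have "\<dots> = norm_const * stat_fun f"
    using state_integral(2)[of "\<lambda>i x. norm_const * (f i x * weight i x)", OF I'] I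
    by (simp add: stat_fun_def distrib_left)
  finally show ?thesis .
qed

lemma transition_operator_bound:
  assumes F: "\<And>i x. i \<in> {0, 1} \<Longrightarrow> \<bar>f i x\<bar> \<le> F" and f: "test_function f"
    and i: "i \<in> {0, 1}" and x: "x \<in> {a<..<b}" and t: "t \<ge> 0"
  shows "\<bar>transition_operator t f i x\<bar> \<le> F"
proof (rule LIMSEQ_le_const2[OF tendsto_rabs[OF transition_operator_limit[OF f i x t]]])
  obtain N where N: "\<And>n. n \<ge> N \<Longrightarrow> small (t / real n)"
    using small_eventually[OF t] unfolding eventually_sequentially by blast
  have "\<bar>(step (t / real n) ^^ n) f i x\<bar> \<le> F" if "n \<ge> N" for n
    by (rule iterate_bound[OF N[OF that]]) (use F i x in auto)
  then show "\<exists>N. \<forall>n\<ge>N. \<bar>(step (t / real n) ^^ n) f i x\<bar> \<le> F" by blast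
qed

lemma test_function_C1_lipschitz:
  assumes "test_function f" obtains K where "C1_lipschitz K f"
proof -
  obtain f' where f': "\<And>i x. i \<in> {0, 1} \<Longrightarrow> (f i has_real_derivative f' i x) (at x)"
    "\<And>i. i \<in> {0, 1} \<Longrightarrow> continuous_on UNIV (f' i)"
    using assms unfolding test_function_def by blast
  have "bounded (f' 0 ` {a..b} \<union> f' 1 ` {a..b})"
    by (auto intro!: compact_imp_bounded compact_continuous_image continuous_on_subset[OF f'(2)])
  then obtain K where "\<And>i x. i \<in> {0, 1} \<Longrightarrow> x \<in> {a..b} \<Longrightarrow> \<bar>f' i x\<bar> \<le> K"
    unfolding bounded_iff by force
  with f' have "C1_lipschitz K f" unfolding C1_lipschitz_def by blast
  with that show thesis .
qed

text \<open>On test functions this is \<open>stat_fun_invariant\<close>, and test functions determine the measure.\<close>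

lemma stat_measure_bind:
  assumes t: "t \<ge> 0" shows "stat_measure \<bind> inner_kernel t = stat_measure"
proof (rule measure_eqI_test_functions)
  interpret prob_space stat_measure by (rule stat_measure_prob)
  have km: "inner_kernel t \<in> measurable stat_measure (subprob_algebra state_space)"
    using inner_kernel_measurable[OF t] unfolding measurable_from_state_space[OF sets_stat_measure] .
  have sp: "space stat_measure = UNIV \<times> {0, 1}"
    using sets_eq_imp_space_eq[OF sets_stat_measure] by (simp add: space_state_space)
  show "finite_measure stat_measure" by (rule finite_measure_axioms)
  show "finite_measure (stat_measure \<bind> inner_kernel t)"
    using subprob_space_bind[OF prob_space_imp_subprob_space[OF stat_measure_prob] km]
    by (rule subprob_space.axioms)
  show "sets (stat_measure \<bind> inner_kernel t) = sets state_space"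
    using sets_bind[of stat_measure "inner_kernel t" state_space] sets_kernel[OF km] sp by auto
  fix f assume f: "test_function f"
  obtain F where F: "\<And>i x. i \<in> {0, 1} \<Longrightarrow> \<bar>f i x\<bar> \<le> F" using test_function_bounded[OF f] by blast
  obtain K where K: "C1_lipschitz K f" using test_function_C1_lipschitz[OF f] .
  define P where "P i x = (if x \<in> {a<..<b} then transition_operator t f i x else f 0 a)" for i x
  have "(\<integral>z. f (snd z) (fst z) \<partial>(stat_measure \<bind> inner_kernel t)) = (\<integral>z. P (snd z) (fst z) \<partial>stat_measure)"
    unfolding P_def by (rule integral_bind_inner_kernel[OF stat_measure_prob sets_stat_measure f t])
  also have "\<dots> = norm_const * stat_fun P"
  proof (rule stat_measure_integral)
    show "P i \<in> borel_measurable borel" if "i \<in> {0, 1}" for i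
      unfolding P_def[abs_def] by (rule transition_operator_measurable[OF f that t])
    show "\<bar>P i x\<bar> \<le> F" if "i \<in> {0, 1}" "x \<in> {a<..<b}" for i x
      using transition_operator_bound[OF F f that t] that(2) by (simp add: P_def)
  qed
  also have "stat_fun P = stat_fun f"
  proof (rule stat_fun_invariant[OF t K F])
    fix i :: nat and x assume "i \<in> {0, 1}" "x \<in> {a<..<b}"
    then show "(\<lambda>n. (step (t / real n) ^^ n) f i x) \<longlonglongrightarrow> P i x"
      using transition_operator_limit[OF f _ _ t] by (simp add: P_def)
  qed
  also have "norm_const * stat_fun f = (\<integral>z. f (snd z) (fst z) \<partial>stat_measure)"
    using stat_measure_integral[of f F, OF test_function_D(2)[OF f] F] by simp
  finally show "(\<integral>z. f (snd z) (fst z) \<partial>(stat_measure \<bind> inner_kernel t)) = (\<integral>z. f (snd z) (fst z) \<partial>stat_measure)" .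
qed (rule sets_stat_measure)

lemma stat_measure_invariant: "invariant_measure (transition M \<xi> X) stat_measure"
  using invariant_measure_iff_bind[OF sets_stat_measure stat_measure_inside] stat_measure_prob stat_measure_bind by blast

lemma stat_measure_support: "has_support stat_measure {a<..<b}"
  unfolding has_support_def
proof (intro conjI allI impI stat_measure_inside)
  interpret prob_space stat_measure by (rule stat_measure_prob)
  fix S :: "real set" assume S: "open S \<and> S \<inter> {a<..<b} \<noteq> {}"
  let ?S = "S \<inter> {a<..<b}"
  have SM: "S \<times> {0, 1} \<in> sets stat_measure" unfolding sets_stat_measure
    using S by (intro pair_measureI) auto
  have m: "(\<lambda>x. indicator S x :: real) \<in> borel_measurable borel" using S by simp
  have "measure stat_measure (S \<times> {0, 1}) = (\<integral>z. indicator (S \<times> {0, 1}) z \<partial>stat_measure)"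
    using SM by simp
  also have "\<dots> = (\<integral>z. (\<lambda>i x. indicator S x) (snd z) (fst z) \<partial>stat_measure)"
    using sets_eq_imp_space_eq[OF sets_stat_measure]
    by (intro Bochner_Integration.integral_cong) (auto simp: space_state_space indicator_def)
  also have "\<dots> = norm_const * stat_fun (\<lambda>i x. indicator S x)"
    by (rule stat_measure_integral[where F = 1]) (use m in \<open>auto simp: indicator_def\<close>)
  finally have eq: "measure stat_measure (S \<times> {0, 1}) = norm_const * stat_fun (\<lambda>i x. indicator S x)" .
  have I: "integrable lborel (\<lambda>x. indicator S x * weight i x)" if "i \<in> {0, 1}" for i
    by (rule weight_mult_integrable(1)[where K = 1]) (use m that in \<open>auto simp: indicator_def\<close>)
  have nn: "0 \<le> (\<integral>x. indicator S x * weight i x \<partial>lborel)" for i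
    using weight_nonneg by simp
  have "(\<integral>x. indicator S x * weight 0 x \<partial>lborel) \<noteq> 0"
  proof
    assume "(\<integral>x. indicator S x * weight 0 x \<partial>lborel) = 0"
    then have "AE x in lborel. indicator S x * weight 0 x = 0"
      using integral_nonneg_eq_0_iff_AE[OF I[of 0]] weight_nonneg by simp
    then have "AE x in lborel. x \<notin> ?S"
    proof eventually_elim
      case (elim x)
      then show ?case using flux_pos[of x] u_strict[of x] by (auto simp: weight_def)
    qed
    moreover have "open ?S" using S by auto
    ultimately have "?S = {}"
      using AE_in_set_eq_1 open_not_negligible[of ?S] 
      by (metis AE_iff_null_sets borel_open negligible_iff_null_sets null_sets_completionI sets_lborel)
    then show False using S by simp
  qed
  with nn[of 0] nn[of 1] have "0 < stat_fun (\<lambda>i x. indicator S x)" unfolding stat_fun_def by linarith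
  then have "0 < measure stat_measure (S \<times> {0, 1})" unfolding eq using norm_const_pos by simp
  then show "0 < emeasure stat_measure (S \<times> {0, 1})" by (simp add: emeasure_eq_measure)
qed

end

section \<open>The generator\<close>

lemma modulus_eventually:
  fixes \<psi> :: "real \<Rightarrow> real"
  assumes c: "continuous_on {a..b} \<psi>" and e: "e > 0"
  shows "\<forall>\<^sub>F d in at_right 0. \<forall>x\<in>{a..b}. \<forall>y\<in>{a..b}. \<bar>x - y\<bar> \<le> d \<longrightarrow> \<bar>\<psi> x - \<psi> y\<bar> \<le> e"
proof -
  have "uniformly_continuous_on {a..b} \<psi>"
    using c by (rule compact_uniformly_continuous) simp
  then obtain d where d: "d > 0" "\<And>x y. x \<in> {a..b} \<Longrightarrow> y \<in> {a..b} \<Longrightarrow> \<bar>x - y\<bar> < d \<Longrightarrow> \<bar>\<psi> x - \<psi> y\<bar> < e"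
    using e unfolding uniformly_continuous_on_def dist_real_def by blast
  have "\<forall>\<^sub>F t in at_right 0. t \<in> {0<..<d}" using d(1) by (rule eventually_at_right_real)
  then show ?thesis
  proof eventually_elim
    case (elim t)
    then show ?case using d(2) by (force intro: less_imp_le)
  qed
qed

context increasing_branch
begin

text \<open>The derivative \<open>f'\<close> is an argument of its own, to be instantiated with the derivative of \<open>f\<close>.\<close>

definition generator :: "(nat \<Rightarrow> real \<Rightarrow> real) \<Rightarrow> (nat \<Rightarrow> real \<Rightarrow> real) \<Rightarrow> nat \<Rightarrow> real \<Rightarrow> real" where
  "generator f f' i x = (c i - u x) * f' i x + lam i * (f (1 - i) x - f i x)"

definition diff_quotient :: "real \<Rightarrow> (nat \<Rightarrow> real \<Rightarrow> real) \<Rightarrow> nat \<Rightarrow> real \<Rightarrow> real" where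
  "diff_quotient h f i x = (step h f i x - f i x) / h"

lemma iterate_linear:
  "(step h ^^ n) (\<lambda>i x. f i x + k * g i x) = (\<lambda>i x. (step h ^^ n) f i x + k * (step h ^^ n) g i x)"
proof (induction n)
  case (Suc n)
  show ?case
    unfolding funpow.simps comp_apply Suc by (intro ext) (simp add: step_def algebra_simps)
qed simp

lemma iterate_telescope:
  assumes "h \<noteq> 0"
  shows "(step h ^^ n) f i x - f i x = h * (\<Sum>k<n. (step h ^^ k) (diff_quotient h f) i x)"
proof (induction n)
  case (Suc n)
  have "step h f = (\<lambda>i x. f i x + h * diff_quotient h f i x)"
    using assms by (intro ext) (simp add: diff_quotient_def)
  then have "(step h ^^ Suc n) f = (\<lambda>i x. (step h ^^ n) f i x + h * (step h ^^ n) (diff_quotient h f) i x)"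
    by (simp only: funpow_Suc_right comp_apply iterate_linear)
  with Suc show ?case by (simp add: algebra_simps)
qed simp

lemma first_order_error:
  fixes f f' :: "real \<Rightarrow> real"
  assumes f: "\<And>x. (f has_real_derivative f' x) (at x)"
    and e: "\<And>t. t \<in> {a..b} \<Longrightarrow> \<bar>t - x\<bar> \<le> \<bar>y - x\<bar> \<Longrightarrow> \<bar>f' t - f' x\<bar> \<le> e"
    and x: "x \<in> {a..b}" and y: "y \<in> {a..b}"
  shows "\<bar>f y - f x - f' x * (y - x)\<bar> \<le> e * \<bar>y - x\<bar>"
proof -
  let ?S = "{min x y..max x y}" and ?g = "\<lambda>t. f t - f' x * t"
  have "norm (?g y - ?g x) \<le> e * norm (y - x)"
  proof (rule field_differentiable_bound[where S = ?S and f' = "\<lambda>t. f' t - f' x"])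
    show "(?g has_field_derivative f' t - f' x) (at t within ?S)" for t
      by (rule DERIV_subset[of _ _ _ UNIV]) (auto intro!: derivative_eq_intros f)
    show "norm (f' t - f' x) \<le> e" if t: "t \<in> ?S" for t
      unfolding real_norm_def using t x y by (intro e) auto
  qed auto
  then show ?thesis by (simp add: algebra_simps)
qed

lemma diff_quotient_near_generator:
  assumes f: "\<And>i x. i \<in> {0, 1} \<Longrightarrow> (f i has_real_derivative f' i x) (at x)"
    and f': "\<And>i. i \<in> {0, 1} \<Longrightarrow> continuous_on UNIV (f' i)" and e: "e > 0"
  shows "\<forall>\<^sub>F h in at_right 0. \<forall>i\<in>{0, 1}. \<forall>x\<in>{a..b}. \<bar>diff_quotient h f i x - generator f f' i x\<bar> \<le> e"
proof -
  define e1 where "e1 = e / (speed + lam 0 + lam 1)"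
  have e1: "e1 > 0" unfolding e1_def using e speed_pos lam_pos by simp
  have cf: "continuous_on S (f i)" if "i \<in> {0, 1}" for i S
    by (rule DERIV_continuous_on[OF DERIV_subset[OF f[OF that]]]) auto
  have sc: "filterlim (\<lambda>h. h * speed) (at_right 0) (at_right 0)"
    unfolding filterlim_at using speed_pos
    by (auto intro!: tendsto_eq_intros eventually_at_right_less simp: zero_less_mult_iff eventually_at_filter)
  have m1: "\<forall>\<^sub>F d in at_right 0. \<forall>x\<in>{a..b}. \<forall>y\<in>{a..b}. \<bar>x - y\<bar> \<le> d \<longrightarrow> \<bar>f' i x - f' i y\<bar> \<le> e1"
    if "i \<in> {0, 1}" for i
    using f'[OF that] by (intro modulus_eventually[OF _ e1]) (auto intro: continuous_on_subset)
  have m2: "\<forall>\<^sub>F d in at_right 0. \<forall>x\<in>{a..b}. \<forall>y\<in>{a..b}. \<bar>x - y\<bar> \<le> d \<longrightarrow> \<bar>(f 1 x - f 0 x) - (f 1 y - f 0 y)\<bar> \<le> e1"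
    by (intro modulus_eventually[OF _ e1] continuous_on_diff cf) auto
  have sm: "\<forall>\<^sub>F h in at_right 0. small h"
  proof -
    have "((\<lambda>h. h * K) \<longlongrightarrow> 0) (at_right 0)" for K :: real by (auto intro!: tendsto_eq_intros)
    then have "\<forall>\<^sub>F h in at_right 0. h * K < 1" for K :: real by (rule order_tendstoD) simp
    from this[of Lip] this[of "lam 0 + lam 1"] eventually_at_right_less[of 0]
    show ?thesis by eventually_elim (simp add: small_def)
  qed
  have p0: "\<forall>\<^sub>F h in at_right 0. 0 < (h :: real)" by (rule eventually_at_right_less)
  note ev = filterlim_iff[THEN iffD1, OF sc, rule_format]
  show ?thesis using ev[OF m1[of 0, OF insertI1]] ev[OF m1[of 1, OF insertI2, OF singletonI]] ev[OF m2] sm p0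
  proof eventually_elim
    case (elim h)
    show ?case
    proof (intro ballI)
      fix i :: nat and x assume i: "i \<in> {0, 1}" and x: "x \<in> {a..b}"
      have ex: "euler h i x \<in> {a..b}" by (rule euler_in[OF elim(4) i x])
      have near: "\<bar>euler h i x - x\<bar> \<le> h * speed" using euler_near[OF _ x i] elim(5) by simp
      have step1: "\<bar>f i (euler h i x) - f i x - f' i x * (euler h i x - x)\<bar> \<le> e1 * \<bar>euler h i x - x\<bar>"
      proof (rule first_order_error[OF f[OF i] _ x ex])
        fix t assume "t \<in> {a..b}" "\<bar>t - x\<bar> \<le> \<bar>euler h i x - x\<bar>"
        with near have "\<bar>t - x\<bar> \<le> h * speed" by linarith
        with i x \<open>t \<in> {a..b}\<close> elim(1,2) show "\<bar>f' i t - f' i x\<bar> \<le> e1" by blast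
      qed
      also have "\<dots> \<le> e1 * (h * speed)" using near e1 by (intro mult_left_mono) auto
      finally have s1: "\<bar>f i (euler h i x) - f i x - f' i x * (euler h i x - x)\<bar> \<le> e1 * (h * speed)" .
      have "\<bar>(f 1 (euler h i x) - f 0 (euler h i x)) - (f 1 x - f 0 x)\<bar> \<le> e1"
        using elim(3) ex x near by blast
      then have s2: "\<bar>(f (1 - i) (euler h i x) - f i (euler h i x)) - (f (1 - i) x - f i x)\<bar> \<le> e1"
        using i by auto
      have l: "0 \<le> lam i" "lam i \<le> lam 0 + lam 1" using i lam_pos by auto
      have "step h f i x - f i x - h * generator f f' i x = (f i (euler h i x) - f i x - f' i x * (euler h i x - x))
          + lam i * h * ((f (1 - i) (euler h i x) - f i (euler h i x)) - (f (1 - i) x - f i x))"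
        by (simp add: step_def generator_def euler_def algebra_simps)
      also have "\<bar>\<dots>\<bar> \<le> e1 * (h * speed) + lam i * h * e1"
        using s1 s2 l(1) elim(5) by (intro order.trans[OF abs_triangle_ineq add_mono]) (auto simp: abs_mult intro!: mult_left_mono)
      also have "\<dots> \<le> e1 * (h * speed) + (lam 0 + lam 1) * h * e1"
        using l e1 elim(5) by (intro add_left_mono mult_right_mono) auto
      also have "\<dots> = h * (e1 * (speed + lam 0 + lam 1))" by (simp add: algebra_simps)
      also have "e1 * (speed + lam 0 + lam 1) = e" unfolding e1_def using speed_pos lam_pos by simp
      finally have b: "\<bar>step h f i x - f i x - h * generator f f' i x\<bar> \<le> h * e" .
      have "diff_quotient h f i x - generator f f' i x = (step h f i x - f i x - h * generator f f' i x) / h"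
        using elim(5) by (simp add: diff_quotient_def field_simps)
      then show "\<bar>diff_quotient h f i x - generator f f' i x\<bar> \<le> e"
        using b elim(5) by (simp add: abs_divide pos_divide_le_eq mult.commute)
    qed
  qed
qed

text \<open>During the time \<open>k h\<close> the position moves by at most \<open>k h\<close> times the maximal speed, and the
  state changes with probability at most \<open>(\<lambda>\<^sub>0 + \<lambda>\<^sub>1) k h\<close>.\<close>

lemma iterate_near_start:
  assumes h: "small h" and i: "i \<in> {0, 1}"
    and near: "\<And>y. y \<in> {a..b} \<Longrightarrow> \<bar>y - x\<bar> \<le> d \<Longrightarrow> \<bar>\<phi> i y - A\<bar> \<le> e"
    and B: "\<And>j y. j \<in> {0, 1} \<Longrightarrow> y \<in> {a..b} \<Longrightarrow> \<bar>\<phi> j y\<bar> \<le> B" "\<bar>A\<bar> \<le> B" and e: "0 \<le> e"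
  shows "y \<in> {a..b} \<Longrightarrow> \<bar>y - x\<bar> + real k * h * speed \<le> d \<Longrightarrow>
    \<bar>(step h ^^ k) \<phi> i y - A\<bar> \<le> e + 2 * B * ((lam 0 + lam 1) * (real k * h))"
proof (induction k arbitrary: y)
  case 0
  then show ?case using near[of y] by simp
next
  case (Suc k)
  define y' where "y' = euler h i y"
  define p where "p = lam i * h"
  have h0: "0 \<le> h" using h by (simp add: small_def)
  have y': "y' \<in> {a..b}" unfolding y'_def by (rule euler_in[OF h i Suc.prems(1)])
  have "\<bar>y' - y\<bar> \<le> h * speed" unfolding y'_def by (rule euler_near[OF h0 Suc.prems(1) i])
  then have "\<bar>y' - x\<bar> + real k * h * speed \<le> d" using Suc.prems(2) by (simp add: algebra_simps)
  note IH = Suc.IH[OF y' this]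
  have j: "1 - i \<in> {0, 1}" by auto
  have other: "\<bar>(step h ^^ k) \<phi> (1 - i) y' - A\<bar> \<le> 2 * B"
    using iterate_bound[of h \<phi> B, OF h B(1) j y', where n = k] B(2) by linarith
  have p: "0 \<le> p" "p \<le> 1" using small_rate[OF h i] by (auto simp: p_def)
  have pl: "p \<le> (lam 0 + lam 1) * h"
    unfolding p_def using i lam_pos h0 by (intro mult_right_mono) auto
  have B0: "0 \<le> B" using B(2) by linarith
  let ?E = "e + 2 * B * ((lam 0 + lam 1) * (real k * h))"
  have E0: "0 \<le> ?E" using e B0 lam_pos h0 by (intro add_nonneg_nonneg mult_nonneg_nonneg) auto
  have "(step h ^^ Suc k) \<phi> i y - A = (1 - p) * ((step h ^^ k) \<phi> i y' - A) + p * ((step h ^^ k) \<phi> (1 - i) y' - A)"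
    by (simp add: step_def[of h _ i y] y'_def p_def algebra_simps)
  also have "\<bar>\<dots>\<bar> \<le> (1 - p) * ?E + p * (2 * B)"
    using IH other p by (intro order.trans[OF abs_triangle_ineq add_mono]) (auto simp: abs_mult intro!: mult_left_mono)
  also have "\<dots> \<le> 1 * ?E + ((lam 0 + lam 1) * h) * (2 * B)"
    using p pl E0 B0 by (intro add_mono mult_right_mono) auto
  also have "\<dots> = e + 2 * B * ((lam 0 + lam 1) * (real (Suc k) * h))" by (simp add: algebra_simps)
  finally show ?case .
qed

text \<open>With \<open>h = t / n\<close>, telescoping writes the increment of the \<open>n\<close>-th iterate as \<open>h\<close> times the
  sum of the \<open>k\<close>-th iterates, \<open>k < n\<close>, applied to \<open>diff_quotient h f\<close>. The difference quotient
  is close to the generator, and up to time \<open>t\<close> the iterates of \<open>step\<close> have hardly left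
  the starting point, so every summand is close to \<open>generator f f' i x\<close>.\<close>

lemma generator_estimate:
  assumes f: "\<And>i x. i \<in> {0, 1} \<Longrightarrow> (f i has_real_derivative f' i x) (at x)"
    and f': "\<And>i. i \<in> {0, 1} \<Longrightarrow> continuous_on UNIV (f' i)" and e: "e > 0"
  shows "\<exists>\<delta>>0. \<forall>t i x P. 0 < t \<longrightarrow> t < \<delta> \<longrightarrow> i \<in> {0, 1} \<longrightarrow> x \<in> {a..b} \<longrightarrow>
    ((\<lambda>n. (step (t / real n) ^^ n) f i x) \<longlonglongrightarrow> P) \<longrightarrow> \<bar>P - f i x - t * generator f f' i x\<bar> \<le> t * e"
proof -
  have cf: "continuous_on S (f i)" if "i \<in> {0, 1}" for i S
    by (rule DERIV_continuous_on[OF DERIV_subset[OF f[OF that]]]) auto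
  have cg: "continuous_on {a..b} (generator f f' i)" if "i \<in> {0, 1}" for i
    unfolding generator_def[abs_def] using that
    by (intro continuous_intros cont_u cf continuous_on_subset[OF f'[OF that]]) auto
  have "bounded (generator f f' 0 ` {a..b} \<union> generator f f' 1 ` {a..b})"
    by (auto intro!: compact_imp_bounded compact_continuous_image cg)
  then obtain G where G: "\<And>i x. i \<in> {0, 1} \<Longrightarrow> x \<in> {a..b} \<Longrightarrow> \<bar>generator f f' i x\<bar> \<le> G"
    unfolding bounded_iff by force
  define B where "B = G + e"
  define e1 where "e1 = e / 4"
  have e1: "e1 > 0" using e by (simp add: e1_def)
  have G0: "0 \<le> G" using G[of 0 a] ends by auto
  have "\<forall>\<^sub>F d in at_right 0. (\<forall>i\<in>{0, 1}. \<forall>x\<in>{a..b}. \<forall>y\<in>{a..b}. \<bar>x - y\<bar> \<le> d \<longrightarrow> \<bar>generator f f' i x - generator f f' i y\<bar> \<le> e1)"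
    using modulus_eventually[OF cg[of 0] e1] modulus_eventually[OF cg[of 1] e1]
    by simp (erule (1) eventually_elim2, blast)
  moreover have "\<forall>\<^sub>F d in at_right 0. 0 < (d :: real)" by (rule eventually_at_right_less)
  ultimately have "\<forall>\<^sub>F d in at_right 0. 0 < d \<and> (\<forall>i\<in>{0, 1}. \<forall>x\<in>{a..b}. \<forall>y\<in>{a..b}. \<bar>x - y\<bar> \<le> d \<longrightarrow> \<bar>generator f f' i x - generator f f' i y\<bar> \<le> e1)"
    by eventually_elim blast
  then have "\<exists>d. 0 < d \<and> (\<forall>i\<in>{0, 1}. \<forall>x\<in>{a..b}. \<forall>y\<in>{a..b}. \<bar>x - y\<bar> \<le> d \<longrightarrow> \<bar>generator f f' i x - generator f f' i y\<bar> \<le> e1)"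
    by (rule eventually_happens'[rotated]) (simp add: trivial_limit_at_right_real)
  then obtain d where d: "d > 0"
    "\<And>i x y. i \<in> {0, 1} \<Longrightarrow> x \<in> {a..b} \<Longrightarrow> y \<in> {a..b} \<Longrightarrow> \<bar>x - y\<bar> \<le> d \<Longrightarrow> \<bar>generator f f' i x - generator f f' i y\<bar> \<le> e1"
    by blast
  \<comment> \<open>Before time \<open>d / speed\<close> the position stays within \<open>d\<close>; the second bound makes the effect of switches at most \<open>e / 2\<close>.\<close>
  define \<delta> where "\<delta> = min (d / speed) (e / (4 * B * (lam 0 + lam 1)))"
  have B0: "B > 0" using G0 e by (simp add: B_def)
  have \<delta>: "\<delta> > 0" unfolding \<delta>_def using d(1) speed_pos e B0 lam_pos by simp
  show ?thesis
  proof (intro exI[of _ \<delta>] conjI allI impI \<delta>)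
    fix t :: real and i :: nat and x P
    assume t: "0 < t" "t < \<delta>" and i: "i \<in> {0, 1}" and x: "x \<in> {a..b}"
      and lim: "(\<lambda>n. (step (t / real n) ^^ n) f i x) \<longlonglongrightarrow> P"
    have td: "t * speed \<le> d" using t speed_pos by (simp add: \<delta>_def pos_less_divide_eq)
    have "t * (4 * B * (lam 0 + lam 1)) < e"
      using t B0 lam_pos by (simp add: \<delta>_def pos_less_divide_eq)
    then have tB: "2 * B * ((lam 0 + lam 1) * t) \<le> e / 2" by (simp add: algebra_simps)
    have hn: "filterlim (\<lambda>n. t / real n) (at_right 0) sequentially"
      unfolding filterlim_at using lim_const_over_n[of t] t(1)
      by (auto intro!: eventually_mono[OF eventually_gt_at_top[of 0]])
    have q: "\<forall>\<^sub>F n in sequentially. \<forall>i\<in>{0, 1}. \<forall>x\<in>{a..b}. \<bar>diff_quotient (t / real n) f i x - generator f f' i x\<bar> \<le> e1"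
      using filterlim_iff[THEN iffD1, OF hn, rule_format, OF diff_quotient_near_generator[OF f f' e1]] .
    have "\<forall>\<^sub>F n in sequentially. \<bar>(step (t / real n) ^^ n) f i x - f i x - t * generator f f' i x\<bar> \<le> t * e"
      using q small_eventually[OF less_imp_le[OF t(1)]] eventually_gt_at_top[of 0]
    proof eventually_elim
      case (elim n)
      define h where "h = t / real n"
      have h: "h > 0" "real n * h = t" using elim(3) t by (auto simp: h_def)
      have qb: "\<bar>diff_quotient h f j y\<bar> \<le> B" if "j \<in> {0, 1}" "y \<in> {a..b}" for j y
      proof -
        have "\<bar>diff_quotient h f j y - generator f f' j y\<bar> \<le> e1" using elim(1) that unfolding h_def by blast
        with G[OF that] e show ?thesis unfolding B_def e1_def by linarith
      qed
      have near_k: "\<bar>(step h ^^ k) (diff_quotient h f) i x - generator f f' i x\<bar> \<le> e" if k: "k < n" for k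
      proof -
        have kt: "real k * h \<le> t" unfolding h(2)[symmetric] using k h(1) by (intro mult_right_mono) auto
        have "\<bar>(step h ^^ k) (diff_quotient h f) i x - generator f f' i x\<bar> \<le> 2 * e1 + 2 * B * ((lam 0 + lam 1) * (real k * h))"
        proof (rule iterate_near_start[where x = x and d = d])
          show "small h" using elim(2) by (simp add: h_def)
          show "\<bar>diff_quotient h f i y - generator f f' i x\<bar> \<le> 2 * e1" if "y \<in> {a..b}" "\<bar>y - x\<bar> \<le> d" for y
          proof -
            have "\<bar>diff_quotient h f i y - generator f f' i y\<bar> \<le> e1" using elim(1) i that(1) unfolding h_def by blast
            with d(2)[OF i that(1) x that(2)] show ?thesis by linarith
          qed
          show "\<bar>generator f f' i x\<bar> \<le> B" using G[OF i x] e by (simp add: B_def)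
          have "real k * h * speed \<le> t * speed" using kt speed_pos by (intro mult_right_mono) auto
          then show "\<bar>x - x\<bar> + real k * h * speed \<le> d" using td by simp
        qed (use qb i x e1 in auto)
        also have "\<dots> \<le> 2 * e1 + 2 * B * ((lam 0 + lam 1) * t)"
          using kt B0 lam_pos by (intro add_left_mono mult_left_mono) auto
        finally show ?thesis using tB by (simp add: e1_def)
      qed
      have "(step h ^^ n) f i x - f i x - t * generator f f' i x
          = h * (\<Sum>k<n. (step h ^^ k) (diff_quotient h f) i x - generator f f' i x)"
        using iterate_telescope[of h n f i x] h
        by (simp add: sum_subtractf algebra_simps h(2)[symmetric])
      also have "\<bar>\<dots>\<bar> \<le> h * (real n * e)"
      proof -
        have "\<bar>\<Sum>k<n. (step h ^^ k) (diff_quotient h f) i x - generator f f' i x\<bar> \<le> (\<Sum>k<n. e)"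
          using near_k by (intro order.trans[OF sum_abs sum_mono]) auto
        then show ?thesis using h(1) by (simp add: abs_mult)
      qed
      also have "\<dots> = (real n * h) * e" by (simp only: mult_ac)
      also have "\<dots> = t * e" by (simp only: h(2))
      finally show ?case by (simp add: h_def)
    qed
    note ev = this
    have "(\<lambda>n. \<bar>(step (t / real n) ^^ n) f i x - f i x - t * generator f f' i x\<bar>) \<longlonglongrightarrow> \<bar>P - f i x - t * generator f f' i x\<bar>"
      by (intro tendsto_intros lim)
    then show "\<bar>P - f i x - t * generator f f' i x\<bar> \<le> t * e"
      by (rule tendsto_upperbound[OF _ ev]) simp
  qed
qed

end

section \<open>Uniqueness\<close>

text \<open>The interval is open, so that \<open>j\<close> vanishes also at its endpoints and integrals of \<open>j\<close> beyond
  them are \<open>0\<close>.\<close>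

definition supported :: "real \<Rightarrow> real \<Rightarrow> (real \<Rightarrow> real) \<Rightarrow> bool" where
  "supported s t j \<longleftrightarrow> continuous_on UNIV j \<and> (\<forall>x. x \<notin> {s<..<t} \<longrightarrow> j x = 0)"

lemma supported_mono: "supported s t j \<Longrightarrow> s' \<le> s \<Longrightarrow> t \<le> t' \<Longrightarrow> supported s' t' j"
  unfolding supported_def by auto

lemma supported_bounded:
  assumes "supported s t j" obtains B where "\<And>x. \<bar>j x\<bar> \<le> B"
proof -
  have "bounded (j ` {s..t})"
    using assms unfolding supported_def
    by (intro compact_imp_bounded compact_continuous_image) (auto intro: continuous_on_subset)
  then obtain B where B: "B > 0" "\<And>x. x \<in> {s..t} \<Longrightarrow> \<bar>j x\<bar> \<le> B"
    unfolding bounded_pos by auto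
  have "\<bar>j x\<bar> \<le> B" for x
  proof (cases "x \<in> {s..t}")
    case False
    then have "j x = 0" using assms unfolding supported_def by auto
    with B(1) show ?thesis by simp
  qed (use B in auto)
  with that show thesis .
qed

lemma supported_mult:
  assumes j: "supported s t j" and "continuous_on {a<..<b} \<phi>" "a < s" "t < b"
  shows "supported s t (\<lambda>x. j x * \<phi> x)"
proof -
  have "isCont (\<lambda>x. j x * \<phi> x) x" for x
  proof (cases "x \<in> {a<..<b}")
    case True
    then have "isCont \<phi> x" using assms(2) by (simp add: continuous_on_eq_continuous_at)
    moreover have "isCont j x" using j by (simp add: supported_def continuous_on_eq_continuous_at)
    ultimately show ?thesis by simp
  next
    case False
    then have "x \<in> - {s..t}" using assms(3,4) by auto
    then have "\<forall>\<^sub>F y in nhds x. y \<in> - {s..t}" by (intro eventually_nhds_in_open) auto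
    then have "\<forall>\<^sub>F y in nhds x. j y * \<phi> y = 0"
      by eventually_elim (use j in \<open>auto simp: supported_def\<close>)
    then have "isCont (\<lambda>x. j x * \<phi> x) x \<longleftrightarrow> isCont (\<lambda>_. 0 :: real) x" by (rule isCont_cong)
    then show ?thesis by simp
  qed
  then show ?thesis using j by (simp add: supported_def continuous_at_imp_continuous_on)
qed

lemma supported_linear:
  "supported s t j \<Longrightarrow> supported s t k \<Longrightarrow> supported s t (\<lambda>x. p * j x - q * k x)"
  unfolding supported_def by (auto intro!: continuous_intros)

lemma supported_antiderivative:
  assumes k: "supported s t k" and st: "s \<le> t"
  obtains g B where "\<And>x. (g has_real_derivative k x) (at x)" "\<And>x. x \<le> s \<Longrightarrow> g x = 0"
    "\<And>x. t \<le> x \<Longrightarrow> g x = integral {s..t} k" "\<And>x. \<bar>g x\<bar> \<le> B"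
proof -
  have ck: "continuous_on UNIV k" and k0: "\<And>x. x \<notin> {s<..<t} \<Longrightarrow> k x = 0" using k by (auto simp: supported_def)
  obtain g0 where g0: "\<And>x. (g0 has_real_derivative k x) (at x)"
    using einterval_antiderivative[of "-\<infinity>" "\<infinity>" k] ck
    by (auto simp: continuous_on_eq_continuous_at has_real_derivative_iff_has_vector_derivative)
  define g where "g x = g0 x - g0 s" for x
  have g: "(g has_real_derivative k x) (at x)" for x
    unfolding g_def[abs_def] by (auto intro!: derivative_eq_intros g0)
  have FTC: "(k has_integral (g y - g x)) {x..y}" if "x \<le> y" for x y
    using g by (intro fundamental_theorem_of_calculus[OF that])
      (auto simp: has_real_derivative_iff_has_vector_derivative[symmetric] intro: DERIV_subset)
  have left: "g x = 0" if "x \<le> s" for x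
  proof -
    have "(k has_integral 0) {x..s}" by (rule has_integral_is_0) (auto simp: k0)
    from has_integral_unique[OF this FTC[OF that]] show ?thesis by (simp add: g_def)
  qed
  have gt: "g t = integral {s..t} k" using integral_unique[OF FTC[OF st]] left[of s] by simp
  have right: "g x = integral {s..t} k" if "t \<le> x" for x
  proof -
    have "(k has_integral 0) {t..x}" by (rule has_integral_is_0) (auto simp: k0)
    from has_integral_unique[OF this FTC[OF that]] show ?thesis by (simp add: gt)
  qed
  have "continuous_on {s..t} g" by (rule DERIV_continuous_on[OF DERIV_subset[OF g]]) auto
  then have "bounded (g ` {s..t})" by (intro compact_imp_bounded compact_continuous_image) auto
  then obtain B where "\<forall>y\<in>g ` {s..t}. norm y \<le> B" unfolding bounded_iff by blast
  then have B: "\<bar>g x\<bar> \<le> B" if "x \<in> {s..t}" for x using that by simp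
  have "\<bar>g x\<bar> \<le> B" for x
  proof -
    consider "x \<le> s" | "x \<in> {s..t}" | "t \<le> x" by force
    then show ?thesis
    proof cases
      case 1 then show ?thesis using left[of x] left[of s] B[of s] st by auto
    next
      case 3 then show ?thesis using right[of x] right[of t] B[of t] st by auto
    qed (use B in auto)
  qed
  with that[of g B] g left right show thesis by blast
qed

locale invariant_law = switched_flow +
  fixes \<mu> :: "(real \<times> nat) measure"
  assumes prob_\<mu>: "prob_space \<mu>" and sets_\<mu>: "sets \<mu> = sets state_space"
    and inside: "AE z in \<mu>. fst z \<in> {a<..<b}"
    and invariant: "t \<ge> 0 \<Longrightarrow> \<mu> \<bind> inner_kernel t = \<mu>"
begin

text \<open>Bounds are required on \<open>(a, b)\<close> only, because \<open>generator f f'\<close> need not be bounded elsewhere.\<close>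

definition admissible :: "(nat \<Rightarrow> real \<Rightarrow> real) \<Rightarrow> bool" where
  "admissible f \<longleftrightarrow> (\<forall>i\<in>{0, 1}. f i \<in> borel_measurable borel) \<and> (\<exists>F. \<forall>i\<in>{0, 1}. \<forall>x\<in>{a<..<b}. \<bar>f i x\<bar> \<le> F)"

definition mean :: "(nat \<Rightarrow> real \<Rightarrow> real) \<Rightarrow> real" where
  "mean f = (\<integral>z. f (snd z) (fst z) \<partial>\<mu>)"

lemma space_\<mu>: "space \<mu> = UNIV \<times> {0, 1}"
  using sets_eq_imp_space_eq[OF sets_\<mu>] by (simp add: space_state_space)

lemma AE_\<mu>: "(\<And>i x. i \<in> {0, 1} \<Longrightarrow> x \<in> {a<..<b} \<Longrightarrow> P i x) \<Longrightarrow> AE z in \<mu>. P (snd z) (fst z)"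
  using inside AE_space by eventually_elim (auto simp: space_\<mu>)

lemma admissible_measurable: "admissible f \<Longrightarrow> (\<lambda>z. f (snd z) (fst z)) \<in> borel_measurable \<mu>"
  unfolding measurable_from_state_space[OF sets_\<mu>] admissible_def by (intro state_measurable) auto

lemma admissible_integrable: 
  assumes "admissible f" shows "integrable \<mu> (\<lambda>z. f (snd z) (fst z))"
proof -
  interpret prob_space \<mu> by (rule prob_\<mu>)
  obtain F where "\<And>i x. i \<in> {0, 1} \<Longrightarrow> x \<in> {a<..<b} \<Longrightarrow> \<bar>f i x\<bar> \<le> F"
    using assms unfolding admissible_def by blast
  then have "AE z in \<mu>. norm (f (snd z) (fst z)) \<le> F"
    unfolding real_norm_def by (rule AE_\<mu>)
  then show ?thesis by (rule integrable_const_bound[OF _ admissible_measurable[OF assms]])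
qed

lemma mean_cong:
  assumes "admissible f" "admissible g" "\<And>i x. i \<in> {0, 1} \<Longrightarrow> x \<in> {a<..<b} \<Longrightarrow> f i x = g i x"
  shows "mean f = mean g"
  unfolding mean_def using assms by (intro integral_cong_AE admissible_measurable AE_\<mu>) auto

lemma mean_linear:
  assumes "admissible f" "admissible g"
  shows "mean (\<lambda>i x. p * f i x - q * g i x) = p * mean f - q * mean g"
  unfolding mean_def using assms[THEN admissible_integrable] by simp

lemma admissible_linear:
  assumes "admissible f" "admissible g"
  shows "admissible (\<lambda>i x. p * f i x - q * g i x)"
proof -
  obtain F G where F: "\<And>i x. i \<in> {0, 1} \<Longrightarrow> x \<in> {a<..<b} \<Longrightarrow> \<bar>f i x\<bar> \<le> F"
    and G: "\<And>i x. i \<in> {0, 1} \<Longrightarrow> x \<in> {a<..<b} \<Longrightarrow> \<bar>g i x\<bar> \<le> G"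
    using assms unfolding admissible_def by blast
  have "\<bar>p * f i x - q * g i x\<bar> \<le> \<bar>p\<bar> * F + \<bar>q\<bar> * G" if "i \<in> {0, 1}" "x \<in> {a<..<b}" for i x
    using F[OF that] G[OF that]
    by (intro order.trans[OF abs_triangle_ineq4 add_mono]) (auto simp: abs_mult intro!: mult_left_mono)
  then have "\<exists>B. \<forall>i\<in>{0, 1}. \<forall>x\<in>{a<..<b}. \<bar>p * f i x - q * g i x\<bar> \<le> B" by blast
  moreover have "(\<lambda>x. p * f i x - q * g i x) \<in> borel_measurable borel" if "i \<in> {0, 1}" for i
    using assms that unfolding admissible_def by (intro borel_measurable_diff borel_measurable_times) auto
  ultimately show ?thesis unfolding admissible_def by blast
qed

lemma mean_limit:
  assumes f: "\<And>n. admissible (f n)" and g: "admissible g"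
    and F: "\<And>n i x. i \<in> {0, 1} \<Longrightarrow> x \<in> {a<..<b} \<Longrightarrow> \<bar>f n i x\<bar> \<le> F"
    and lim: "\<And>i x. i \<in> {0, 1} \<Longrightarrow> x \<in> {a<..<b} \<Longrightarrow> (\<lambda>n. f n i x) \<longlonglongrightarrow> g i x"
  shows "(\<lambda>n. mean (f n)) \<longlonglongrightarrow> mean g"
proof -
  interpret prob_space \<mu> by (rule prob_\<mu>)
  show ?thesis unfolding mean_def
  proof (rule integral_dominated_convergence[where w = "\<lambda>_. F"])
    show "AE z in \<mu>. norm (f n (snd z) (fst z)) \<le> F" for n
      unfolding real_norm_def using F by (rule AE_\<mu>)
    show "AE z in \<mu>. (\<lambda>n. f n (snd z) (fst z)) \<longlonglongrightarrow> g (snd z) (fst z)"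
      using lim by (rule AE_\<mu>)
  qed (use admissible_measurable[OF f] admissible_measurable[OF g] in auto)
qed

text \<open>An invariant law gives \<open>f\<close> and its image under the transition operator at time \<open>t\<close> the same
  mean. By \<open>generator_estimate\<close> their difference is \<open>t * generator f f'\<close> up to \<open>t * e\<close>.\<close>

lemma weak_stationarity:
  assumes f: "\<And>i x. i \<in> {0, 1} \<Longrightarrow> (f i has_real_derivative f' i x) (at x)"
    and f': "\<And>i. i \<in> {0, 1} \<Longrightarrow> continuous_on UNIV (f' i)" and F: "\<And>i x. i \<in> {0, 1} \<Longrightarrow> \<bar>f i x\<bar> \<le> F"
  shows "admissible (generator f f')" "mean (generator f f') = 0"
proof -
  interpret prob_space \<mu> by (rule prob_\<mu>)
  have tf: "test_function f" unfolding test_function_def using f f' F by blast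
  have cf: "continuous_on S (f i)" if "i \<in> {0, 1}" for i S
    by (rule DERIV_continuous_on[OF DERIV_subset[OF f[OF that]]]) auto
  have cg: "continuous_on UNIV (generator f f' i)" if "i \<in> {0, 1}" for i
    unfolding generator_def[abs_def] using that by (intro continuous_intros cont_u cf f') auto
  have "bounded (generator f f' 0 ` {a..b} \<union> generator f f' 1 ` {a..b})"
    by (auto intro!: compact_imp_bounded compact_continuous_image continuous_on_subset[OF cg])
  then obtain G where "\<And>i x. i \<in> {0, 1} \<Longrightarrow> x \<in> {a..b} \<Longrightarrow> \<bar>generator f f' i x\<bar> \<le> G"
    unfolding bounded_iff by force
  then have "\<forall>i\<in>{0, 1}. \<forall>x\<in>{a<..<b}. \<bar>generator f f' i x\<bar> \<le> G" by auto
  with cg show adm: "admissible (generator f f')"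
    unfolding admissible_def by (blast intro: borel_measurable_continuous_onI)
  have adf: "admissible f" unfolding admissible_def using test_function_D(2)[OF tf] F by blast
  have small: "\<bar>mean (generator f f')\<bar> \<le> e" if e: "e > 0" for e
  proof -
    obtain \<delta> where \<delta>: "\<delta> > 0" "\<And>t i x P. 0 < t \<Longrightarrow> t < \<delta> \<Longrightarrow> i \<in> {0, 1} \<Longrightarrow> x \<in> {a..b} \<Longrightarrow>
      (\<lambda>n. (step (t / real n) ^^ n) f i x) \<longlonglongrightarrow> P \<Longrightarrow> \<bar>P - f i x - t * generator f f' i x\<bar> \<le> t * e"
      using generator_estimate[of f f', OF f f' e] by blast
    define t where "t = \<delta> / 2"
    have t: "0 < t" "t < \<delta>" "0 \<le> t" using \<delta>(1) by (auto simp: t_def)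
    define P where "P i x = (if x \<in> {a<..<b} then transition_operator t f i x else f 0 a)" for i x
    have adP: "admissible P"
    proof -
      have "P i \<in> borel_measurable borel" if "i \<in> {0, 1}" for i
        unfolding P_def[abs_def] by (rule transition_operator_measurable[OF tf that t(3)])
      moreover have "\<bar>P i x\<bar> \<le> F" if "i \<in> {0, 1}" "x \<in> {a<..<b}" for i x
        using transition_operator_bound[OF F tf that t(3)] that(2) by (simp add: P_def)
      ultimately show ?thesis unfolding admissible_def by blast
    qed
    have "mean P = mean f"
      using integral_bind_inner_kernel[OF prob_\<mu> sets_\<mu> tf t(3)]
      unfolding invariant[OF t(3)] mean_def P_def by simp
    then have "mean (\<lambda>i x. 1 * (1 * P i x - 1 * f i x) - t * generator f f' i x) = - (t * mean (generator f f'))"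
      using mean_linear[OF adP adf, of 1 1]
      unfolding mean_linear[OF admissible_linear[OF adP adf] adm] by simp
    moreover have "\<bar>mean (\<lambda>i x. 1 * (1 * P i x - 1 * f i x) - t * generator f f' i x)\<bar> \<le> t * e"
    proof -
      have int: "integrable \<mu> (\<lambda>z. 1 * (1 * P (snd z) (fst z) - 1 * f (snd z) (fst z)) - t * generator f f' (snd z) (fst z))"
        using adP adf adm by (intro Bochner_Integration.integrable_diff integrable_mult_right admissible_integrable)
      have "AE z in \<mu>. \<bar>1 * (1 * P (snd z) (fst z) - 1 * f (snd z) (fst z)) - t * generator f f' (snd z) (fst z)\<bar> \<le> t * e"
      proof (rule AE_\<mu>)
        fix i :: nat and x assume i: "i \<in> {0, 1}" and x: "x \<in> {a<..<b}"
        have "x \<in> {a..b}" using x by auto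
        then show "\<bar>1 * (1 * P i x - 1 * f i x) - t * generator f f' i x\<bar> \<le> t * e"
          using \<delta>(2)[OF t(1,2) i _ transition_operator_limit[OF tf i x t(3)]] x by (simp add: P_def)
      qed
      then have "(\<integral>z. \<bar>1 * (1 * P (snd z) (fst z) - 1 * f (snd z) (fst z)) - t * generator f f' (snd z) (fst z)\<bar> \<partial>\<mu>) \<le> (\<integral>z. t * e \<partial>\<mu>)"
        using int by (intro integral_mono_AE) auto
      then show ?thesis
        unfolding mean_def prob_space lebesgue_integral_const
        by (intro order.trans[OF integral_abs_bound]) (simp add: prob_space)
    qed
    ultimately have "t * \<bar>mean (generator f f')\<bar> \<le> t * e" using t(1) by (simp add: abs_mult)
    then show ?thesis using t(1) by simp
  qed
  have "\<bar>mean (generator f f')\<bar> \<le> 0"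
    by (rule field_le_epsilon) (use small in simp)
  then show "mean (generator f f') = 0" by simp
qed

lemma supported_admissible:
  assumes "supported s t j" "supported s t k"
  shows "admissible (\<lambda>i x. if i = 0 then j x else k x)"
proof -
  obtain B C where "\<And>x. \<bar>j x\<bar> \<le> B" "\<And>x. \<bar>k x\<bar> \<le> C"
    using supported_bounded[OF assms(1)] supported_bounded[OF assms(2)] by metis
  then have "\<forall>i\<in>{0, 1 :: nat}. \<forall>x\<in>{a<..<b}. \<bar>if i = 0 then j x else k x\<bar> \<le> max B C"
    by (auto simp: le_max_iff_disj)
  moreover have "j \<in> borel_measurable borel" "k \<in> borel_measurable borel"
    using assms by (auto simp: supported_def intro: borel_measurable_continuous_onI)
  ultimately show ?thesis unfolding admissible_def by auto
qed

lemma supported_zero: "supported s t (\<lambda>_. 0)"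
  by (simp add: supported_def)

lemma cont_inverse_drift:
  "continuous_on {a<..<b} (\<lambda>x. 1 / (c 0 - u x))" "continuous_on {a<..<b} (\<lambda>x. 1 / (c 1 - u x))"
  "continuous_on {a<..<b} (\<lambda>x. 1 / flux x)"
  using u_strict flux_pos by (intro continuous_intros cont_u cont_flux; force)+

text \<open>Test functions independent of the state: the probability fluxes of the two states
  cancel.\<close>

lemma flux_balance:
  assumes k: "supported s t k" and st: "a < s" "s \<le> t" "t < b"
  shows "mean (\<lambda>i x. if i = 0 then (c 0 - u x) * k x else (c 1 - u x) * k x) = 0"
proof -
  obtain g B where g: "\<And>x. (g has_real_derivative k x) (at x)" "\<And>x. \<bar>g x\<bar> \<le> B"
    using supported_antiderivative[OF k st(2)] by metis
  have ck: "continuous_on UNIV k" using k by (simp add: supported_def)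
  have s: "supported s t (\<lambda>x. (c i - u x) * k x)" for i
    using k by (auto simp: supported_def intro!: continuous_intros cont_u)
  have "mean (generator (\<lambda>_. g) (\<lambda>_. k)) = 0" by (rule weak_stationarity(2)[OF g(1) ck g(2)])
  moreover have "mean (\<lambda>i x. if i = 0 then (c 0 - u x) * k x else (c 1 - u x) * k x) = mean (generator (\<lambda>_. g) (\<lambda>_. k))"
    by (rule mean_cong[OF supported_admissible[OF s s] weak_stationarity(1)[OF g(1) ck g(2)]]) (auto simp: generator_def)
  ultimately show ?thesis by simp
qed

text \<open>The test function \<open>H / flux\<close> in state \<open>0\<close> only; \<open>1 / flux\<close> is the integrating factor of the
  stationary equation, so that all terms without \<open>H'\<close> cancel once \<open>flux_balance\<close> has
  replaced the mass in state \<open>1\<close> by mass in state \<open>0\<close>.\<close>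

lemma integrating_factor:
  assumes H: "\<And>x. (H has_real_derivative H' x) (at x)" and sH: "supported s t H" "supported s t H'"
    and st: "a < s" "s \<le> t" "t < b"
  shows "mean (\<lambda>i x. if i = 0 then H' x * (1 / weight 0 x) else 0) = 0"
proof -
  define vd where "vd x = lam 1 * weight 1 x - lam 0 * weight 0 x" for x
  define g where "g x = H x * (1 / flux x)" for x
  define g' where "g' x = H' x * (1 / flux x) - H x * (vd x * (1 / flux x) * (1 / flux x))" for x
  have cw: "continuous_on {a<..<b} (weight i)" if "i \<in> {0, 1}" for i
    unfolding weight_def[abs_def] using u_strict that by (intro continuous_intros cont_u cont_flux) force
  have cvd: "continuous_on {a<..<b} (\<lambda>x. vd x * (1 / flux x) * (1 / flux x))"
    unfolding vd_def by (intro continuous_on_mult continuous_on_diff continuous_on_const cw cont_inverse_drift) auto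
  have sg: "supported s t g" unfolding g_def[abs_def]
    by (rule supported_mult[OF sH(1) cont_inverse_drift(3) st(1,3)])
  have sg': "supported s t g'"
    using supported_linear[OF supported_mult[OF sH(2) cont_inverse_drift(3) st(1,3)] supported_mult[OF sH(1) cvd st(1,3)], of 1 1]
    by (simp add: g'_def[abs_def])
  have dg: "(g has_real_derivative g' x) (at x)" for x
  proof (cases "x \<in> {a<..<b}")
    case True
    have nz: "flux x \<noteq> 0" using flux_pos[OF True] by simp
    have "((\<lambda>x. H x / flux x) has_real_derivative (H' x * flux x - H x * vd x) / (flux x * flux x)) (at x)"
      unfolding vd_def by (rule DERIV_divide[OF H flux_deriv[OF True] nz])
    moreover have "(H' x * flux x - H x * vd x) / (flux x * flux x) = g' x"
      using nz by (simp add: g'_def field_simps)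
    ultimately show ?thesis by (simp add: g_def[abs_def])
  next
    case False
    then have x: "x \<in> - {s..t}" using st by auto
    then have "g' x = 0" using sg' by (auto simp: supported_def)
    moreover have "((\<lambda>_. 0) has_real_derivative 0) (at x)" by simp
    then have "(g has_real_derivative 0) (at x)"
      by (rule has_field_derivative_transform_within_open[of _ _ _ "- {s..t}"]) (use x sg in \<open>auto simp: supported_def\<close>)
    ultimately show ?thesis by simp
  qed
  obtain B where B: "\<And>x. \<bar>g x\<bar> \<le> B" using supported_bounded[OF sg] by metis
  have B0: "0 \<le> B" using B[of 0] by linarith
  define f where "f i = (if i = 0 then g else (\<lambda>_. 0))" for i :: nat
  define f' where "f' i = (if i = 0 then g' else (\<lambda>_. 0))" for i :: nat
  have W: "(f i has_real_derivative f' i x) (at x)" "continuous_on UNIV (f' i)" "\<bar>f i x\<bar> \<le> B" for i x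
    using dg sg' B B0 by (auto simp: f_def f'_def supported_def)
  note weak = weak_stationarity[of f f' B, OF W]
  define k where "k x = g x * (1 / (c 1 - u x))" for x
  have sk: "supported s t k" unfolding k_def[abs_def]
    by (rule supported_mult[OF sg cont_inverse_drift(2) st(1,3)])
  have sdk: "supported s t (\<lambda>x. (c i - u x) * k x)" for i
    using sk by (auto simp: supported_def intro!: continuous_intros cont_u)
  note bal = flux_balance[OF sk st]
  have "supported s t (\<lambda>x. H' x * (1 / weight 0 x))"
  proof (rule supported_mult[OF sH(2) _ st(1,3)])
    have "weight 0 x \<noteq> 0" if "x \<in> {a<..<b}" for x
      using flux_pos[OF that] u_strict[OF that] by (simp add: weight_def)
    then show "continuous_on {a<..<b} (\<lambda>x. 1 / weight 0 x)"
      using cw[of 0] by (intro continuous_intros) auto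
  qed
  then have ad1: "admissible (\<lambda>i x. if i = 0 then H' x * (1 / weight 0 x) else 0)"
    using supported_zero by (rule supported_admissible)
  have ad2: "admissible (\<lambda>i x. if i = 0 then (c 0 - u x) * k x else (c 1 - u x) * k x)"
    by (rule supported_admissible[OF sdk sdk])
  have ad3: "admissible (\<lambda>i x. 1 * generator f f' i x - lam 1 * (if i = 0 then (c 0 - u x) * k x else (c 1 - u x) * k x))"
    by (rule admissible_linear[OF weak(1) ad2])
  have "mean (\<lambda>i x. if i = 0 then H' x * (1 / weight 0 x) else 0)
      = mean (\<lambda>i x. 1 * generator f f' i x - lam 1 * (if i = 0 then (c 0 - u x) * k x else (c 1 - u x) * k x))"
  proof (rule mean_cong[OF ad1 ad3])
    fix i :: nat and x assume i: "i \<in> {0, 1}" and x: "x \<in> {a<..<b}"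
    have nz: "flux x \<noteq> 0" "c 0 - u x \<noteq> 0" "c 1 - u x \<noteq> 0" using flux_pos[OF x] u_strict[OF x] by auto
    have w: "weight 0 x = flux x / (c 0 - u x)" "weight 1 x = - (flux x / (c 1 - u x))"
      using u_strict[OF x] by (auto simp: weight_def minus_divide_right)
    have vd: "vd x * (1 / flux x) * (1 / flux x) = - (lam 1 / (c 1 - u x) + lam 0 / (c 0 - u x)) * (1 / flux x)"
    proof -
      have "vd x = - (lam 1 / (c 1 - u x) + lam 0 / (c 0 - u x)) * flux x"
        unfolding vd_def w by (simp add: left_diff_distrib)
      then show ?thesis using nz(1) by simp
    qed
    show "(if i = 0 then H' x * (1 / weight 0 x) else 0)
      = 1 * generator f f' i x - lam 1 * (if i = 0 then (c 0 - u x) * k x else (c 1 - u x) * k x)"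
    proof (cases "i = 0")
      case True
      have "(c 0 - u x) * g' x - lam 0 * g x - lam 1 * ((c 0 - u x) * k x) = H' x * (1 / weight 0 x)"
        unfolding g'_def vd k_def g_def w(1) using nz by (simp add: divide_simps) (simp add: algebra_simps)
      then show ?thesis using True by (simp add: generator_def f_def f'_def)
    next
      case False
      with i have "i = 1" by simp
      then show ?thesis using nz by (simp add: generator_def f_def f'_def k_def)
    qed
  qed
  also have "\<dots> = 0" unfolding mean_linear[OF weak(1) ad2] weak(2) bal by simp
  finally show ?thesis .
qed

text \<open>The constants in \<open>H' = (\<beta> j - \<alpha> j') weight 0\<close> are chosen such that its integral is \<open>0\<close>; this is
  what makes an antiderivative \<open>H\<close> compactly supported and \<open>integrating_factor\<close> applicable.\<close>

lemma proportional:
  assumes j: "supported s t j" "supported s t j'" and st: "a < s" "s \<le> t" "t < b"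
  shows "(\<integral>x. j' x * weight 0 x \<partial>lborel) * mean (\<lambda>i x. if i = 0 then j x else 0)
    = (\<integral>x. j x * weight 0 x \<partial>lborel) * mean (\<lambda>i x. if i = 0 then j' x else 0)"
proof -
  define \<alpha> where "\<alpha> = (\<integral>x. j x * weight 0 x \<partial>lborel)"
  define \<beta> where "\<beta> = (\<integral>x. j' x * weight 0 x \<partial>lborel)"
  define q where "q x = \<beta> * j x - \<alpha> * j' x" for x
  have sq: "supported s t q" unfolding q_def[abs_def] by (rule supported_linear[OF j])
  have cw: "continuous_on {a<..<b} (weight 0)"
    unfolding weight_def[abs_def] using u_strict by (intro continuous_intros cont_u cont_flux) force
  have sH': "supported s t (\<lambda>x. q x * weight 0 x)" by (rule supported_mult[OF sq cw st(1,3)])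
  obtain H where H: "\<And>x. (H has_real_derivative q x * weight 0 x) (at x)" "\<And>x. x \<le> s \<Longrightarrow> H x = 0"
    "\<And>x. t \<le> x \<Longrightarrow> H x = integral {s..t} (\<lambda>x. q x * weight 0 x)"
    using supported_antiderivative[OF sH' st(2)] by metis
  have int: "integrable lborel (\<lambda>x. k x * weight 0 x)" if k: "supported s t k" for k
  proof -
    obtain B where B: "\<And>x. \<bar>k x\<bar> \<le> B" using supported_bounded[OF k] by metis
    have "k \<in> borel_measurable borel" using k by (simp add: supported_def borel_measurable_continuous_onI)
    then show ?thesis by (rule weight_mult_integrable(1)[OF _ B]) simp
  qed
  have "integral {s..t} (\<lambda>x. q x * weight 0 x) = integral {a..b} (\<lambda>x. q x * weight 0 x)"
  proof -
    have "(\<lambda>x. if x \<in> {s..t} then q x * weight 0 x else 0) = (\<lambda>x. q x * weight 0 x)"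
      using sq by (force simp: supported_def fun_eq_iff)
    then show ?thesis
      using integral_restrict_Int[of "{a..b}" "{s..t}" "\<lambda>x. q x * weight 0 x"] st by (simp add: Int_absorb2)
  qed
  also have "\<dots> = (\<integral>x. q x * weight 0 x \<partial>lborel)"
    by (rule integral_lborel_eq[OF int[OF sq], symmetric]) (auto simp: weight_outside)
  also have "\<dots> = (\<integral>x. \<beta> * (j x * weight 0 x) - \<alpha> * (j' x * weight 0 x) \<partial>lborel)"
    by (simp add: q_def left_diff_distrib mult.assoc)
  also have "\<dots> = \<beta> * \<alpha> - \<alpha> * \<beta>"
    using int[OF j(1)] int[OF j(2)] by (simp add: \<alpha>_def \<beta>_def)
  finally have "integral {s..t} (\<lambda>x. q x * weight 0 x) = 0" by simp
  with H have sH: "supported s t H"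
    unfolding supported_def by (auto intro!: DERIV_continuous_on[OF DERIV_subset[OF H(1)]] simp: not_less)
  have ad: "admissible (\<lambda>i x. if i = 0 then k x else 0)" if "supported s t k" for k
    by (rule supported_admissible[OF that supported_zero])
  have w: "weight 0 x \<noteq> 0" if "x \<in> {a<..<b}" for x
    using flux_pos[OF that] u_strict[OF that] by (simp add: weight_def)
  have sr: "supported s t (\<lambda>x. q x * weight 0 x * (1 / weight 0 x))"
    using w by (intro supported_mult[OF sH' _ st(1,3)] continuous_intros cw) auto
  have "mean (\<lambda>i x. if i = 0 then q x else 0) = mean (\<lambda>i x. if i = 0 then q x * weight 0 x * (1 / weight 0 x) else 0)"
    by (rule mean_cong[OF ad[OF sq] ad[OF sr]]) (use w in auto)
  also have "\<dots> = 0" by (rule integrating_factor[OF H(1) sH sH' st])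
  finally have "mean (\<lambda>i x. if i = 0 then q x else 0) = 0" .
  moreover have "(\<lambda>i x. if i = 0 then q x else 0)
      = (\<lambda>(i::nat) x. \<beta> * (if i = 0 then j x else 0) - \<alpha> * (if i = 0 then j' x else 0))"
    by (auto simp: fun_eq_iff q_def)
  ultimately show ?thesis using mean_linear[OF ad[OF j(1)] ad[OF j(2)], of \<beta> \<alpha>] by (simp add: \<alpha>_def \<beta>_def)
qed

definition cutoff :: "nat \<Rightarrow> real \<Rightarrow> real" where
  "cutoff n x = min 1 (max 0 (real (Suc n) * min (x - a) (b - x) - 1))"

lemma cutoff_range: "0 \<le> cutoff n x" "cutoff n x \<le> 1"
  by (auto simp: cutoff_def)

lemma cutoff_supported:
  obtains s t where "a < s" "s < t" "t < b" "supported s t (cutoff n)"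
proof -
  let ?m = "(a + b) / 2"
  \<comment> \<open>The second arguments of \<open>min\<close> and \<open>max\<close> ensure \<open>s < t\<close> for the small \<open>n\<close> at which the cutoff vanishes identically.\<close>
  define s where "s = min (a + 1 / real (Suc n)) ((a + ?m) / 2)"
  define t where "t = max (b - 1 / real (Suc n)) ((?m + b) / 2)"
  have "cutoff n x = 0" if "x \<notin> {s<..<t}" for x
  proof -
    have "x - a \<le> 1 / real (Suc n) \<or> b - x \<le> 1 / real (Suc n)"
      using that by (auto simp: s_def t_def not_less)
    then have "min (x - a) (b - x) \<le> 1 / real (Suc n)" by auto
    then have "real (Suc n) * min (x - a) (b - x) \<le> 1" by (simp add: pos_le_divide_eq mult.commute)
    then show ?thesis by (simp add: cutoff_def)
  qed
  then have "supported s t (cutoff n)"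
    unfolding supported_def cutoff_def[abs_def] by (auto intro!: continuous_intros)
  moreover have "a < s" "s < t" "t < b" using ends by (auto simp: s_def t_def min_less_iff_disj less_max_iff_disj)
  ultimately show thesis using that by blast
qed

lemma cutoff_limit: "x \<in> {a<..<b} \<Longrightarrow> (\<lambda>n. cutoff n x) \<longlonglongrightarrow> 1"
proof (rule tendsto_eventually)
  assume x: "x \<in> {a<..<b}"
  define d where "d = min (x - a) (b - x)"
  have d: "d > 0" using x by (simp add: d_def)
  obtain N where N: "2 / d < real N" using reals_Archimedean2 by blast
  show "\<forall>\<^sub>F n in sequentially. cutoff n x = 1"
    using eventually_ge_at_top[of N]
  proof eventually_elim
    case (elim n)
    then have "2 / d < real (Suc n)" using N by linarith
    then have "2 < real (Suc n) * d" using d by (simp add: pos_divide_less_eq)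
    then show ?case unfolding cutoff_def d_def[symmetric] by simp
  qed
qed

lemma cutoff_integral:
  assumes m: "f \<in> borel_measurable borel" and F: "\<And>x. x \<in> {a..b} \<Longrightarrow> \<bar>f x\<bar> \<le> F" and i: "i \<in> {0, 1}"
  shows "(\<lambda>n. \<integral>x. cutoff n x * f x * weight i x \<partial>lborel) \<longlonglongrightarrow> (\<integral>x. f x * weight i x \<partial>lborel)"
proof (rule integral_dominated_convergence[where w = "\<lambda>x. F * weight i x"])
  have [measurable]: "cutoff n \<in> borel_measurable borel" for n
    unfolding cutoff_def[abs_def] by measurable
  note [measurable] = m
  show "(\<lambda>x. cutoff n x * f x * weight i x) \<in> borel_measurable lborel" for n by simp
  show "(\<lambda>x. f x * weight i x) \<in> borel_measurable lborel" by simp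
  show "integrable lborel (\<lambda>x. F * weight i x)" using weight_integrable[OF i] by simp
  show "AE x in lborel. (\<lambda>n. cutoff n x * f x * weight i x) \<longlonglongrightarrow> f x * weight i x"
  proof (rule AE_I2)
    fix x show "(\<lambda>n. cutoff n x * f x * weight i x) \<longlonglongrightarrow> f x * weight i x"
    proof (cases "x \<in> {a<..<b}")
      case True
      from tendsto_mult_right[OF cutoff_limit[OF True], of "f x * weight i x"] show ?thesis by (simp add: mult.assoc)
    qed (simp add: weight_outside)
  qed
  show "AE x in lborel. norm (cutoff n x * f x * weight i x) \<le> F * weight i x" for n
  proof (rule AE_I2)
    fix x show "norm (cutoff n x * f x * weight i x) \<le> F * weight i x"
    proof (cases "x \<in> {a<..<b}")
      case True
      have "\<bar>cutoff n x * f x\<bar> \<le> 1 * F"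
        unfolding abs_mult using cutoff_range[of n x] F[of x] True by (intro mult_mono) auto
      then show ?thesis using weight_nonneg[of i x] by (simp add: abs_mult mult_right_mono)
    qed (simp add: weight_outside)
  qed
qed

text \<open>The density of the law in state \<open>0\<close> with respect to \<open>weight 0\<close>; that it is a constant is
  shown by comparing an arbitrary \<open>j\<close> with the cutoffs.\<close>

definition \<kappa> :: real where "\<kappa> = mean (\<lambda>i x. if i = 0 then 1 else 0) / mass 0"

lemma mean_state_0:
  assumes j: "supported s t j" and st: "a < s" "s \<le> t" "t < b"
  shows "mean (\<lambda>i x. if i = 0 then j x else 0) = \<kappa> * (\<integral>x. j x * weight 0 x \<partial>lborel)"
proof -
  let ?J = "mean (\<lambda>i x. if i = 0 then j x else 0)" and ?\<alpha> = "\<integral>x. j x * weight 0 x \<partial>lborel"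
  have eq: "(\<integral>x. cutoff n x * 1 * weight 0 x \<partial>lborel) * ?J = ?\<alpha> * mean (\<lambda>i x. if i = 0 then cutoff n x else 0)" for n
  proof -
    obtain s' t' where c: "a < s'" "s' < t'" "t' < b" "supported s' t' (cutoff n)" using cutoff_supported .
    show ?thesis
      using proportional[of "min s s'" "max t t'" j "cutoff n"] st c
        supported_mono[OF j, of "min s s'" "max t t'"] supported_mono[OF c(4), of "min s s'" "max t t'"] by auto
  qed
  have "(\<lambda>n. \<integral>x. cutoff n x * 1 * weight 0 x \<partial>lborel) \<longlonglongrightarrow> (\<integral>x. 1 * weight 0 x \<partial>lborel)"
    by (rule cutoff_integral[where F = 1]) auto
  then have l1: "(\<lambda>n. (\<integral>x. cutoff n x * 1 * weight 0 x \<partial>lborel) * ?J) \<longlonglongrightarrow> mass 0 * ?J"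
    unfolding mass_def by (intro tendsto_mult tendsto_const) simp
  have "(\<lambda>n. mean (\<lambda>i x. if i = 0 then cutoff n x else 0)) \<longlonglongrightarrow> mean (\<lambda>i x. if i = 0 then 1 else 0)"
  proof (rule mean_limit[where F = 1])
    fix n
    obtain s' t' where c: "supported s' t' (cutoff n)" using cutoff_supported[of n] by metis
    show "admissible (\<lambda>i x. if i = 0 then cutoff n x else 0)" by (rule supported_admissible[OF c supported_zero])
    show "\<bar>if i = 0 then cutoff n x else 0\<bar> \<le> 1" for i :: nat and x
      using cutoff_range[of n x] by simp
  qed (auto simp: admissible_def cutoff_limit intro!: exI[of _ 1])
  then have "(\<lambda>n. ?\<alpha> * mean (\<lambda>i x. if i = 0 then cutoff n x else 0)) \<longlonglongrightarrow> ?\<alpha> * mean (\<lambda>i x. if i = 0 then 1 else 0)"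
    by (intro tendsto_mult tendsto_const)
  from LIMSEQ_unique[OF l1[unfolded eq] this] show ?thesis
    using mass_pos[of 0] by (simp add: \<kappa>_def field_simps)
qed

text \<open>Subtracting the flux balance for \<open>k = f 1 / (c 1 - u)\<close> removes the contribution of state \<open>1\<close> and
  turns it into one of state \<open>0\<close>, to which \<open>mean_state_0\<close> applies.\<close>

lemma mean_supported:
  assumes j: "supported s t (f 0)" "supported s t (f 1)" and st: "a < s" "s \<le> t" "t < b"
  shows "mean (\<lambda>i x. if i = 0 then f 0 x else f 1 x) = \<kappa> * stat_fun f"
proof -
  define k where "k x = f 1 x * (1 / (c 1 - u x))" for x
  have sk: "supported s t k" unfolding k_def[abs_def] by (rule supported_mult[OF j(2) cont_inverse_drift(2) st(1,3)])
  have sdk: "supported s t (\<lambda>x. (c i - u x) * k x)" for i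
    using sk by (auto simp: supported_def intro!: continuous_intros cont_u)
  have sd: "supported s t (\<lambda>x. 1 * f 0 x - 1 * ((c 0 - u x) * k x))" by (rule supported_linear[OF j(1) sdk])
  have w1: "(c 0 - u x) * k x * weight 0 x = - (f 1 x * weight 1 x)" for x
  proof (cases "x \<in> {a<..<b}")
    case True
    have "(c 0 - u x) * k x * weight 0 x = k x * ((c 0 - u x) * weight 0 x)" by (simp add: mult_ac)
    also have "\<dots> = k x * - ((c 1 - u x) * weight 1 x)" unfolding drift_weight by simp
    also have "\<dots> = - (f 1 x * weight 1 x)" using u_strict[OF True] by (simp add: k_def)
    finally show ?thesis .
  qed (simp add: weight_outside)
  have int: "integrable lborel (\<lambda>x. k x * weight i x)" if k: "supported s t k" and i: "i \<in> {0, 1}" for k i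
  proof -
    obtain B where B: "\<And>x. \<bar>k x\<bar> \<le> B" using supported_bounded[OF k] by metis
    have "k \<in> borel_measurable borel" using k by (simp add: supported_def borel_measurable_continuous_onI)
    then show ?thesis by (rule weight_mult_integrable(1)[OF _ B i])
  qed
  note ad1 = supported_admissible[OF j] and ad2 = supported_admissible[OF sdk[of 0] sdk[of 1]]
  have "mean (\<lambda>i x. if i = 0 then f 0 x else f 1 x)
      = mean (\<lambda>i x. 1 * (if i = 0 then f 0 x else f 1 x) - 1 * (if i = 0 then (c 0 - u x) * k x else (c 1 - u x) * k x))"
    unfolding mean_linear[OF ad1 ad2] flux_balance[OF sk st] by simp
  also have "\<dots> = mean (\<lambda>i x. if i = 0 then 1 * f 0 x - 1 * ((c 0 - u x) * k x) else 0)"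
  proof (rule mean_cong)
    have "(\<lambda>i x. 1 * (if i = 0 then f 0 x else f 1 x) - 1 * (if i = 0 then (c 0 - u x) * k x else (c 1 - u x) * k x))
      = (\<lambda>(i::nat) x. if i = 0 then 1 * f 0 x - 1 * ((c 0 - u x) * k x) else 1 * f 1 x - 1 * ((c 1 - u x) * k x))"
      by (auto simp: fun_eq_iff)
    then show "admissible (\<lambda>i x. 1 * (if i = 0 then f 0 x else f 1 x) - 1 * (if i = 0 then (c 0 - u x) * k x else (c 1 - u x) * k x))"
      using supported_admissible[OF sd supported_linear[OF j(2) sdk]] by simp
    show "admissible (\<lambda>i x. if i = 0 then 1 * f 0 x - 1 * ((c 0 - u x) * k x) else 0)"
      by (rule supported_admissible[OF sd supported_zero])
  qed (use u_strict in \<open>force simp: k_def\<close>)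
  also have "\<dots> = \<kappa> * (\<integral>x. (1 * f 0 x - 1 * ((c 0 - u x) * k x)) * weight 0 x \<partial>lborel)"
    by (rule mean_state_0[OF sd st])
  also have "(\<integral>x. (1 * f 0 x - 1 * ((c 0 - u x) * k x)) * weight 0 x \<partial>lborel)
      = (\<integral>x. f 0 x * weight 0 x + f 1 x * weight 1 x \<partial>lborel)"
  proof (rule Bochner_Integration.integral_cong[OF refl])
    fix x
    have "(1 * f 0 x - 1 * ((c 0 - u x) * k x)) * weight 0 x = f 0 x * weight 0 x - (c 0 - u x) * k x * weight 0 x"
      by (simp only: mult_1 left_diff_distrib[of "f 0 x"])
    then show "(1 * f 0 x - 1 * ((c 0 - u x) * k x)) * weight 0 x = f 0 x * weight 0 x + f 1 x * weight 1 x"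
      unfolding w1 by simp
  qed
  also have "\<dots> = stat_fun f" unfolding stat_fun_def using int[OF j(1), of 0] int[OF j(2), of 1] by simp
  finally show ?thesis .
qed

lemma mean_eq_stat_fun:
  assumes f: "test_function f" shows "mean f = \<kappa> * stat_fun f"
proof -
  obtain F where F: "\<And>i x. i \<in> {0, 1} \<Longrightarrow> \<bar>f i x\<bar> \<le> F" using test_function_bounded[OF f] by blast
  define fn where "fn n i x = cutoff n x * f i x" for n i x
  have cf: "continuous_on UNIV (f i)" if "i \<in> {0, 1}" for i by (rule test_function_D(1)[OF f that])
  have eq: "mean (\<lambda>i x. if i = 0 then fn n 0 x else fn n 1 x) = \<kappa> * stat_fun (fn n)" for n
  proof -
    obtain s t where c: "a < s" "s < t" "t < b" "supported s t (cutoff n)" using cutoff_supported .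
    have "supported s t (fn n i)" if "i \<in> {0, 1}" for i
      unfolding fn_def[abs_def] by (rule supported_mult[OF c(4) continuous_on_subset[OF cf[OF that]] c(1,3)]) simp
    then show ?thesis using c by (intro mean_supported) auto
  qed
  have adm: "admissible f" unfolding admissible_def using test_function_D(2)[OF f] F by blast
  have "(\<lambda>n. mean (\<lambda>i x. if i = 0 then fn n 0 x else fn n 1 x)) \<longlonglongrightarrow> mean f"
  proof (rule mean_limit[OF _ adm, where F = F])
    fix n
    obtain s t where c: "a < s" "s < t" "t < b" "supported s t (cutoff n)" using cutoff_supported .
    have "supported s t (fn n i)" if "i \<in> {0, 1}" for i
      unfolding fn_def[abs_def] by (rule supported_mult[OF c(4) continuous_on_subset[OF cf[OF that]] c(1,3)]) simp
    then show "admissible (\<lambda>i x. if i = 0 then fn n 0 x else fn n 1 x)" by (intro supported_admissible) auto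
    fix i :: nat and x assume i: "i \<in> {0, 1}"
    have "\<bar>fn n i x\<bar> \<le> 1 * F"
      unfolding fn_def abs_mult using cutoff_range[of n x] F[OF i] by (intro mult_mono) auto
    then show "\<bar>if i = 0 then fn n 0 x else fn n 1 x\<bar> \<le> F" using i by auto
  next
    fix i :: nat and x assume i: "i \<in> {0, 1}" and x: "x \<in> {a<..<b}"
    have "(\<lambda>n. fn n i x) \<longlonglongrightarrow> 1 * f i x"
      unfolding fn_def by (intro tendsto_mult cutoff_limit[OF x] tendsto_const)
    then show "(\<lambda>n. if i = 0 then fn n 0 x else fn n 1 x) \<longlonglongrightarrow> f i x" using i by auto
  qed
  moreover have "(\<lambda>n. \<kappa> * stat_fun (fn n)) \<longlonglongrightarrow> \<kappa> * stat_fun f"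
    unfolding stat_fun_def fn_def using test_function_D(2)[OF f] F
    by (intro tendsto_mult tendsto_const tendsto_add cutoff_integral) auto
  ultimately show ?thesis unfolding eq by (rule LIMSEQ_unique)
qed

lemma law_unique: "\<mu> = stat_measure"
proof -
  interpret prob_space \<mu> by (rule prob_\<mu>)
  have one: "test_function (\<lambda>_ _. 1)" unfolding test_function_def
    by (intro exI[of _ "\<lambda>_ _. 0"] exI[of _ 1]) auto
  have "1 = \<kappa> * (mass 0 + mass 1)"
    using mean_eq_stat_fun[OF one] by (simp add: mean_def stat_fun_def mass_def prob_space)
  then have \<kappa>: "\<kappa> = norm_const" using mass_pos[of 0] mass_pos[of 1] by (simp add: norm_const_def field_simps)
  show ?thesis
  proof (rule measure_eqI_test_functions[OF finite_measure_axioms sets_\<mu> _ sets_stat_measure])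
    show "finite_measure stat_measure" using stat_measure_prob by (simp add: prob_space.finite_measure)
    fix f assume f: "test_function f"
    obtain F where F: "\<And>i x. i \<in> {0, 1} \<Longrightarrow> \<bar>f i x\<bar> \<le> F" using test_function_bounded[OF f] by blast
    show "(\<integral>z. f (snd z) (fst z) \<partial>\<mu>) = (\<integral>z. f (snd z) (fst z) \<partial>stat_measure)"
      using mean_eq_stat_fun[OF f] stat_measure_integral[of f F, OF test_function_D(2)[OF f] F]
      by (simp add: mean_def \<kappa>)
  qed
qed

end

section \<open>The stationary densities\<close>

context switched_flow
begin

lemma mass_set_integral:
  "(LBINT x:{a<..<b}. Psi_inv lam \<Phi> x / (c 0 - deriv U x)) = mass 0"
  "(LBINT x:{a<..<b}. Psi_inv lam \<Phi> x / (deriv U x - c 1)) = mass 1"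
proof -
  have "indicator {a<..<b} x *\<^sub>R (Psi_inv lam \<Phi> x / (c 0 - deriv U x)) = weight 0 x
      \<and> indicator {a<..<b} x *\<^sub>R (Psi_inv lam \<Phi> x / (deriv U x - c 1)) = weight 1 x" for x
  proof (cases "x \<in> {a<..<b}")
    case True
    with u_strict[OF True] show ?thesis by (auto simp: weight_def flux_def deriv_U)
  qed (auto simp: weight_outside)
  then show "(LBINT x:{a<..<b}. Psi_inv lam \<Phi> x / (c 0 - deriv U x)) = mass 0"
    "(LBINT x:{a<..<b}. Psi_inv lam \<Phi> x / (deriv U x - c 1)) = mass 1"
    unfolding set_lebesgue_integral_def mass_def by simp_all
qed

text \<open>Both constants are \<open>1 / (mass 0 + mass 1)\<close>, because \<open>lam 0 * mass 0 = lam 1 * mass 1\<close>.\<close>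

lemma normalising_constants:
  "C0 U c lam \<Phi> a b = norm_const" "C1 U c lam \<Phi> a b = norm_const"
proof -
  have m1: "mass 1 = lam 0 * mass 0 / lam 1" using mass_balance lam_pos by (simp add: field_simps)
  have m0: "mass 0 = lam 1 * mass 1 / lam 0" using mass_balance lam_pos by (simp add: field_simps)
  have pos: "0 < mass 0" "0 < mass 1" by (auto intro: mass_pos)
  have "mass 0 + mass 1 = mass 0 * ((lam 0 + lam 1) / lam 1)"
    unfolding m1 using lam_pos by (simp add: field_simps)
  then show "C0 U c lam \<Phi> a b = norm_const"
    unfolding C0_def mass_set_integral norm_const_def using lam_pos pos by (simp add: inverse_eq_divide)
  have "mass 0 + mass 1 = mass 1 * ((lam 0 + lam 1) / lam 0)"
    unfolding m0 using lam_pos by (simp add: field_simps)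
  then show "C1 U c lam \<Phi> a b = norm_const"
    unfolding C1_def mass_set_integral norm_const_def using lam_pos pos by (simp add: inverse_eq_divide)
qed

lemma stat_measure_eq: "stat_measure = measure_of_densities {a<..<b} (stat_density U c lam \<Phi> a b)"
proof -
  let ?L = "lborel \<Otimes>\<^sub>M count_space {0, 1 :: nat}"
  have m: "(\<lambda>z. ennreal (norm_const * weight (snd z) (fst z))) \<in> borel_measurable ?L"
    using weight_state_measurable by simp
  have eq: "ennreal (norm_const * weight (snd z) (fst z))
      = (case z of (x, i) \<Rightarrow> ennreal (stat_density U c lam \<Phi> a b i x) * indicator {a<..<b} x)"
    if z: "z \<in> space ?L" for z
  proof -
    obtain x i where xi: "z = (x, i)" "i \<in> {0, 1}" using z by (auto simp: space_pair_measure)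
    show ?thesis
    proof (cases "x \<in> {a<..<b}")
      case True
      with u_strict[OF True] xi(2) show ?thesis
        by (auto simp: xi(1) stat_density_def normalising_constants weight_def flux_def deriv_U)
    qed (auto simp: xi(1) weight_outside)
  qed
  show ?thesis
    unfolding stat_measure_def measure_of_densities_def
    by (rule density_cong[OF m measurable_cong[THEN iffD1, OF eq m] AE_I2[OF eq]])
qed

lemma invariant_measure_unique:
  assumes "invariant_measure (transition M \<xi> X) \<mu>" "has_support \<mu> {a<..<b}"
  shows "\<mu> = stat_measure"
proof -
  have \<mu>: "prob_space \<mu>" "sets \<mu> = sets state_space" "AE z in \<mu>. fst z \<in> {a<..<b}"
    using assms by (auto simp: invariant_measure_def has_support_def)
  have bind: "\<mu> \<bind> inner_kernel t = \<mu>" if "t \<ge> 0" for t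
    using invariant_measure_iff_bind[OF \<mu>(2,3)] assms(1) that by blast
  interpret invariant_law u u' c lam a b l r \<Phi> U M \<xi> X \<mu>
    by (rule invariant_law.intro[OF switched_flow_axioms invariant_law_axioms.intro[OF \<mu> bind]])
  show ?thesis by (rule law_unique)
qed

end

theorem theorem4p1:
  fixes U :: "real \<Rightarrow> real" and c lam :: "nat \<Rightarrow> real" and \<Phi> :: "nat \<Rightarrow> real \<Rightarrow> real"
    and xm x0 xp V v a b :: real
    and M :: "nat \<Rightarrow> 'w measure"
    and \<xi> :: "nat \<Rightarrow> real \<Rightarrow> 'w \<Rightarrow> nat"
    and X :: "nat \<Rightarrow> real \<Rightarrow> real \<Rightarrow> 'w \<Rightarrow> real"
  assumes "double_well U xm x0 xp"
    and "c 0 > c 1"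
    and "lam 0 > 0" and "lam 1 > 0"
    and "\<And>i. i \<in> {0, 1} \<Longrightarrow> divergent_at_crit_points (tilted U (c i))"
    and "the_local_max_value (deriv U) V" and "the_local_min_value (deriv U) v"
    and "is_attractor U c V v a b"
    and "\<And>i. i \<in> {0, 1} \<Longrightarrow> two_state_markov (M i) lam i (\<xi> i)"
    and "\<And>i x. i \<in> {0, 1} \<Longrightarrow> x \<in> {a<..<b} \<Longrightarrow> solves_switched_ode (M i) U c (\<xi> i) x (X i x)"
    and "\<And>i y. i \<in> {0, 1} \<Longrightarrow> y \<in> {a<..<b} \<Longrightarrow>
           (\<Phi> i has_real_derivative 1 / (c i - deriv U y)) (at y)"
  shows "\<forall>\<mu>. (invariant_measure (transition M \<xi> X) \<mu> \<and> has_support \<mu> {a<..<b}) \<longleftrightarrow>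
             \<mu> = measure_of_densities {a<..<b} (stat_density U c lam \<Phi> a b)"
proof -
  have "C2 U" using assms(1) by (simp add: double_well_def)
  note D = C2_D[OF this]
  obtain l r where lr: "l < a" "a < b" "b < r" "strict_mono_on {l..r} (deriv U)"
    "deriv U a = c 1" "deriv U b = c 0"
    using attractor_in_increasing_branch[OF assms(1,6-8)] .
  interpret switched_flow "deriv U" "deriv (deriv U)" c lam a b l r \<Phi> U M \<xi> X
    by (unfold_locales; (fact D lr assms(3,4) refl | erule (1) assms(9-11) | erule assms(9-11)))
  show ?thesis
    using stat_measure_invariant stat_measure_support invariant_measure_unique
    unfolding stat_measure_eq by blast
qed

end
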